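(* Let $\Omega\subseteq\mathbb{R}^n$ be an open convex set and $\varphi:\Omega\to(0,\infty)$ a $C^2$ convex function with $D^2\varphi$ positive definite on $\Omega$. Let $\beta\ge n+1$ with $\int_\Omega\varphi^{-\beta}dx<\infty$, and let $\mu_\beta$ be the probability measure $d\mu_\beta=\frac{\varphi(x)^{-\beta}}{\int_\Omega\varphi^{-\beta}}dx$ on $\Omega$. Then for every locally Lipschitz $f\in L^2(\mu_\beta)$, $$\mathrm{Var}_{\mu_\beta}(f)\le\frac1{\beta-1}\int_\Omega\langle(D^2\varphi)^{-1}\nabla f,\nabla f\rangle\,\varphi\,d\mu_\beta.$$
   Context: For a probability measure $\mu$, $\mathrm{Var}_\mu(f)=\int f^2d\mu-(\int f\,d\mu)^2$; $\langle\cdot,\cdot\rangle$ is the Euclidean inner product. *)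

theory Defs
  imports "HOL-Analysis.Analysis"
begin

text \<open>Gradient of a real-valued function on real vectors (meaningful where f is differentiable;
  by Rademacher this is almost everywhere for locally Lipschitz f).\<close>
definition grad :: "(real^'n \<Rightarrow> real) \<Rightarrow> real^'n \<Rightarrow> real^'n" where
  "grad f x = (SOME D. GDERIV f x :> D)"

definition locally_lipschitz_on :: "(real^'n) set \<Rightarrow> (real^'n \<Rightarrow> real) \<Rightarrow> bool" where
  "locally_lipschitz_on S f \<longleftrightarrow> (\<forall>x\<in>S. \<exists>e>0. \<exists>L. L-lipschitz_on (ball x e \<inter> S) f)"

definition mu_beta :: "(real^'n) set \<Rightarrow> (real^'n \<Rightarrow> real) \<Rightarrow> real \<Rightarrow> (real^'n) measure" where
  "mu_beta \<Omega> \<phi> \<beta> = density lebesgue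
     (\<lambda>x. ennreal (indicator \<Omega> x * \<phi> x powr (-\<beta>) / (\<integral>y\<in>\<Omega>. \<phi> y powr (-\<beta>) \<partial>lebesgue)))"

end

theory Submission
  imports Defs
begin

text \<open>
  The weight \<open>\<phi> powr - \<beta>\<close> is, up to the factor \<open>Gamma \<beta>\<close>, the marginal in \<open>x = y / t\<close> of the density
  \<open>t powr (\<beta> - n - 1) * exp (- t * \<phi> (y / t))\<close> on a convex cone in dimension \<open>n + 1\<close>.  The perspective
  \<open>t * \<phi> (y / t)\<close> is convex, so this density is log-concave as soon as \<open>\<beta> \<ge> n + 1\<close>, and the claim is the
  Brascamp-Lieb inequality for the function \<open>f (y / t)\<close>: its energy density is \<open>1 / t\<close> times the one of \<open>f\<close>, and
  integrating out \<open>t\<close> produces the constant \<open>Gamma (\<beta> - 1) / Gamma \<beta> = 1 / (\<beta> - 1)\<close>.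

  The Brascamp-Lieb inequality is the second-order term, as \<open>s \<rightarrow> 0\<close>, of the Prekopa-Leindler inequality for the
  densities multiplied by \<open>exp (s * f)\<close> and \<open>exp (- s * f)\<close>.  At points where \<open>f\<close> is differentiable their supremal
  midpoint convolution exceeds the unperturbed density by the factor \<open>1 + s\<^sup>2 * q / (2 * t) + o (s\<^sup>2)\<close> with
  \<open>q\<close> the inverse-Hessian energy of \<open>f\<close>, so only Rademacher's theorem and dominated convergence are needed,
  and no smoothing of \<open>f\<close>.  All of this is done on relatively compact convex open subsets for \<open>\<beta> > n + 1\<close>
  (strict convexity in the radial direction); then \<open>\<beta>\<close> decreases to \<open>n + 1\<close> and the subsets exhaust \<open>\<Omega>\<close>.
\<close>

subsection \<open>The Prekopa-Leindler inequality\<close>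

text \<open>Opposite signs of the perturbation cancel the first order: with moments Z, M1, M2 of f
  the product of the two integrals is \<open>Z\<^sup>2 + s\<^sup>2 * (Z * M2 - M1\<^sup>2)\<close>
  up to higher order. The factor \<open>q / (2 * t)\<close> comes from maximising
  \<open>s * (g \<bullet> k) - t / 4 * (k \<bullet> (H *v k))\<close> over the displacement k of the
  two base points; the maximum is \<open>s\<^sup>2 * q / t\<close>, attained at size O(s), so only
  first-order data of f at the midpoint matter. The obstacle is that the perspective is linear along
  rays: at very unequal heights the convexity gain carries a small factor \<theta> (1 - \<theta>)
  and cannot pay for the difference of f. The power \<open>t powr \<alpha>\<close> with \<alpha> =
  \<beta> - n - 1 pays instead, through
  \<open>\<alpha> * ln (4 * \<theta> * (1 - \<theta>))\<close>, which vanishes only at equal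
  heights; hence \<alpha> > 0 comes first. Compactness bounds the Hessian below by some
  \<open>c > 0\<close>, which bounds the second-order quotient by a multiple of 1 / t, integrable
  against the cone density.\<close>

lemma emeasure_Int_atMost_approx:
  fixes A :: "real set"
  assumes A: "A \<in> sets lborel" "A \<noteq> {}" and c: "c < emeasure lborel A"
  obtains a where "a \<in> A" "c < emeasure lborel (A \<inter> {..a})"
proof -
  have mono: "emeasure lborel (A \<inter> {..a}) \<le> emeasure lborel (A \<inter> {..b})" if "a \<le> b" for a b
    using that A(1) by (intro emeasure_mono) auto
  have "(SUP n::nat. emeasure lborel (A \<inter> {..real n})) = emeasure lborel (\<Union>n::nat. A \<inter> {..real n})"
    using A(1) by (intro SUP_emeasure_incseq) (auto simp: incseq_def)
  also have "(\<Union>n::nat. A \<inter> {..real n}) = A"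
    using real_arch_simple by auto
  finally obtain n :: nat where n: "c < emeasure lborel (A \<inter> {..real n})"
    using c by (metis (no_types, lifting) less_SUP_iff)
  show ?thesis
  proof (cases "bdd_above A")
    case False
    then obtain a where "a \<in> A" "real n \<le> a"
      by (metis bdd_above.unfold linear)
    then show ?thesis
      using that n mono order_less_le_trans by blast
  next
    case True
    define s where "s = Sup A"
    have le_s: "x \<le> s" if "x \<in> A" for x
      unfolding s_def using that True by (rule cSup_upper)
    \<comment> \<open>The cut has to be made at a point of \<open>A\<close>, because Brunn-Minkowski
      translates the other set by it; \<open>s\<close> itself serves only if it is attained.\<close>
    show ?thesis
    proof (cases "s \<in> A")
      case True
      moreover have "A \<inter> {..s} = A" using le_s by auto
      ultimately show ?thesis using that c by metis
    next
      case False
      have "(SUP n::nat. emeasure lborel (A \<inter> {..s - 1 / Suc n})) = emeasure lborel (\<Union>n::nat. A \<inter> {..s - 1 / Suc n})"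
        using A(1) by (intro SUP_emeasure_incseq) (auto simp: incseq_def field_simps intro: order_trans)
      also have "(\<Union>n::nat. A \<inter> {..s - 1 / Suc n}) = A"
      proof -
        have "\<exists>n::nat. x \<le> s - 1 / Suc n" if "x \<in> A" for x
        proof -
          have "0 < s - x" using le_s[OF that] False that by (auto simp: order_less_le)
          then obtain n where "1 / Suc n < s - x" using nat_approx_posE by blast
          then show ?thesis by (intro exI[of _ n]) simp
        qed
        then show ?thesis by auto
      qed
      finally obtain n :: nat where n: "c < emeasure lborel (A \<inter> {..s - 1 / Suc n})"
        using c by (metis (no_types, lifting) less_SUP_iff)
      obtain a where a: "a \<in> A" "s - 1 / Suc n < a"
        using less_cSup_iff[OF A(2) True, of "s - 1 / Suc n"] by (auto simp: s_def)
      have "c < emeasure lborel (A \<inter> {..a})"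
        using n mono[of "s - 1 / Suc n" a] a by (simp add: order_less_le_trans)
      then show ?thesis using that a by blast
    qed
  qed
qed

lemma emeasure_lborel_vimage_affine:
  fixes A :: "real set"
  assumes A: "A \<in> sets lborel" and "c \<noteq> 0"
  shows "emeasure lborel A = ennreal \<bar>c\<bar> * emeasure lborel {x. t + c * x \<in> A}"
proof -
  have "emeasure lborel A = (\<integral>\<^sup>+x. indicator A x \<partial>lborel)"
    using A by simp
  also have "\<dots> = ennreal \<bar>c\<bar> * (\<integral>\<^sup>+x. indicator A (t + c * x) \<partial>lborel)"
    using A by (intro nn_integral_real_affine assms) simp
  also have "(\<integral>\<^sup>+x. indicator A (t + c * x) \<partial>lborel) = (\<integral>\<^sup>+x. indicator {x. t + c * x \<in> A} x \<partial>lborel)"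
    by (intro nn_integral_cong) (auto simp: indicator_def)
  also have "\<dots> = emeasure lborel {x. t + c * x \<in> A}"
  proof (intro nn_integral_indicator)
    have "(\<lambda>x. t + c * x) -` A \<inter> space borel \<in> sets borel"
      using A by (intro measurable_sets[where A=borel]) auto
    then show "{x. t + c * x \<in> A} \<in> sets lborel"
      by (simp add: vimage_def)
  qed
  finally show ?thesis .
qed

text \<open>Cut \<open>A\<close> above at a point a of \<open>A\<close> and \<open>B\<close> below
  at a point b of \<open>B\<close>. The halved translates of \<open>A \<inter> {..a}\<close> by b
  and of \<open>B \<inter> {b..}\<close> by a both lie in \<open>C\<close> and meet at most in (a +
  b) / 2, so their measures add up. Suprema over the cuts give the claim.\<close>

lemma Brunn_Minkowski_midpoint_real:
  fixes A B C :: "real set"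
  assumes A: "A \<in> sets lborel" "A \<noteq> {}" and B: "B \<in> sets lborel" "B \<noteq> {}" and C: "C \<in> sets lborel"
    and mid: "\<And>x y. x \<in> A \<Longrightarrow> y \<in> B \<Longrightarrow> (x + y) / 2 \<in> C"
  shows "emeasure lborel A + emeasure lborel B \<le> 2 * emeasure lborel C"
proof -
  have key: "emeasure lborel (A \<inter> {..a}) + emeasure lborel (B \<inter> {b..}) \<le> 2 * emeasure lborel C"
    if a: "a \<in> A" and b: "b \<in> B" for a b
  proof -
    let ?A = "{z. - b + 2 * z \<in> A \<inter> {..a}}" and ?B = "{z. - a + 2 * z \<in> B \<inter> {b..}}"
    have meas: "?A \<in> sets lborel" "?B \<in> sets lborel"
      using A(1) B(1) by measurable
    have sub: "?A \<union> ?B \<subseteq> C"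
    proof
      fix z assume "z \<in> ?A \<union> ?B"
      then show "z \<in> C"
        using mid[of "2 * z - b" b] mid[of a "2 * z - a"] a b by auto
    qed
    have disj: "?A \<inter> ?B \<subseteq> {(a + b) / 2}" by auto
    have "emeasure lborel (?A \<inter> ?B) \<le> emeasure lborel {(a + b) / 2}"
      using disj by (intro emeasure_mono) auto
    then have 0: "emeasure lborel (?A \<inter> ?B) = 0" by simp
    have "emeasure lborel ?A + emeasure lborel ?B = emeasure lborel (?A \<union> ?B) + emeasure lborel (?A \<inter> ?B)"
      using meas by (intro emeasure_Un_Int) auto
    also have "\<dots> \<le> emeasure lborel C"
      using 0 sub C by (simp add: emeasure_mono)
    finally have "2 * (emeasure lborel ?A + emeasure lborel ?B) \<le> 2 * emeasure lborel C"
      by (intro mult_left_mono) auto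
    moreover have "emeasure lborel (A \<inter> {..a}) = 2 * emeasure lborel ?A"
      using emeasure_lborel_vimage_affine[of "A \<inter> {..a}" 2 "-b"] A(1) by (simp add: ennreal_numeral)
    moreover have "emeasure lborel (B \<inter> {b..}) = 2 * emeasure lborel ?B"
      using emeasure_lborel_vimage_affine[of "B \<inter> {b..}" 2 "-a"] B(1) by (simp add: ennreal_numeral)
    ultimately show ?thesis by (simp add: distrib_left)
  qed
  have le_SUP_A: "emeasure lborel A \<le> (SUP a\<in>A. emeasure lborel (A \<inter> {..a}))"
  proof (rule dense_le)
    fix c assume "c < emeasure lborel A"
    then obtain a where "a \<in> A" "c < emeasure lborel (A \<inter> {..a})"
      using emeasure_Int_atMost_approx[OF A] by blast
    then show "c \<le> (SUP a\<in>A. emeasure lborel (A \<inter> {..a}))"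
      by (meson SUP_upper2 less_imp_le)
  qed
  have le_SUP_B: "emeasure lborel B \<le> (SUP b\<in>B. emeasure lborel (B \<inter> {b..}))"
  proof (rule dense_le)
    fix d assume d: "d < emeasure lborel B"
    \<comment> \<open>A lower cut of \<open>B\<close> is an upper cut of its reflection, written in
      the affine form of \<open>emeasure_lborel_vimage_affine\<close>.\<close>
    let ?B = "{x. 0 + (-1) * x \<in> B}"
    have B'm: "?B \<in> sets lborel" using B(1) by measurable
    have "emeasure lborel B = emeasure lborel ?B"
      using emeasure_lborel_vimage_affine[of B "-1" 0] B(1) by simp
    moreover have "?B \<noteq> {}"
      using B(2) by (metis (mono_tags, lifting) add_0 all_not_in_conv mem_Collect_eq minus_minus mult_minus1)
    ultimately obtain b where b: "b \<in> ?B" "d < emeasure lborel (?B \<inter> {..b})"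
      using d emeasure_Int_atMost_approx[OF B'm, of d] by auto
    have "emeasure lborel (B \<inter> {-b..}) = emeasure lborel {x. 0 + (-1) * x \<in> (B \<inter> {-b..})}"
      using emeasure_lborel_vimage_affine[of "B \<inter> {-b..}" "-1" 0] B(1) by simp
    also have "{x. 0 + (-1) * x \<in> (B \<inter> {-b..})} = ?B \<inter> {..b}" by auto
    finally have "d \<le> emeasure lborel (B \<inter> {-b..})" using b by simp
    then show "d \<le> (SUP b\<in>B. emeasure lborel (B \<inter> {b..}))"
      using b(1) by (intro SUP_upper2[of "-b"]) auto
  qed
  have "emeasure lborel A + emeasure lborel B
      \<le> (SUP a\<in>A. emeasure lborel (A \<inter> {..a})) + (SUP b\<in>B. emeasure lborel (B \<inter> {b..}))"
    by (intro add_mono le_SUP_A le_SUP_B)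
  also have "\<dots> = (SUP b\<in>B. SUP a\<in>A. emeasure lborel (A \<inter> {..a}) + emeasure lborel (B \<inter> {b..}))"
    using A(2) B(2) by (simp add: ennreal_SUP_add_left[symmetric] ennreal_SUP_add_right)
  also have "\<dots> \<le> 2 * emeasure lborel C"
    by (intro SUP_least key)
  finally show ?thesis .
qed

section \<open>Layer cake and the Prekopa-Leindler inequality on the line\<close>

lemma ennreal_eq_nn_integral_superlevel:
  fixes a :: ennreal
  shows "a = (\<integral>\<^sup>+l. indicator {l. 0 \<le> l \<and> ennreal l < a} l \<partial>lborel)"
proof (cases a)
  case (real r)
  then have "{l. 0 \<le> l \<and> ennreal l < a} = {0..<r}"
    by (auto simp: ennreal_less_iff)
  then show ?thesis using real by simp
next
  case top
  have "{l. 0 \<le> l \<and> ennreal l < a} = {0..}"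
    using top by auto
  moreover have "emeasure lborel {0::real..} = \<infinity>"
  proof -
    have "ennreal (real n) \<le> emeasure lborel {0::real..}" for n
    proof -
      have "emeasure lborel {0..real n} \<le> emeasure lborel {0::real..}" by (intro emeasure_mono) auto
      then show ?thesis by simp
    qed
    then show ?thesis
      by (metis ennreal_SUP_of_nat_eq_top SUP_least ennreal_of_nat_eq_real_of_nat infinity_ennreal_def top.extremum_unique)
  qed
  ultimately show ?thesis using top by simp
qed

lemma nn_integral_superlevel:
  fixes f :: "'a \<Rightarrow> ennreal"
  assumes "sigma_finite_measure M" and f[measurable]: "f \<in> borel_measurable M"
  shows "(\<integral>\<^sup>+x. f x \<partial>M) = (\<integral>\<^sup>+l. indicator {0..} l * emeasure M {x\<in>space M. ennreal l < f x} \<partial>lborel)"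
proof -
  interpret sigma_finite_measure M by fact
  interpret P: pair_sigma_finite M lborel ..
  have "(\<integral>\<^sup>+x. f x \<partial>M) = (\<integral>\<^sup>+x. \<integral>\<^sup>+l. indicator {0..} l * indicator {x\<in>space M. ennreal l < f x} x \<partial>lborel \<partial>M)"
  proof (intro nn_integral_cong)
    fix x assume "x \<in> space M"
    then show "f x = (\<integral>\<^sup>+l. indicator {0..} l * indicator {x\<in>space M. ennreal l < f x} x \<partial>lborel)"
      by (subst ennreal_eq_nn_integral_superlevel, intro nn_integral_cong) (auto split: split_indicator)
  qed
  also have "\<dots> = (\<integral>\<^sup>+l. \<integral>\<^sup>+x. indicator {0..} l * indicator {x\<in>space M. ennreal l < f x} x \<partial>M \<partial>lborel)"
    by (rule P.Fubini'[symmetric]) measurable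
  also have "\<dots> = (\<integral>\<^sup>+l. indicator {0..} l * emeasure M {x\<in>space M. ennreal l < f x} \<partial>lborel)"
    by (intro nn_integral_cong) (simp add: nn_integral_cmult)
  finally show ?thesis .
qed

lemma ennreal_mult_strict_mono:
  fixes a b c d :: ennreal
  assumes "a < b" "c < d"
  shows "a * c < b * d"
proof -
  obtain r where r: "a = ennreal r" "0 \<le> r" using assms(1) by (cases a) auto
  obtain s where s: "c = ennreal s" "0 \<le> s" using assms(2) by (cases c) auto
  have nz: "b \<noteq> 0" "d \<noteq> 0" using assms by auto
  show ?thesis
  proof (cases "b = top \<or> d = top")
    case True
    then have "b * d = top" using nz by (auto simp: ennreal_mult_eq_top_iff)
    then show ?thesis using r s by (simp add: ennreal_mult[symmetric])
  next
    case False
    then obtain r' s' where "b = ennreal r'" "0 \<le> r'" "d = ennreal s'" "0 \<le> s'"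
      by (cases b; cases d) auto
    then show ?thesis
      using assms r s by (simp add: ennreal_less_iff ennreal_mult[symmetric] mult_strict_mono')
  qed
qed

lemma ennreal_square_le_iff:
  fixes a b :: ennreal
  shows "a\<^sup>2 \<le> b\<^sup>2 \<longleftrightarrow> a \<le> b"
proof
  assume "a\<^sup>2 \<le> b\<^sup>2"
  then show "a \<le> b"
    using ennreal_mult_strict_mono[of b a b a] by (auto simp: power2_eq_square not_less[symmetric])
next
  assume "a \<le> b"
  then show "a\<^sup>2 \<le> b\<^sup>2" by (intro power_mono) auto
qed

lemma ennreal_AM_GM:
  fixes a b :: ennreal
  shows "4 * (a * b) \<le> (a + b)\<^sup>2"
proof (cases a; cases b)
  fix r s assume *: "a = ennreal r" "0 \<le> r" "b = ennreal s" "0 \<le> s"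
  have "4 * (r * s) \<le> (r + s)\<^sup>2"
    using zero_le_power2[of "r - s"] by (simp add: power2_eq_square algebra_simps)
  then have "ennreal (4 * (r * s)) \<le> ennreal ((r + s)\<^sup>2)" by (rule ennreal_leI)
  then show ?thesis using *
    by (simp add: ennreal_mult ennreal_power[symmetric] del: ennreal_plus) (simp add: ennreal_numeral)
qed (auto simp: power2_eq_square ennreal_top_mult ennreal_mult_top)

text \<open>Equal suprema make the superlevel sets of \<open>u\<close> and \<open>v\<close> nonempty
  for the same levels, namely those below 1, so Brunn-Minkowski can be applied level by level: two
  values above l force a value of \<open>w\<close> above l at the midpoint. The result is the
  arithmetic form, which is stronger than the geometric one.\<close>

lemma Prekopa_Leindler_real_SUP_1:
  fixes u v w :: "real \<Rightarrow> ennreal"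
  assumes [measurable]: "u \<in> borel_measurable borel" "v \<in> borel_measurable borel" "w \<in> borel_measurable borel"
    and mid: "\<And>x y. u x * v y \<le> (w ((x + y) / 2))\<^sup>2"
    and u1: "(SUP x. u x) = 1" and v1: "(SUP x. v x) = 1"
  shows "(\<integral>\<^sup>+x. u x \<partial>lborel) + (\<integral>\<^sup>+x. v x \<partial>lborel) \<le> 2 * (\<integral>\<^sup>+x. w x \<partial>lborel)"
proof -
  have level: "(\<integral>\<^sup>+x. f x \<partial>lborel) = (\<integral>\<^sup>+l. indicator {0..} l * emeasure lborel {x. ennreal l < f x} \<partial>lborel)"
    if "f \<in> borel_measurable borel" for f :: "real \<Rightarrow> ennreal"
    using nn_integral_superlevel[OF lborel.sigma_finite_measure_axioms, of f] that by simp
  have meas[measurable]: "(\<lambda>l. emeasure lborel {x. ennreal l < f x}) \<in> borel_measurable borel"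
    if [measurable]: "f \<in> borel_measurable borel" for f :: "real \<Rightarrow> ennreal"
  proof -
    have "(\<lambda>l. emeasure lborel {x\<in>space lborel. ennreal l < f x}) \<in> borel_measurable borel"
      by measurable
    then show ?thesis by simp
  qed
  have pt: "indicator {0..} l * emeasure lborel {x. ennreal l < u x} + indicator {0..} l * emeasure lborel {x. ennreal l < v x}
     \<le> 2 * (indicator {0..} l * emeasure lborel {x. ennreal l < w x})" for l :: real
  proof (cases "0 \<le> l \<and> l < 1")
    case True
    then have l: "ennreal l < 1" by (simp add: ennreal_less_one_iff)
    have ne: "{x. ennreal l < u x} \<noteq> {}" "{x. ennreal l < v x} \<noteq> {}"
      using l less_SUP_iff[of "ennreal l" u UNIV] less_SUP_iff[of "ennreal l" v UNIV] by (auto simp: u1 v1)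
    have "emeasure lborel {x. ennreal l < u x} + emeasure lborel {x. ennreal l < v x}
      \<le> 2 * emeasure lborel {x. ennreal l < w x}"
    proof (rule Brunn_Minkowski_midpoint_real[OF _ ne(1) _ ne(2)])
      fix x y assume "x \<in> {x. ennreal l < u x}" "y \<in> {x. ennreal l < v x}"
      then have "ennreal l * ennreal l < u x * v y"
        by (auto intro: ennreal_mult_strict_mono)
      also have "\<dots> \<le> (w ((x + y) / 2))\<^sup>2" by (rule mid)
      finally show "(x + y) / 2 \<in> {x. ennreal l < w x}"
        by (metis ennreal_square_le_iff leD leI mem_Collect_eq power2_eq_square)
    qed measurable
    then show ?thesis using True by simp
  next
    case False
    have "{x. ennreal l < u x} = {}" "{x. ennreal l < v x} = {}" if "1 \<le> l"
    proof -
      have *: "1 \<le> ennreal l" using that by simp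
      have "u x \<le> ennreal l" "v x \<le> ennreal l" for x
        using u1 v1 * by (metis SUP_upper UNIV_I order_trans)+
      then show "{x. ennreal l < u x} = {}" "{x. ennreal l < v x} = {}"
        by (auto simp: not_less)
    qed
    then show ?thesis using False by (auto simp: indicator_def)
  qed
  have "(\<integral>\<^sup>+x. u x \<partial>lborel) + (\<integral>\<^sup>+x. v x \<partial>lborel)
     = (\<integral>\<^sup>+l. indicator {0..} l * emeasure lborel {x. ennreal l < u x} + indicator {0..} l * emeasure lborel {x. ennreal l < v x} \<partial>lborel)"
    by (subst (1 2) level) (auto intro!: nn_integral_add[symmetric])
  also have "\<dots> \<le> (\<integral>\<^sup>+l. 2 * (indicator {0..} l * emeasure lborel {x. ennreal l < w x}) \<partial>lborel)"
    by (intro nn_integral_mono pt)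
  also have "\<dots> = 2 * (\<integral>\<^sup>+x. w x \<partial>lborel)"
    by (subst level[of w]) (auto intro!: nn_integral_cmult)
  finally show ?thesis .
qed

text \<open>Dividing by the suprema M, N and by \<open>K = sqrt (M * N)\<close> keeps the midpoint
  hypothesis and reaches the normalised case. AM-GM turns the sum of the normalised integrals into
  their product, and the constants cancel because \<open>K\<^sup>2 = M * N\<close>.\<close>

lemma Prekopa_Leindler_real_bounded:
  fixes u v w :: "real \<Rightarrow> ennreal"
  assumes [measurable]: "u \<in> borel_measurable borel" "v \<in> borel_measurable borel" "w \<in> borel_measurable borel"
    and mid: "\<And>x y. u x * v y \<le> (w ((x + y) / 2))\<^sup>2"
    and ub: "(SUP x. u x) < \<infinity>" and vb: "(SUP x. v x) < \<infinity>"
  shows "(\<integral>\<^sup>+x. u x \<partial>lborel) * (\<integral>\<^sup>+x. v x \<partial>lborel) \<le> (\<integral>\<^sup>+x. w x \<partial>lborel)\<^sup>2"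
proof (cases "(SUP x. u x) = 0 \<or> (SUP x. v x) = 0")
  case True
  then have "u = (\<lambda>x. 0) \<or> v = (\<lambda>x. 0)"
    by (metis (no_types, lifting) SUP_upper UNIV_I ext le_zero_eq)
  then show ?thesis by auto
next
  case False
  obtain M where M: "(SUP x. u x) = ennreal M" "M > 0"
    using ub False by (cases "SUP x. u x") (auto simp: order_less_le)
  obtain N where N: "(SUP x. v x) = ennreal N" "N > 0"
    using vb False by (cases "SUP x. v x") (auto simp: order_less_le)
  define K where "K = sqrt (M * N)"
  have K: "K > 0" "K\<^sup>2 = M * N" using M N by (auto simp: K_def)
  let ?u = "\<lambda>x. ennreal (1 / M) * u x" and ?v = "\<lambda>x. ennreal (1 / N) * v x" and ?w = "\<lambda>x. ennreal (1 / K) * w x"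
  have KMN: "ennreal (1 / M) * ennreal (1 / N) = (ennreal (1 / K))\<^sup>2"
    using K M N by (simp add: ennreal_mult[symmetric] ennreal_power power_divide)
  have 1: "(\<integral>\<^sup>+x. ?u x \<partial>lborel) + (\<integral>\<^sup>+x. ?v x \<partial>lborel) \<le> 2 * (\<integral>\<^sup>+x. ?w x \<partial>lborel)"
  proof (rule Prekopa_Leindler_real_SUP_1)
    show "?u x * ?v y \<le> (?w ((x + y) / 2))\<^sup>2" for x y
    proof -
      have "?u x * ?v y = (ennreal (1 / K))\<^sup>2 * (u x * v y)"
        unfolding KMN[symmetric] by (simp add: ac_simps)
      also have "\<dots> \<le> (ennreal (1 / K))\<^sup>2 * (w ((x + y) / 2))\<^sup>2"
        by (intro mult_left_mono mid) auto
      finally show ?thesis by (simp add: power_mult_distrib)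
    qed
    show "(SUP x. ?u x) = 1"
      using M by (simp add: SUP_mult_left_ennreal[symmetric] ennreal_mult[symmetric])
    show "(SUP x. ?v x) = 1"
      using N by (simp add: SUP_mult_left_ennreal[symmetric] ennreal_mult[symmetric])
  qed measurable
  let ?I = "\<integral>\<^sup>+x. u x \<partial>lborel" and ?J = "\<integral>\<^sup>+x. v x \<partial>lborel" and ?W = "\<integral>\<^sup>+x. w x \<partial>lborel"
  have "ennreal (1 / M) * ?I + ennreal (1 / N) * ?J \<le> 2 * (ennreal (1 / K) * ?W)"
    using 1 by (simp add: nn_integral_cmult)
  then have "(ennreal (1 / M) * ?I + ennreal (1 / N) * ?J)\<^sup>2 \<le> (2 * (ennreal (1 / K) * ?W))\<^sup>2"
    by (subst ennreal_square_le_iff)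
  then have "4 * ((ennreal (1 / M) * ?I) * (ennreal (1 / N) * ?J)) \<le> (2 * (ennreal (1 / K) * ?W))\<^sup>2"
    using ennreal_AM_GM order_trans by blast
  moreover have "4 * ((ennreal (1 / M) * ?I) * (ennreal (1 / N) * ?J)) = 4 * (ennreal (1 / K))\<^sup>2 * (?I * ?J)"
    unfolding KMN[symmetric] by (simp add: ac_simps)
  moreover have "(2 * (ennreal (1 / K) * ?W))\<^sup>2 = 4 * (ennreal (1 / K))\<^sup>2 * ?W\<^sup>2"
    by (simp add: power_mult_distrib ac_simps)
  ultimately have "4 * (ennreal (1 / K))\<^sup>2 * (?I * ?J) \<le> 4 * (ennreal (1 / K))\<^sup>2 * ?W\<^sup>2" by simp
  moreover have "4 * (ennreal (1 / K))\<^sup>2 = ennreal (4 / K\<^sup>2)"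
    using K(1) by (simp add: ennreal_power power_divide ennreal_mult[symmetric] flip: ennreal_numeral)
  ultimately show ?thesis
    using K(1) by (subst (asm) ennreal_mult_le_mult_iff) auto
qed

text \<open>Truncating \<open>u\<close> and \<open>v\<close> preserves the midpoint hypothesis, so
  the same \<open>w\<close> serves for all truncation levels and monotone convergence removes the
  boundedness.\<close>

lemma Prekopa_Leindler_real:
  fixes u v w :: "real \<Rightarrow> ennreal"
  assumes [measurable]: "u \<in> borel_measurable borel" "v \<in> borel_measurable borel" "w \<in> borel_measurable borel"
    and mid: "\<And>x y. u x * v y \<le> (w ((x + y) / 2))\<^sup>2"
  shows "(\<integral>\<^sup>+x. u x \<partial>lborel) * (\<integral>\<^sup>+x. v x \<partial>lborel) \<le> (\<integral>\<^sup>+x. w x \<partial>lborel)\<^sup>2"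
proof -
  have SUP_trunc: "(SUP k::nat. min a (of_nat k)) = a" for a :: ennreal
  proof (rule antisym)
    show "a \<le> (SUP k::nat. min a (of_nat k))"
    proof (rule dense_le)
      fix c assume "c < a"
      then have "c < top" by (simp add: order_less_le_trans)
      then obtain k :: nat where "c < of_nat k"
        using ennreal_SUP_of_nat_eq_top less_SUP_iff[of c of_nat UNIV] by auto
      then show "c \<le> (SUP k::nat. min a (of_nat k))"
        using \<open>c < a\<close> by (intro SUP_upper2[of k]) auto
    qed
  qed (auto intro: SUP_least)
  have int_SUP: "(\<integral>\<^sup>+x. f x \<partial>lborel) = (SUP k::nat. \<integral>\<^sup>+x. min (f x) (of_nat k) \<partial>lborel)"
    if [measurable]: "f \<in> borel_measurable borel" for f :: "real \<Rightarrow> ennreal"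
    by (subst SUP_trunc[symmetric])
      (auto intro!: nn_integral_monotone_convergence_SUP simp: incseq_def le_fun_def min.coboundedI2)
  have fin: "(SUP x. min (f x) (of_nat k)) < \<infinity>" for f :: "real \<Rightarrow> ennreal" and k
    by (rule order_le_less_trans[of _ "of_nat k"]) (auto intro: SUP_least of_nat_less_top)
  have "(\<integral>\<^sup>+x. min (u x) (of_nat j) \<partial>lborel) * (\<integral>\<^sup>+x. min (v x) (of_nat k) \<partial>lborel) \<le> (\<integral>\<^sup>+x. w x \<partial>lborel)\<^sup>2" for j k
    by (rule Prekopa_Leindler_real_bounded)
      (auto intro!: fin[simplified] order_trans[OF mult_mono mid])
  then show ?thesis
    unfolding int_SUP[of u, simplified] int_SUP[of v, simplified]
    by (simp add: SUP_mult_left_ennreal SUP_mult_right_ennreal SUP_least)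
qed

section \<open>Tensorisation to finite products\<close>

text \<open>Induction on the set of coordinates. For fixed remaining coordinates the one-dimensional
  inequality bounds the product of the slice integrals, and this bound is again a midpoint
  hypothesis in the remaining coordinates. Points are restricted to \<open>extensional I\<close>
  because these are the points of the product space, determined by their coordinates in
  \<open>I\<close>.\<close>

lemma Prekopa_Leindler_PiM:
  fixes u v w :: "('i \<Rightarrow> real) \<Rightarrow> ennreal"
  assumes "finite I"
    and "u \<in> borel_measurable (Pi\<^sub>M I (\<lambda>_. lborel))" "v \<in> borel_measurable (Pi\<^sub>M I (\<lambda>_. lborel))"
      "w \<in> borel_measurable (Pi\<^sub>M I (\<lambda>_. lborel))"
    and "\<And>x y. x \<in> extensional I \<Longrightarrow> y \<in> extensional I \<Longrightarrow> u x * v y \<le> (w (\<lambda>i\<in>I. (x i + y i) / 2))\<^sup>2"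
  shows "(\<integral>\<^sup>+x. u x \<partial>Pi\<^sub>M I (\<lambda>_. lborel)) * (\<integral>\<^sup>+x. v x \<partial>Pi\<^sub>M I (\<lambda>_. lborel)) \<le> (\<integral>\<^sup>+x. w x \<partial>Pi\<^sub>M I (\<lambda>_. lborel))\<^sup>2"
  using assms
proof (induction I arbitrary: u v w rule: finite_induct)
  case empty
  interpret product_sigma_finite "\<lambda>_. lborel :: real measure" ..
  show ?case
    using empty(4)[of "\<lambda>_. undefined" "\<lambda>_. undefined"] by (simp add: nn_integral_empty restrict_def)
next
  case (insert i I)
  interpret product_sigma_finite "\<lambda>_. lborel :: real measure" ..
  note insert.prems(1-3)[measurable]
  have upd[measurable]: "(\<lambda>(x, y). x(i := y)) \<in> Pi\<^sub>M I (\<lambda>_. lborel) \<Otimes>\<^sub>M lborel \<rightarrow>\<^sub>M Pi\<^sub>M (insert i I) (\<lambda>_. lborel :: real measure)"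
    using measurable_add_dim[of i I "\<lambda>_. lborel :: real measure"] by simp
  have ext: "x(i := a) \<in> extensional (insert i I)" if "x \<in> extensional I" for x :: "'i \<Rightarrow> real" and a
    using that by (auto simp: extensional_def)
  have comp: "(\<lambda>a. f (x(i := a))) \<in> borel_measurable borel"
    if [measurable]: "f \<in> borel_measurable (Pi\<^sub>M (insert i I) (\<lambda>_. lborel))" and x: "x \<in> extensional I"
    for f :: "('i \<Rightarrow> real) \<Rightarrow> ennreal" and x
  proof -
    have x': "x \<in> space (Pi\<^sub>M I (\<lambda>_. lborel :: real measure))"
      using x by (simp add: space_PiM PiE_def)
    have "(\<lambda>a. f (case (x, a) of (x, y) \<Rightarrow> x(i := y))) \<in> borel_measurable lborel"
      by (rule measurable_compose[OF measurable_Pair1'[OF x']]) measurable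
    then show ?thesis by simp
  qed
  have slice: "(\<lambda>x. \<integral>\<^sup>+a. f (x(i := a)) \<partial>lborel) \<in> borel_measurable (Pi\<^sub>M I (\<lambda>_. lborel))"
    if f: "f \<in> borel_measurable (Pi\<^sub>M (insert i I) (\<lambda>_. lborel))" for f :: "('i \<Rightarrow> real) \<Rightarrow> ennreal"
  proof (rule lborel.borel_measurable_nn_integral)
    show "(\<lambda>(x, a). f (x(i := a))) \<in> borel_measurable (Pi\<^sub>M I (\<lambda>_. lborel) \<Otimes>\<^sub>M lborel)"
      using measurable_compose[OF upd f] by (simp only: case_prod_beta')
  qed
  show ?case
    unfolding product_nn_integral_insert[OF insert.hyps insert.prems(1)]
      product_nn_integral_insert[OF insert.hyps insert.prems(2)]
      product_nn_integral_insert[OF insert.hyps insert.prems(3)]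
  proof (rule insert.IH)
    fix x y :: "'i \<Rightarrow> real" assume x: "x \<in> extensional I" and y: "y \<in> extensional I"
    show "(\<integral>\<^sup>+a. u (x(i := a)) \<partial>lborel) * (\<integral>\<^sup>+a. v (y(i := a)) \<partial>lborel)
      \<le> (\<integral>\<^sup>+a. w ((\<lambda>j\<in>I. (x j + y j) / 2)(i := a)) \<partial>lborel)\<^sup>2"
    proof (rule Prekopa_Leindler_real)
      fix a b :: real
      have "(\<lambda>j\<in>insert i I. ((x(i := a)) j + (y(i := b)) j) / 2) = (\<lambda>j\<in>I. (x j + y j) / 2)(i := (a + b) / 2)"
        using insert.hyps(2) by (auto simp: fun_eq_iff)
      then show "u (x(i := a)) * v (y(i := b)) \<le> (w ((\<lambda>j\<in>I. (x j + y j) / 2)(i := (a + b) / 2)))\<^sup>2"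
        using insert.prems(4)[OF ext[OF x] ext[OF y], of a b] by (simp only:)
    qed (intro comp insert.prems x y restrict_extensional)+
  qed (intro slice insert.prems)+
qed

theorem Prekopa_Leindler:
  fixes u v w :: "'a::euclidean_space \<Rightarrow> ennreal"
  assumes [measurable]: "u \<in> borel_measurable borel" "v \<in> borel_measurable borel" "w \<in> borel_measurable borel"
    and mid: "\<And>x y. u x * v y \<le> (w ((1 / 2) *\<^sub>R (x + y)))\<^sup>2"
  shows "(\<integral>\<^sup>+x. u x \<partial>lborel) * (\<integral>\<^sup>+x. v x \<partial>lborel) \<le> (\<integral>\<^sup>+x. w x \<partial>lborel)\<^sup>2"
proof -
  let ?T = "\<lambda>f. \<Sum>b\<in>Basis. f b *\<^sub>R (b::'a)"
  let ?P = "Pi\<^sub>M Basis (\<lambda>_. lborel) :: ('a \<Rightarrow> real) measure"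
  have T[measurable]: "?T \<in> ?P \<rightarrow>\<^sub>M borel" by measurable
  have eq: "(\<integral>\<^sup>+x. f x \<partial>lborel) = (\<integral>\<^sup>+x. f (?T x) \<partial>?P)"
    if [measurable]: "f \<in> borel_measurable borel" for f :: "'a \<Rightarrow> ennreal"
    by (subst lborel_def) (simp add: lborel_eq_real[symmetric] nn_integral_distr)
  show ?thesis
    unfolding eq[OF assms(1)] eq[OF assms(2)] eq[OF assms(3)]
  proof (rule Prekopa_Leindler_PiM)
    fix x y :: "'a \<Rightarrow> real"
    have "?T (\<lambda>i\<in>Basis. (x i + y i) / 2) = (1 / 2) *\<^sub>R (?T x + ?T y)"
      by (simp add: scaleR_sum_right sum.distrib[symmetric] add_divide_distrib scaleR_add_left scaleR_add_right)
    then show "u (?T x) * v (?T y) \<le> (w (?T (\<lambda>i\<in>Basis. (x i + y i) / 2)))\<^sup>2"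
      using mid[of "?T x" "?T y"] by simp
  qed measurable
qed

subsection \<open>Rademacher's theorem\<close>

text \<open>The points t with \<open>G a \<le> G t\<close> form a compact set; a largest one before
  b would be exceeded by the step starting at it.\<close>

lemma right_increasing_imp_le:
  fixes G :: "real \<Rightarrow> real"
  assumes cont: "continuous_on {a..b} G" and ab: "a \<le> b"
    and step: "\<And>t. a \<le> t \<Longrightarrow> t < b \<Longrightarrow> \<exists>h>0. t + h \<le> b \<and> G t \<le> G (t + h)"
  shows "G a \<le> G b"
proof -
  define S where "S = {t\<in>{a..b}. G a \<le> G t}"
  have "closed S"
    unfolding S_def using continuous_closed_preimage[OF cont closed_real_atLeastAtMost, of "{G a..}"]
    by (simp add: vimage_def Int_def)
  moreover have "bounded S" by (rule bounded_subset[of "{a..b}"]) (auto simp: S_def)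
  ultimately have "compact S" by (simp add: compact_eq_bounded_closed)
  moreover have "a \<in> S" using ab by (simp add: S_def)
  ultimately obtain s where s: "s \<in> S" "\<And>t. t \<in> S \<Longrightarrow> t \<le> s"
    using compact_attains_sup[of S] by blast
  have "s = b"
  proof (rule ccontr)
    assume "s \<noteq> b"
    then obtain h where "h > 0" "s + h \<le> b" "G s \<le> G (s + h)"
      using step[of s] s(1) by (auto simp: S_def)
    then have "s + h \<in> S" using s(1) by (auto simp: S_def)
    then show False using s(2)[of "s + h"] \<open>h > 0\<close> by simp
  qed
  then show ?thesis using s(1) by (simp add: S_def)
qed

text \<open>The function \<open>M t - q * U t\<close>, with \<open>U t\<close> the measure of
  \<open>K\<close> between a and t, can always be continued to the right without decreasing. At a
  point of \<open>K\<close> the given step pays for \<open>U\<close>, which grows with slope at most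
  1; off \<open>K\<close> a short interval to the right misses \<open>K\<close>, so \<open>U\<close>
  is constant there and monotonicity of \<open>M\<close> suffices.\<close>

lemma measure_compact_upper_derivate_le:
  fixes M :: "real \<Rightarrow> real"
  assumes mono: "mono M" and cont: "continuous_on UNIV M" and K: "compact K" and q: "0 \<le> q" and ab: "a \<le> b"
    and up: "\<And>t e. t \<in> K \<Longrightarrow> 0 < e \<Longrightarrow> \<exists>h. 0 < h \<and> h < e \<and> q * h \<le> M (t + h) - M t"
  shows "q * measure lebesgue (K \<inter> {a..b}) \<le> M b - M a"
proof -
  define U where "U t = measure lebesgue (K \<inter> {a..t})" for t
  have lm: "K \<inter> {s..t} \<in> lmeasurable" for s t
    using K by (intro lmeasurable_compact) (simp add: compact_Int)
  have U_split: "U t = U s + measure lebesgue (K \<inter> {s<..t})" if "a \<le> s" "s \<le> t" for s t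
  proof -
    have eq: "K \<inter> {a..t} = (K \<inter> {a..s}) \<union> (K \<inter> {s<..t})" using that by auto
    have lm': "K \<inter> {s<..t} \<in> lmeasurable"
      by (rule fmeasurableI2[OF lm[of s t]]) (use K in \<open>auto intro!: sets.Int borel_compact\<close>)
    show ?thesis
      unfolding U_def eq by (rule measure_Un_AE) (use lm lm' in auto)
  qed
  have U_le: "measure lebesgue (K \<inter> {s<..t}) \<le> t - s" if "s \<le> t" for s t
  proof -
    have "measure lebesgue (K \<inter> {s<..t}) \<le> measure lebesgue {s..t}"
      using K by (intro measure_mono_fmeasurable) (auto intro!: sets.Int borel_compact)
    then show ?thesis using that by simp
  qed
  have U_lip: "\<bar>U t - U s\<bar> \<le> \<bar>t - s\<bar>" if "a \<le> s" "a \<le> t" for s t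
    using U_split[of s t] U_split[of t s] U_le[of s t] U_le[of t s] that
      measure_nonneg[of lebesgue "K \<inter> {s<..t}"] measure_nonneg[of lebesgue "K \<inter> {t<..s}"]
    by linarith
  have "continuous_on {a..b} U"
  proof -
    have "1-lipschitz_on {a..b} U"
      by (rule lipschitz_onI) (use U_lip in \<open>auto simp: dist_real_def\<close>)
    then show ?thesis by (rule lipschitz_on_continuous_on)
  qed
  then have contG: "continuous_on {a..b} (\<lambda>t. M t - q * U t)"
    by (intro continuous_intros continuous_on_subset[OF cont]) auto
  have "M a - q * U a \<le> M b - q * U b"
  proof (rule right_increasing_imp_le[OF contG ab])
    fix t assume t: "a \<le> t" "t < b"
    show "\<exists>h>0. t + h \<le> b \<and> M t - q * U t \<le> M (t + h) - q * U (t + h)"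
    proof (cases "t \<in> K")
      case True
      then obtain h where h: "0 < h" "h < b - t" "q * h \<le> M (t + h) - M t"
        using up[of t "b - t"] t by auto
      have "U (t + h) \<le> U t + h" using U_split[of t "t + h"] U_le[of t "t + h"] t h by simp
      then have "q * U (t + h) \<le> q * U t + q * h"
        using q by (metis mult_left_mono distrib_left)
      then show ?thesis using h by (intro exI[of _ h]) auto
    next
      case False
      have "open (- K)" using K by (simp add: compact_imp_closed open_Compl)
      then obtain e where e: "e > 0" "ball t e \<subseteq> - K"
        using False by (meson ComplI openE)
      define h where "h = min (e / 2) (b - t)"
      have h: "0 < h" "h < e" "t + h \<le> b" using e t by (auto simp: h_def)
      have "K \<inter> {t<..t + h} \<subseteq> K \<inter> ball t e" using h by (auto simp: dist_real_def)
      then have "K \<inter> {t<..t + h} = {}" using e(2) by auto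
      then have "U (t + h) = U t" using U_split[of t "t + h"] t h by simp
      moreover have "M t \<le> M (t + h)" using mono h by (simp add: monoD)
      ultimately show ?thesis using h by (intro exI[of _ h]) auto
    qed
  qed
  moreover have "U a = 0"
    by (cases "a \<in> K") (auto simp: U_def)
  ultimately show ?thesis by (simp add: U_def)
qed

text \<open>Adding \<open>L * t\<close> makes \<open>F\<close> monotone, which is why \<open>L\<close> occurs on both sides.\<close>

lemma measure_upper_derivate_le:
  fixes F :: "real \<Rightarrow> real"
  assumes lip: "L-lipschitz_on UNIV F" and E: "E \<in> sets lebesgue" and ab: "a \<le> b"
    and up: "\<And>t e. t \<in> E \<Longrightarrow> 0 < e \<Longrightarrow> \<exists>h. 0 < h \<and> h < e \<and> q * h \<le> F (t + h) - F t"
  shows "(q + L) * measure lebesgue (E \<inter> {a..b}) \<le> F b - F a + L * (b - a)"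
proof (cases "q + L \<le> 0")
  case True
  then have "(q + L) * measure lebesgue (E \<inter> {a..b}) \<le> 0"
    by (simp add: mult_nonpos_nonneg)
  moreover have "\<bar>F b - F a\<bar> \<le> L * (b - a)"
    using lipschitz_onD[OF lip, of b a] ab by (simp add: dist_real_def)
  ultimately show ?thesis by linarith
next
  case False
  define M where "M t = F t + L * t" for t
  have "mono M"
  proof (rule monoI)
    fix s t :: real assume "s \<le> t"
    then show "M s \<le> M t"
      using lipschitz_onD[OF lip, of s t] by (auto simp: M_def dist_real_def algebra_simps abs_if split: if_splits)
  qed
  have contM: "continuous_on UNIV M"
    unfolding M_def by (intro continuous_intros lipschitz_on_continuous_on[OF lip])
  let ?S = "E \<inter> {a..b}"
  have S: "?S \<in> lmeasurable" by (rule fmeasurableI2[of "{a..b}"]) (use E in auto)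
  have "(q + L) * measure lebesgue ?S \<le> M b - M a + e" if "e > 0" for e
  proof -
    have pos: "e / (q + L) > 0" using that False by simp
    \<comment> \<open>The compact case applies to \<open>T\<close>; the part of \<open>?S\<close>
      left over has measure below e / (q + L) and costs at most e.\<close>
    obtain T where T: "closed T" "T \<subseteq> ?S" "?S - T \<in> lmeasurable" "emeasure lebesgue (?S - T) < ennreal (e / (q + L))"
      using sets_lebesgue_inner_closed[of ?S "e / (q + L)"] S pos by auto
    have cT: "compact T"
      using T by (auto simp: compact_eq_bounded_closed intro: bounded_subset[of "{a..b}"])
    have "(q + L) * measure lebesgue (T \<inter> {a..b}) \<le> M b - M a"
    proof (rule measure_compact_upper_derivate_le[OF \<open>mono M\<close> contM cT _ ab])
      fix t e :: real assume "t \<in> T" "0 < e"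
      then obtain h where "0 < h \<and> h < e \<and> q * h \<le> F (t + h) - F t"
        using up[of t e] T(2) by auto
      then show "\<exists>h. 0 < h \<and> h < e \<and> (q + L) * h \<le> M (t + h) - M t"
        by (intro exI[of _ h]) (auto simp: M_def algebra_simps)
    qed (use False in simp)
    moreover have "T \<inter> {a..b} = T" using T(2) by auto
    moreover have "measure lebesgue ?S = measure lebesgue T + measure lebesgue (?S - T)"
    proof -
      have "measure lebesgue (T \<union> (?S - T)) = measure lebesgue T + measure lebesgue (?S - T)"
        using T(3) lmeasurable_compact[OF cT] by (intro measure_Un_AE) auto
      moreover have "T \<union> (?S - T) = ?S" using T(2) by auto
      ultimately show ?thesis by simp
    qed
    moreover have "measure lebesgue (?S - T) < e / (q + L)"
      using T(3,4) pos by (simp add: emeasure_eq_measure2 ennreal_less_iff)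
    then have "(q + L) * measure lebesgue (?S - T) < e"
      using False by (simp add: field_simps)
    ultimately show ?thesis by (simp add: distrib_left)
  qed
  then have "(q + L) * measure lebesgue ?S \<le> M b - M a" by (rule field_le_epsilon)
  then show ?thesis by (simp add: M_def algebra_simps)
qed

text \<open>Cover \<open>E \<inter> cbox a b\<close> by nonoverlapping intervals of total length at
  most its measure plus e. At most the fraction c of this length belongs to \<open>E\<close>, so the
  measure is at most c times itself, and c < 1 makes it 0.\<close>

lemma negligible_if_sparse_in_intervals:
  fixes E :: "real set"
  assumes E: "E \<in> sets lebesgue" and c: "c < 1"
    and le: "\<And>a b. a \<le> b \<Longrightarrow> measure lebesgue (E \<inter> {a..b}) \<le> c * (b - a)"
  shows "negligible E"
proof -
  have "negligible (E \<inter> cbox a b)" for a b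
  proof (cases "a < b")
    case True
    let ?S = "E \<inter> cbox a b"
    have S: "?S \<in> lmeasurable" by (rule fmeasurableI2[of "cbox a b"]) (use E in auto)
    have c0: "0 \<le> c"
    proof -
      have "0 \<le> c * (b - a)" using le[of a b] True measure_nonneg order_trans by (metis less_imp_le)
      then show ?thesis using True by (simp add: zero_le_mult_iff)
    qed
    have "measure lebesgue ?S \<le> c * measure lebesgue ?S + e" if e: "e > 0" for e
    proof -
      have "\<exists>\<D>. countable \<D> \<and> (\<forall>K\<in>\<D>. \<exists>c d. K \<noteq> {} \<and> K = cbox c d)
        \<and> pairwise (\<lambda>A B. interior A \<inter> interior B = {}) \<D> \<and> ?S \<subseteq> \<Union>\<D> \<and> \<Union>\<D> \<in> lmeasurable
        \<and> measure lebesgue (\<Union>\<D>) \<le> measure lebesgue ?S + e"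
      proof (rule measurable_outer_intervals_bounded[OF S Int_lower2 e])
        fix \<D> assume *: "countable \<D>" "\<And>K. K \<in> \<D> \<Longrightarrow> K \<subseteq> cbox a b \<and> K \<noteq> {} \<and> (\<exists>c d. K = cbox c d)"
          "pairwise (\<lambda>A B. interior A \<inter> interior B = {}) \<D>" "?S \<subseteq> \<Union>\<D>" "\<Union>\<D> \<in> lmeasurable"
          "measure lebesgue (\<Union>\<D>) \<le> measure lebesgue ?S + e"
        have "\<forall>K\<in>\<D>. \<exists>c d. K \<noteq> {} \<and> K = cbox c d" using *(2) by metis
        with *(1,3-6) show ?thesis by (intro exI[of _ \<D>] conjI)
      qed
      then obtain \<D> where D: "countable \<D>" "\<forall>K\<in>\<D>. \<exists>c d. K \<noteq> {} \<and> K = cbox c d"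
        "pairwise (\<lambda>A B. interior A \<inter> interior B = {}) \<D>" "?S \<subseteq> \<Union>\<D>" "\<Union>\<D> \<in> lmeasurable"
        "measure lebesgue (\<Union>\<D>) \<le> measure lebesgue ?S + e"
        by (elim exE conjE)
      have box: "\<exists>s t. s \<le> t \<and> K = {s..t}" if KD: "K \<in> \<D>" for K
      proof -
        obtain s t where "K \<noteq> {}" "K = cbox s t" using bspec[OF D(2) KD] by blast
        then show ?thesis by (intro exI[of _ s] exI[of _ t]) simp
      qed
      have fin: "measure lebesgue (\<Union>((\<inter>) E ` \<F>)) \<le> c * (measure lebesgue ?S + e)"
        if F: "finite \<F>" "\<F> \<subseteq> \<D>" for \<F>
      proof -
        have lm: "K \<in> lmeasurable" if KF: "K \<in> \<F>" for K
        proof -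
          obtain s t where "K = {s..t}" using box[OF subsetD[OF F(2) KF]] by blast
          then show ?thesis by simp
        qed
        have lmE: "E \<inter> K \<in> lmeasurable" if "K \<in> \<F>" for K
          by (rule fmeasurableI2[OF lm[OF that]]) (use E fmeasurableD[OF lm[OF that]] in auto)
        have "measure lebesgue (\<Union>K\<in>\<F>. E \<inter> K) \<le> (\<Sum>K\<in>\<F>. measure lebesgue (E \<inter> K))"
          using F lmE by (intro measure_UNION_le) (auto simp: fmeasurableD)
        also have "\<dots> \<le> (\<Sum>K\<in>\<F>. c * measure lebesgue K)"
        proof (rule sum_mono)
          fix K assume "K \<in> \<F>"
          then obtain s t where "s \<le> t" "K = {s..t}" using box[OF subsetD[OF F(2)]] by blast
          then show "measure lebesgue (E \<inter> K) \<le> c * measure lebesgue K" using le by simp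
        qed
        also have "\<dots> = c * measure lebesgue (\<Union>\<F>)"
        proof -
          have "measure lebesgue (\<Union>\<F>) = (\<Sum>K\<in>\<F>. measure lebesgue K)"
          proof (rule measure_negligible_finite_Union[OF F(1) lm])
            show "pairwise (\<lambda>S T. negligible (S \<inter> T)) \<F>"
            proof (rule pairwiseI)
              fix A B assume AB: "A \<in> \<F>" "B \<in> \<F>" "A \<noteq> B"
              then have "interior A \<inter> interior B = {}"
                using D(3) F(2) by (auto simp: pairwise_def)
              moreover obtain s t s' t' where "A = {s..t}" "B = {s'..t'}" using box[OF subsetD[OF F(2) AB(1)]] box[OF subsetD[OF F(2) AB(2)]] by blast
              ultimately have "interior (A \<inter> B) = {}" "convex (A \<inter> B)"
                by (auto intro!: convex_Int)
              then show "negligible (A \<inter> B)" by (simp add: negligible_convex_interior)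
            qed
          qed
          then show ?thesis by (simp add: sum_distrib_left)
        qed
        also have "\<dots> \<le> c * measure lebesgue (\<Union>\<D>)"
          by (intro mult_left_mono measure_mono_fmeasurable Union_mono F D(5) c0 sets.finite_Union subsetI fmeasurableD lm)
        also have "\<dots> \<le> c * (measure lebesgue ?S + e)"
          using D(6) c0 by (rule mult_left_mono)
        finally show ?thesis by simp
      qed
      have "measure lebesgue (\<Union>((\<inter>) E ` \<D>)) \<le> c * (measure lebesgue ?S + e)"
      proof (rule measure_Union_bound)
        show "countable ((\<inter>) E ` \<D>)" using D(1) by simp
        show "d \<in> lmeasurable" if dE: "d \<in> (\<inter>) E ` \<D>" for d
        proof -
          obtain K where K: "K \<in> \<D>" "d = E \<inter> K" using dE by blast
          obtain s t where st: "K = {s..t}" using box[OF K(1)] by blast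
          show ?thesis unfolding K(2) st by (rule fmeasurableI2[of "{s..t}"]) (use E in auto)
        qed
        show "measure lebesgue (\<Union>\<E>) \<le> c * (measure lebesgue ?S + e)"
          if EE: "\<E> \<subseteq> (\<inter>) E ` \<D>" "finite \<E>" for \<E>
        proof -
          obtain \<F> where "\<F> \<subseteq> \<D>" "finite \<F>" "\<E> = (\<inter>) E ` \<F>"
            using finite_subset_image[OF EE(2,1)] by blast
          then show ?thesis using fin by simp
        qed
      qed
      moreover have "measure lebesgue ?S \<le> measure lebesgue (\<Union>((\<inter>) E ` \<D>))"
      proof (rule measure_mono_fmeasurable)
        have eq: "\<Union>((\<inter>) E ` \<D>) = E \<inter> \<Union>\<D>" by blast
        show "\<Union>((\<inter>) E ` \<D>) \<in> lmeasurable"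
          unfolding eq by (rule fmeasurableI2[OF D(5) Int_lower2 sets.Int[OF E fmeasurableD[OF D(5)]]])
        show "?S \<subseteq> \<Union>((\<inter>) E ` \<D>)" unfolding eq using D(4) by blast
        show "?S \<in> sets lebesgue" using S by (rule fmeasurableD)
      qed
      ultimately have "measure lebesgue ?S \<le> c * measure lebesgue ?S + c * e" by (simp add: distrib_left)
      moreover have "c * e \<le> e" using e c by simp
      ultimately show ?thesis by linarith
    qed
    then have "measure lebesgue ?S \<le> c * measure lebesgue ?S" by (rule field_le_epsilon)
    then have "(1 - c) * measure lebesgue ?S \<le> 0" by (simp add: algebra_simps)
    then have "measure lebesgue ?S \<le> 0" using c by (simp add: mult_le_0_iff)
    then have "measure lebesgue ?S = 0" using measure_nonneg[of lebesgue ?S] by (rule antisym)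
    then show ?thesis using S by (simp add: negligible_iff_measure)
  next
    case False
    then have "E \<inter> cbox a b \<subseteq> {a}" by auto
    then show ?thesis by (rule negligible_subset[OF negligible_sing])
  qed
  then show ?thesis using negligible_on_intervals by blast
qed

text \<open>Applied to \<open>F\<close> and to \<open>- F\<close>, the previous estimate bounds the share of \<open>E\<close> in every interval by
  \<open>2 * L / (q - p + 2 * L) < 1\<close>.\<close>

lemma negligible_distinct_right_derivates:
  fixes F :: "real \<Rightarrow> real"
  assumes lip: "L-lipschitz_on UNIV F" and E: "E \<in> sets lebesgue" and pq: "p < q"
    and up: "\<And>t e. t \<in> E \<Longrightarrow> 0 < e \<Longrightarrow> \<exists>h. 0 < h \<and> h < e \<and> q * h \<le> F (t + h) - F t"
    and low: "\<And>t e. t \<in> E \<Longrightarrow> 0 < e \<Longrightarrow> \<exists>h. 0 < h \<and> h < e \<and> F (t + h) - F t \<le> p * h"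
  shows "negligible E"
proof (rule negligible_if_sparse_in_intervals[OF E])
  have L: "0 \<le> L" using lip by (rule lipschitz_on_nonneg)
  show "2 * L / (q - p + 2 * L) < 1" using pq L by (simp add: field_simps)
  fix a b :: real assume ab: "a \<le> b"
  let ?m = "measure lebesgue (E \<inter> {a..b})"
  have "(q + L) * ?m \<le> F b - F a + L * (b - a)"
    by (rule measure_upper_derivate_le[OF lip E ab up])
  moreover have "(- p + L) * ?m \<le> - F b - - F a + L * (b - a)"
  proof (rule measure_upper_derivate_le[OF _ E ab])
    show "L-lipschitz_on UNIV (\<lambda>x. - F x)" using lip by (simp add: lipschitz_on_minus)
    fix t e :: real assume "t \<in> E" "0 < e"
    then show "\<exists>h. 0 < h \<and> h < e \<and> - p * h \<le> - F (t + h) - - F t"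
      using low[of t e] by (auto simp: algebra_simps)
  qed
  ultimately have "(q - p + 2 * L) * ?m \<le> 2 * L * (b - a)" by (simp add: algebra_simps)
  then show "?m \<le> 2 * L / (q - p + 2 * L) * (b - a)" using pq L by (simp add: field_simps)
qed

text \<open>Averaging over translations along \<open>v\<close> replaces a linear change of coordinates.\<close>

lemma null_set_if_null_on_lines:
  fixes E :: "'a::euclidean_space set"
  assumes E[measurable]: "E \<in> sets borel" and lines: "\<And>x. {t. x + t *\<^sub>R v \<in> E} \<in> null_sets lborel"
  shows "E \<in> null_sets lborel"
proof -
  have "emeasure lborel E = (\<integral>\<^sup>+t. indicator {0..1::real} t * emeasure lborel E \<partial>lborel)"
    by (subst nn_integral_multc) auto
  also have "\<dots> = (\<integral>\<^sup>+t. (\<integral>\<^sup>+x. indicator {0..1::real} t * indicator E (x + t *\<^sub>R v) \<partial>lborel) \<partial>lborel)"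
  proof (rule nn_integral_cong)
    fix t :: real
    have "emeasure lborel E = (\<integral>\<^sup>+x. indicator E x \<partial>distr lborel borel ((+) (t *\<^sub>R v)))"
      by (subst lborel_distr_plus) simp
    also have "\<dots> = (\<integral>\<^sup>+x. indicator E (x + t *\<^sub>R v) \<partial>lborel)"
      by (subst nn_integral_distr) (auto simp: add.commute)
    finally show "indicator {0..1::real} t * emeasure lborel E
      = (\<integral>\<^sup>+x. indicator {0..1::real} t * indicator E (x + t *\<^sub>R v) \<partial>lborel)"
      by (simp add: nn_integral_cmult)
  qed
  also have "\<dots> = (\<integral>\<^sup>+x. (\<integral>\<^sup>+t. indicator {0..1::real} t * indicator E (x + t *\<^sub>R v) \<partial>lborel) \<partial>lborel)"
    by (rule lborel_pair.Fubini') measurable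
  also have "\<dots> = (\<integral>\<^sup>+x. 0 \<partial>(lborel :: 'a measure))"
  proof (rule nn_integral_cong)
    fix x :: 'a
    have "AE t in lborel. t \<notin> {t. x + t *\<^sub>R v \<in> E}"
      using lines by (rule AE_not_in)
    then have "(\<integral>\<^sup>+t. indicator {0..1::real} t * indicator E (x + t *\<^sub>R v) \<partial>lborel) = (\<integral>\<^sup>+t. 0 \<partial>(lborel :: real measure))"
      by (intro nn_integral_cong_AE) (auto elim!: eventually_mono)
    then show "(\<integral>\<^sup>+t. indicator {0..1::real} t * indicator E (x + t *\<^sub>R v) \<partial>lborel) = 0" by simp
  qed
  finally show ?thesis by (simp add: null_sets_def)
qed


section \<open>One-sided directional derivatives almost everywhere\<close>

lemma difference_quotient_bound:
  fixes f :: "'a::real_normed_vector \<Rightarrow> real"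
  assumes lip: "L-lipschitz_on UNIV f" and h: "0 < h"
  shows "\<bar>(f (x + h *\<^sub>R v) - f x) / h\<bar> \<le> L * norm v"
proof -
  have "\<bar>f (x + h *\<^sub>R v) - f x\<bar> \<le> L * norm v * h"
    using lipschitz_onD[OF lip, of "x + h *\<^sub>R v" x] h by (simp add: dist_norm ac_simps)
  then show ?thesis using h by (simp add: field_simps)
qed

text \<open>If the lower and upper limits differed, rationals p < q would fit strictly between them,
  contrary to \<open>osc\<close>. Rational thresholds are used so that countably many null sets
  suffice in the application.\<close>

lemma tendsto_if_bounded_no_oscillation:
  fixes Q :: "'a \<Rightarrow> real"
  assumes F: "F \<noteq> bot" and bd: "\<forall>\<^sub>F h in F. \<bar>Q h\<bar> \<le> B"
    and osc: "\<And>p q. p \<in> \<rat> \<Longrightarrow> q \<in> \<rat> \<Longrightarrow> p < q \<Longrightarrow> \<not> ((\<exists>\<^sub>F h in F. Q h < p) \<and> (\<exists>\<^sub>F h in F. q < Q h))"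
  shows "\<exists>l. (Q \<longlongrightarrow> l) F"
proof -
  define l where "l = Liminf F (\<lambda>h. ereal (Q h))"
  define u where "u = Limsup F (\<lambda>h. ereal (Q h))"
  have "\<not> l < u"
  proof
    assume "l < u"
    then obtain p' where p': "l < ereal p'" "ereal p' < u" using ereal_dense2 by blast
    then obtain q' where q': "ereal p' < ereal q'" "ereal q' < u" using ereal_dense2 by blast
    obtain p where p: "p \<in> \<rat>" "p' < p" "p < q'" using q'(1) Rats_dense_in_real by auto
    obtain q where q: "q \<in> \<rat>" "p < q" "q < q'" using p(3) Rats_dense_in_real by auto
    have "\<exists>\<^sub>F h in F. Q h < p"
    proof (rule ccontr)
      assume "\<not> (\<exists>\<^sub>F h in F. Q h < p)"
      then have "\<forall>\<^sub>F h in F. ereal p \<le> ereal (Q h)" by (simp add: not_frequently not_less)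
      then have "ereal p \<le> l" unfolding l_def by (rule Liminf_bounded)
      then have "ereal p < ereal p'" using p'(1) by (rule le_less_trans)
      then show False using p(2) by simp
    qed
    moreover have "\<exists>\<^sub>F h in F. q < Q h"
    proof (rule ccontr)
      assume "\<not> (\<exists>\<^sub>F h in F. q < Q h)"
      then have "\<forall>\<^sub>F h in F. ereal (Q h) \<le> ereal q" by (simp add: not_frequently not_less)
      then have "u \<le> ereal q" unfolding u_def by (rule Limsup_bounded)
      with q'(2) have "ereal q' < ereal q" by (rule less_le_trans)
      then show False using q(3) by simp
    qed
    ultimately show False using osc p(1) q by blast
  qed
  moreover have "l \<le> u" unfolding l_def u_def by (rule Liminf_le_Limsup[OF F])
  ultimately have eq: "l = u" by simp
  have "ereal (- B) \<le> l"
    unfolding l_def by (rule Liminf_bounded, rule eventually_mono[OF bd]) simp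
  moreover have "u \<le> ereal B"
    unfolding u_def by (rule Limsup_bounded, rule eventually_mono[OF bd]) simp
  ultimately obtain r where r: "u = ereal r"
    using eq by (cases u) auto
  have "((\<lambda>h. ereal (Q h)) \<longlongrightarrow> ereal r) F"
    by (rule Liminf_eq_Limsup[OF F]) (use eq r in \<open>simp_all add: l_def u_def\<close>)
  then show ?thesis by auto
qed

text \<open>For p < q, the points whose quotient along v falls below p and rises above q for
  arbitrarily small h meet every line in direction v in a negligible set, by the one-dimensional
  result. Hence they form a null set, and countably many such sets cover all failures of
  convergence.\<close>

lemma AE_right_directional_limit:
  fixes f :: "'a::euclidean_space \<Rightarrow> real"
  assumes lip: "L-lipschitz_on UNIV f"
  shows "AE x in lborel. \<exists>l. ((\<lambda>h. (f (x + h *\<^sub>R v) - f x) / h) \<longlongrightarrow> l) (at_right 0)"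
proof -
  have cont: "continuous_on UNIV f" using lip by (rule lipschitz_on_continuous_on)
  have cont': "continuous_on UNIV (\<lambda>x. f (x + h *\<^sub>R v) - f x)" for h
    by (intro continuous_intros continuous_on_compose2[OF cont]) auto
  \<comment> \<open>Strict inequalities between continuous functions make each of the two unions
    over h open for fixed n, so \<open>E p q\<close> is Borel as a countable intersection of open
    sets.\<close>
  define E where "E p q = {x. \<forall>n::nat. (\<exists>h. 0 < h \<and> h < 1 / Suc n \<and> q * h < f (x + h *\<^sub>R v) - f x)
      \<and> (\<exists>h. 0 < h \<and> h < 1 / Suc n \<and> f (x + h *\<^sub>R v) - f x < p * h)}" for p q
  have meas: "E p q \<in> sets borel" for p q
  proof -
    have eq: "E p q = (\<Inter>n::nat. (\<Union>h\<in>{h. 0 < h \<and> h < 1 / Suc n}. {x. q * h < f (x + h *\<^sub>R v) - f x})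
       \<inter> (\<Union>h\<in>{h. 0 < h \<and> h < 1 / Suc n}. {x. f (x + h *\<^sub>R v) - f x < p * h}))"
      by (auto simp: E_def)
    have "open {x. q * h < f (x + h *\<^sub>R v) - f x}" "open {x. f (x + h *\<^sub>R v) - f x < p * h}" for p q h
      by (intro open_Collect_less cont' continuous_intros)+
    then show ?thesis
      unfolding eq by (intro sets.countable_INT'[OF countableI_type] image_subsetI borel_open open_Int open_UN ballI) auto
  qed
  have null: "E p q \<in> null_sets lborel" if pq: "p < q" for p q
  proof (rule null_set_if_null_on_lines[OF meas])
    fix x :: 'a
    let ?F = "\<lambda>t::real. f (x + t *\<^sub>R v)" and ?E = "{t. x + t *\<^sub>R v \<in> E p q}"
    have lipF: "(L * norm v)-lipschitz_on UNIV ?F"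
    proof (rule lipschitz_onI)
      fix s t :: real
      have "dist (x + s *\<^sub>R v) (x + t *\<^sub>R v) = norm v * dist s t"
        by (metis dist_add_cancel dist_norm dist_real_def mult.commute norm_scaleR scaleR_left_diff_distrib)
      then show "dist (?F s) (?F t) \<le> L * norm v * dist s t"
        using lipschitz_onD[OF lip, of "x + s *\<^sub>R v" "x + t *\<^sub>R v"] by (simp only: mult.assoc UNIV_I)
    qed (use lipschitz_on_nonneg[OF lip] in simp)
    have Em: "?E \<in> sets borel"
    proof -
      have "(\<lambda>t::real. x + t *\<^sub>R v) -` E p q \<inter> space borel \<in> sets borel"
        by (rule measurable_sets[OF _ meas]) measurable
      then show ?thesis by (simp add: vimage_def)
    qed
    have shift: "f (x + t *\<^sub>R v + h *\<^sub>R v) = ?F (t + h)" for t h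
      by (simp add: scaleR_add_left add.assoc)
    have "negligible ?E"
    proof (rule negligible_distinct_right_derivates[OF lipF _ pq])
      show "?E \<in> sets lebesgue" using Em by simp
      fix t e :: real assume t: "t \<in> ?E" and e: "0 < e"
      obtain n where n: "1 / Suc n < e" using nat_approx_posE[OF e] by blast
      from t obtain h k where "0 < h" "h < 1 / Suc n" "q * h < ?F (t + h) - ?F t"
          "0 < k" "k < 1 / Suc n" "?F (t + k) - ?F t < p * k"
        unfolding E_def mem_Collect_eq shift by blast
      then show "\<exists>h. 0 < h \<and> h < e \<and> q * h \<le> ?F (t + h) - ?F t"
        "\<exists>h. 0 < h \<and> h < e \<and> ?F (t + h) - ?F t \<le> p * h"
        using n by (intro exI[of _ h] exI[of _ k]; simp)+
    qed
    then show "?E \<in> null_sets lborel"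
      using Em by (simp add: negligible_iff_null_sets null_sets_completion_iff)
  qed
  have "AE x in lborel. \<forall>r\<in>\<rat> \<times> \<rat>. fst r < snd r \<longrightarrow> x \<notin> E (fst r) (snd r)"
  proof (subst AE_ball_countable)
    show "countable (\<rat> \<times> \<rat> :: (real \<times> real) set)" by (simp add: countable_rat)
    show "\<forall>r\<in>\<rat> \<times> \<rat>. AE x in lborel. fst r < snd r \<longrightarrow> x \<notin> E (fst r) (snd r)"
      using null by (auto intro: AE_not_in)
  qed
  then show ?thesis
  proof (rule AE_mp, intro AE_I2 impI)
    fix x assume x: "\<forall>r\<in>\<rat> \<times> \<rat>. fst r < snd r \<longrightarrow> x \<notin> E (fst r) (snd r)"
    let ?Q = "\<lambda>h. (f (x + h *\<^sub>R v) - f x) / h"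
    have freq: "\<exists>h. 0 < h \<and> h < e \<and> P h" if "\<exists>\<^sub>F h in at_right 0. P h" "0 < e" for P and e :: real
    proof (rule ccontr)
      assume "\<not> ?thesis"
      then have "\<forall>\<^sub>F h in at_right 0. \<not> P h"
        unfolding eventually_at_right_field using that(2) by (intro exI[of _ e]) auto
      then show False using that(1) by (simp add: frequently_def)
    qed
    show "\<exists>l. (?Q \<longlongrightarrow> l) (at_right 0)"
    proof (rule tendsto_if_bounded_no_oscillation[OF trivial_limit_at_right_real])
      show "\<forall>\<^sub>F h in at_right 0. \<bar>?Q h\<bar> \<le> L * norm v"
        unfolding eventually_at_right_field
        by (intro exI[of _ 1]) (blast intro: zero_less_one difference_quotient_bound[OF lip])
      fix p q :: real assume pq: "p \<in> \<rat>" "q \<in> \<rat>" "p < q"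
      show "\<not> ((\<exists>\<^sub>F h in at_right 0. ?Q h < p) \<and> (\<exists>\<^sub>F h in at_right 0. q < ?Q h))"
      proof
        assume *: "(\<exists>\<^sub>F h in at_right 0. ?Q h < p) \<and> (\<exists>\<^sub>F h in at_right 0. q < ?Q h)"
        have "(\<exists>h. 0 < h \<and> h < 1 / Suc n \<and> q * h < f (x + h *\<^sub>R v) - f x)
            \<and> (\<exists>h. 0 < h \<and> h < 1 / Suc n \<and> f (x + h *\<^sub>R v) - f x < p * h)" for n :: nat
        proof -
          have e: "0 < 1 / real (Suc n)" by simp
          obtain h where "0 < h" "h < 1 / Suc n" "?Q h < p" using freq[OF conjunct1[OF *] e] by blast
          moreover obtain k where "0 < k" "k < 1 / Suc n" "q < ?Q k" using freq[OF conjunct2[OF *] e] by blast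
          ultimately show ?thesis
            by (intro conjI exI[of _ k] exI[of _ h]) (simp_all add: pos_less_divide_eq pos_divide_less_eq)
        qed
        then have "x \<in> E p q" unfolding E_def by blast
        then show False using bspec[OF x, of "(p, q)"] pq by simp
      qed
    qed
  qed
qed

text \<open>A limit along the sequence 1 / (n + 1) instead of \<open>at_right 0\<close> makes the
  function Borel measurable for continuous f; for Lipschitz f the two limits agree at almost every
  point.\<close>

definition right_dderiv :: "('a::euclidean_space \<Rightarrow> real) \<Rightarrow> 'a \<Rightarrow> 'a \<Rightarrow> real" where
  "right_dderiv f v x = lim (\<lambda>n. (f (x + (1 / Suc n) *\<^sub>R v) - f x) / (1 / Suc n))"

lemma right_dderiv_eqI:
  assumes "((\<lambda>h. (f (x + h *\<^sub>R v) - f x) / h) \<longlongrightarrow> l) (at_right 0)"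
  shows "right_dderiv f v x = l"
proof -
  have "filterlim (\<lambda>n. 1 / Suc n) (at_right 0) sequentially"
    by (intro tendsto_imp_filterlim_at_right)
      (use LIMSEQ_inverse_real_of_nat in \<open>auto simp: inverse_eq_divide add.commute\<close>)
  from filterlim_compose[OF assms this] show ?thesis
    unfolding right_dderiv_def by (rule limI)
qed

lemma AE_right_dderiv:
  fixes f :: "'a::euclidean_space \<Rightarrow> real"
  assumes "L-lipschitz_on UNIV f"
  shows "AE x in lborel. ((\<lambda>h. (f (x + h *\<^sub>R v) - f x) / h) \<longlongrightarrow> right_dderiv f v x) (at_right 0)"
  using AE_right_directional_limit[OF assms, of v]
  by eventually_elim (metis right_dderiv_eqI)

lemma borel_measurable_right_dderiv:
  fixes f :: "'a::euclidean_space \<Rightarrow> real"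
  assumes lip: "L-lipschitz_on UNIV f"
  shows "right_dderiv f v \<in> borel_measurable borel"
proof -
  have [measurable]: "f \<in> borel_measurable borel"
    using lip by (intro borel_measurable_continuous_onI lipschitz_on_continuous_on)
  show ?thesis unfolding right_dderiv_def[abs_def] by measurable
qed

section \<open>Linearity in the direction, by testing against cutoffs\<close>

text \<open>Continuous cutoffs approximate the indicator of a compact set, so \<open>G\<close> has
  integral 0 over every compact set. A compact set of positive measure inside
  \<open>{x. c < G x}\<close> would have a positive integral, and inner regularity then makes the
  bounded parts of these sets null.\<close>

lemma AE_nonpos_if_continuous_test_integrals_0:
  fixes G :: "'a::euclidean_space \<Rightarrow> real"
  assumes G[measurable]: "G \<in> borel_measurable borel" and bd: "\<And>x. \<bar>G x\<bar> \<le> B"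
    and test: "\<And>\<psi> r. continuous_on UNIV \<psi> \<Longrightarrow> (\<And>x. \<bar>\<psi> x\<bar> \<le> (1::real)) \<Longrightarrow> (\<And>x. x \<notin> cball 0 r \<Longrightarrow> \<psi> x = 0)
      \<Longrightarrow> (\<integral>x. \<psi> x * G x \<partial>lborel) = 0"
  shows "AE x in lborel. G x \<le> 0"
proof -
  have compact0: "(\<integral>x. indicator K x * G x \<partial>lborel) = 0" if K: "compact K" for K
  proof (cases "K = {}")
    case False
    obtain r where r: "K \<subseteq> cball 0 r"
      using compact_imp_bounded[OF K] by (auto simp: bounded_iff subset_iff)
    \<comment> \<open>For m \<ge> 1 this cutoff equals 1 on \<open>K\<close> and vanishes at
      distance 1 / m and beyond, hence outside the ball of radius r + 1.\<close>
    define \<psi> where "\<psi> m x = max 0 (1 - real m * infdist x K)" for m :: nat and x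
    have nonneg: "0 \<le> real m * infdist x K" for m x by (simp add: infdist_nonneg)
    have \<psi>1: "\<bar>\<psi> m x\<bar> \<le> 1" for m x using nonneg[of m x] unfolding \<psi>_def by linarith
    have \<psi>0: "\<psi> m x = 0" if x: "x \<notin> cball 0 (r + 1)" and m: "1 \<le> m" for m x
    proof -
      have "1 \<le> infdist x K"
        unfolding infdist_notempty[OF False]
      proof (rule cINF_greatest[OF False])
        fix y assume "y \<in> K"
        then have "norm y \<le> r" using r by (auto simp: dist_norm)
        moreover have "norm x - norm y \<le> dist x y" by (simp add: dist_norm norm_triangle_ineq2)
        ultimately show "1 \<le> dist x y" using x by (simp add: dist_norm)
      qed
      then have "1 * 1 \<le> real m * infdist x K" using m by (intro mult_mono) auto
      then show "\<psi> m x = 0" unfolding \<psi>_def by linarith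
    qed
    have cont: "continuous_on UNIV (\<psi> m)" for m unfolding \<psi>_def by (intro continuous_intros)
    have 0: "(\<integral>x. \<psi> m x * G x \<partial>lborel) = 0" if m: "1 \<le> m" for m
      using cont \<psi>1 \<psi>0[OF _ m] by (rule test)
    have [measurable]: "\<psi> m \<in> borel_measurable borel" for m
      using cont by (rule borel_measurable_continuous_onI)
    \<comment> \<open>The index is shifted because \<open>\<psi> 0\<close> is constantly 1 and has
      no bounded support.\<close>
    have lim: "(\<lambda>m. \<psi> (Suc m) x) \<longlonglongrightarrow> indicator K x" for x
    proof (cases "x \<in> K")
      case True
      then have "\<psi> m x = 1" for m by (simp add: \<psi>_def)
      then show ?thesis using True by simp
    next
      case x: False
      have "infdist x K > 0"
        using x False K in_closed_iff_infdist_zero[of K x] infdist_nonneg[of x K] compact_imp_closed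
        by (auto simp: order_less_le)
      then obtain N where N: "1 < real N * infdist x K" using ex_less_of_nat_mult by blast
      have "\<forall>\<^sub>F m in sequentially. \<psi> (Suc m) x = 0"
        unfolding eventually_sequentially
      proof (intro exI[of _ N] allI impI)
        fix m assume "N \<le> m"
        then have "real N * infdist x K \<le> real (Suc m) * infdist x K" by (intro mult_right_mono) (auto simp: infdist_nonneg)
        then show "\<psi> (Suc m) x = 0" using N unfolding \<psi>_def by linarith
      qed
      then have "(\<lambda>m. \<psi> (Suc m) x) \<longlonglongrightarrow> 0" by (rule tendsto_eventually)
      then show ?thesis using x by simp
    qed
    have "(\<lambda>m. \<integral>x. \<psi> (Suc m) x * G x \<partial>lborel) \<longlonglongrightarrow> (\<integral>x. indicator K x * G x \<partial>lborel)"
    proof (rule integral_dominated_convergence[where w="\<lambda>x. B * indicator (cball 0 (r + 1)) x"])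
      show "integrable lborel (\<lambda>x. B * indicator (cball (0::'a) (r + 1)) x)"
        by (intro integrable_mult_right integrable_real_indicator emeasure_compact_finite[OF compact_cball]) simp
      show "AE x in lborel. (\<lambda>m. \<psi> (Suc m) x * G x) \<longlonglongrightarrow> indicator K x * G x"
        by (intro AE_I2 tendsto_mult lim tendsto_const)
      show "AE x in lborel. norm (\<psi> (Suc m) x * G x) \<le> B * indicator (cball 0 (r + 1)) x" for m
      proof (intro AE_I2)
        fix x :: 'a
        show "norm (\<psi> (Suc m) x * G x) \<le> B * indicator (cball 0 (r + 1)) x"
        proof (cases "x \<in> cball 0 (r + 1)")
          case True
          have "\<bar>\<psi> (Suc m) x\<bar> * \<bar>G x\<bar> \<le> 1 * B"
            using bd[of x] \<psi>1[of "Suc m" x] by (intro mult_mono) auto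
          then show ?thesis using True by (simp add: abs_mult)
        next
          case False
          then show ?thesis using \<psi>0[OF False, of "Suc m"] by simp
        qed
      qed
    qed (use K in \<open>auto intro!: borel_measurable_times borel_measurable_indicator borel_compact\<close>)
    moreover have "(\<lambda>m. \<integral>x. \<psi> (Suc m) x * G x \<partial>lborel) = (\<lambda>m. 0)" using 0 by auto
    ultimately show ?thesis by (simp add: LIMSEQ_const_iff)
  qed simp
  have "emeasure lborel ({x. c < G x} \<inter> cball 0 r) = 0" if c: "c > 0" for c r
  proof -
    let ?S = "{x. c < G x} \<inter> cball 0 r"
    have S: "?S \<in> sets lborel" by measurable
    have small: "emeasure lborel ?S \<le> 0 + ennreal e" if e: "e > 0" for e
    proof -
      obtain T where T: "closed T" "T \<subseteq> ?S" "?S - T \<in> lmeasurable" "emeasure lebesgue (?S - T) < ennreal e"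
        using sets_lebesgue_inner_closed[of ?S e] S e by auto
      have cT: "compact T"
        using T by (auto simp: compact_eq_bounded_closed intro: bounded_subset[of "cball 0 r"])
      have "c * measure lborel T = (\<integral>x. c * indicator T x \<partial>lborel)" using cT by (simp add: borel_compact)
      also have "\<dots> \<le> (\<integral>x. indicator T x * G x \<partial>lborel)"
      proof (rule integral_mono)
        show "integrable lborel (\<lambda>x. c * indicator T x)"
          by (intro integrable_mult_right integrable_real_indicator emeasure_compact_finite cT)
            (simp add: borel_compact cT)
        show "integrable lborel (\<lambda>x. indicator T x * G x)"
        proof (rule Bochner_Integration.integrable_bound[of _ "\<lambda>x. B * indicator T x"])
          show "integrable lborel (\<lambda>x. B * indicator T x)"
            by (intro integrable_mult_right integrable_real_indicator emeasure_compact_finite cT)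
              (simp add: borel_compact cT)
          show "AE x in lborel. norm (indicator T x * G x) \<le> norm (B * indicator T x)"
            using bd by (intro AE_I2) (auto simp: indicator_def intro: order_trans[OF _ abs_ge_self])
        qed (use cT in \<open>auto intro!: borel_measurable_times borel_measurable_indicator borel_compact\<close>)
        show "c * indicator T x \<le> indicator T x * G x" for x
          using T(2) by (auto simp: indicator_def intro: less_imp_le)
      qed
      also have "\<dots> = 0" by (rule compact0[OF cT])
      finally have "measure lborel T = 0"
        using c measure_nonneg[of lborel T] by (simp add: mult_le_0_iff)
      then have "emeasure lborel T = 0"
        using cT emeasure_compact_finite[OF cT] by (simp add: emeasure_eq_ennreal_measure)
      then have 0: "emeasure lebesgue T = 0" using cT by (simp add: borel_compact)
      have "emeasure lebesgue ?S \<le> emeasure lebesgue T + emeasure lebesgue (?S - T)"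
        using T S cT by (intro order_trans[OF emeasure_mono emeasure_subadditive[of T _ "?S - T"]]) (auto simp: borel_compact)
      also have "\<dots> \<le> ennreal e" using 0 T(4) by simp
      finally show ?thesis using S by simp
    qed
    have "emeasure lborel ?S \<le> 0" by (rule ennreal_le_epsilon) (rule small)
    then show ?thesis by simp
  qed
  then have "AE x in lborel. x \<notin> {x. 1 / Suc n < G x} \<inter> cball 0 (real m)" for n m :: nat
    by (intro AE_not_in) (auto simp: null_sets_def)
  then have "AE x in lborel. \<forall>n m :: nat. x \<notin> {x. 1 / Suc n < G x} \<inter> cball 0 (real m)"
    unfolding AE_all_countable by blast
  then show ?thesis
  proof (rule AE_mp, intro AE_I2 impI)
    fix x assume x: "\<forall>n m :: nat. x \<notin> {x. 1 / Suc n < G x} \<inter> cball 0 (real m)"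
    obtain m :: nat where "norm x \<le> real m" using real_arch_simple by blast
    show "G x \<le> 0"
    proof (rule ccontr)
      assume "\<not> G x \<le> 0"
      then have "0 < G x" by simp
      then obtain n where "1 / Suc n < G x" using nat_approx_posE by blast
      then show False using x[rule_format, of n m] \<open>norm x \<le> real m\<close> by simp
    qed
  qed
qed


lemma right_dderiv_bound:
  fixes f :: "'a::euclidean_space \<Rightarrow> real"
  assumes lip: "L-lipschitz_on UNIV f"
    and lim: "((\<lambda>h. (f (x + h *\<^sub>R v) - f x) / h) \<longlongrightarrow> right_dderiv f v x) (at_right 0)"
  shows "\<bar>right_dderiv f v x\<bar> \<le> L * norm v"
proof (rule tendsto_upperbound[OF tendsto_rabs[OF lim]])
  show "\<forall>\<^sub>F h in at_right 0. \<bar>(f (x + h *\<^sub>R v) - f x) / h\<bar> \<le> L * norm v"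
    unfolding eventually_at_right_field
    by (intro exI[of _ 1]) (blast intro: zero_less_one difference_quotient_bound[OF lip])
qed simp

lemma tendsto_integral_difference_quotient:
  fixes f :: "'a::euclidean_space \<Rightarrow> real" and \<psi> :: "'a \<Rightarrow> real"
  assumes lip: "L-lipschitz_on UNIV f" and cont: "continuous_on UNIV \<psi>"
    and \<psi>1: "\<And>x. \<bar>\<psi> x\<bar> \<le> 1" and supp: "\<And>x. x \<notin> cball 0 r \<Longrightarrow> \<psi> x = 0"
    and h: "filterlim h (at_right 0) sequentially"
  shows "(\<lambda>n. \<integral>x. \<psi> (x - h n *\<^sub>R w) * ((f (x + h n *\<^sub>R v) - f x) / h n) \<partial>lborel)
    \<longlonglongrightarrow> (\<integral>x. \<psi> x * right_dderiv f v x \<partial>lborel)"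
proof -
  have h0: "h \<longlonglongrightarrow> 0" using h by (simp add: filterlim_at)
  have "\<forall>\<^sub>F n in sequentially. h n \<in> {0<..} \<and> h n \<noteq> 0" using h by (simp add: filterlim_at)
  with order_tendstoD(2)[OF h0 zero_less_one]
  have "\<forall>\<^sub>F n in sequentially. h n \<in> {0<..<1}" by eventually_elim simp
  then obtain N where N: "\<And>n. N \<le> n \<Longrightarrow> 0 < h n \<and> h n < 1"
    by (auto simp: eventually_sequentially)
  have [measurable]: "f \<in> borel_measurable borel" "\<psi> \<in> borel_measurable borel"
    using lip cont by (auto intro: borel_measurable_continuous_onI lipschitz_on_continuous_on)
  have [measurable]: "right_dderiv f v \<in> borel_measurable borel" using lip by (rule borel_measurable_right_dderiv)
  let ?I = "\<lambda>n x. \<psi> (x - h n *\<^sub>R w) * ((f (x + h n *\<^sub>R v) - f x) / h n)"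
  have "(\<lambda>n. \<integral>x. ?I (n + N) x \<partial>lborel) \<longlonglongrightarrow> (\<integral>x. \<psi> x * right_dderiv f v x \<partial>lborel)"
  proof (rule integral_dominated_convergence[where w="\<lambda>x. (L * norm v) * indicator (cball 0 (r + norm w)) x"])
    show "integrable lborel (\<lambda>x. (L * norm v) * indicator (cball (0::'a) (r + norm w)) x)"
      by (intro integrable_mult_right integrable_real_indicator emeasure_compact_finite[OF compact_cball]) simp
    show "AE x in lborel. (\<lambda>n. ?I (n + N) x) \<longlonglongrightarrow> \<psi> x * right_dderiv f v x"
      using AE_right_dderiv[OF lip, of v]
    proof eventually_elim
      case (elim x)
      have "(\<lambda>n. x - h n *\<^sub>R w) \<longlonglongrightarrow> x - 0 *\<^sub>R w" by (intro tendsto_intros h0)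
      then have "(\<lambda>n. \<psi> (x - h n *\<^sub>R w)) \<longlonglongrightarrow> \<psi> x"
        using continuous_on_tendsto_compose[OF cont, of "\<lambda>n. x - h n *\<^sub>R w" x] by simp
      then have "(\<lambda>n. ?I n x) \<longlonglongrightarrow> \<psi> x * right_dderiv f v x"
        by (intro tendsto_mult filterlim_compose[OF elim h])
      then show ?case by (rule LIMSEQ_ignore_initial_segment)
    qed
    show "AE x in lborel. norm (?I (n + N) x) \<le> (L * norm v) * indicator (cball 0 (r + norm w)) x" for n
    proof (intro AE_I2)
      fix x :: 'a
      have hn: "0 < h (n + N)" "h (n + N) < 1" using N[of "n + N"] by auto
      show "norm (?I (n + N) x) \<le> (L * norm v) * indicator (cball 0 (r + norm w)) x"
      proof (cases "x \<in> cball 0 (r + norm w)")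
        case True
        have "\<bar>\<psi> (x - h (n + N) *\<^sub>R w)\<bar> * \<bar>(f (x + h (n + N) *\<^sub>R v) - f x) / h (n + N)\<bar> \<le> 1 * (L * norm v)"
          by (intro mult_mono \<psi>1 difference_quotient_bound[OF lip hn(1)]) auto
        then show ?thesis using True by (simp add: abs_mult)
      next
        case False
        have "norm x \<le> norm (x - h (n + N) *\<^sub>R w) + norm (h (n + N) *\<^sub>R w)"
          using norm_triangle_ineq[of "x - h (n + N) *\<^sub>R w" "h (n + N) *\<^sub>R w"] by simp
        moreover have "norm (h (n + N) *\<^sub>R w) \<le> norm w"
          using hn mult_right_mono[of "h (n + N)" 1 "norm w"] by simp
        ultimately have "x - h (n + N) *\<^sub>R w \<notin> cball 0 r"
          using False unfolding mem_cball_0 by linarith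
        then have "\<psi> (x - h (n + N) *\<^sub>R w) = 0" by (rule supp)
        then show ?thesis using False by simp
      qed
    qed
  qed measurable
  then show ?thesis by (rule LIMSEQ_offset)
qed

text \<open>The sign \<open>s\<close> gives both inequalities of additivity from a one-sided test-function criterion.\<close>

lemma AE_right_dderiv_add_aux:
  fixes f :: "'a::euclidean_space \<Rightarrow> real"
  assumes lip: "L-lipschitz_on UNIV f" and s: "\<bar>s\<bar> = (1::real)"
  shows "AE x in lborel. s * (right_dderiv f (v + w) x - right_dderiv f v x - right_dderiv f w x) \<le> 0"
proof -
  let ?D = "\<lambda>v x. right_dderiv f v x"
  have meas[measurable]: "?D v \<in> borel_measurable borel" for v using lip by (rule borel_measurable_right_dderiv)
  \<comment> \<open>The criterion needs a bound at every point, while the derivative is known to be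
    bounded by \<open>L * norm v\<close> only almost everywhere; clipping changes it on a null
    set.\<close>
  define T where "T v x = max (- (L * norm v)) (min (L * norm v) (?D v x))" for v x
  have [measurable]: "T v \<in> borel_measurable borel" for v unfolding T_def by measurable
  have L: "0 \<le> L" using lip by (rule lipschitz_on_nonneg)
  have T_bd: "\<bar>T v x\<bar> \<le> L * norm v" for v x using L unfolding T_def by (auto simp: abs_le_iff min_def max_def)
  have T_eq: "AE x in lborel. T v x = ?D v x" for v
    using AE_right_dderiv[OF lip, of v]
  proof eventually_elim
    case (elim x)
    then show ?case using right_dderiv_bound[OF lip elim] unfolding T_def by (auto simp: abs_le_iff)
  qed
  define h :: "nat \<Rightarrow> real" where "h n = 1 / Suc n" for n
  have h: "filterlim h (at_right 0) sequentially"
    unfolding h_def by (intro tendsto_imp_filterlim_at_right)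
      (use LIMSEQ_inverse_real_of_nat in \<open>auto simp: inverse_eq_divide add.commute\<close>)
  have h_pos: "h n > 0" for n by (simp add: h_def)
  have "AE x in lborel. s * (T (v + w) x - T v x - T w x) \<le> 0"
  proof (rule AE_nonpos_if_continuous_test_integrals_0[where B="L * norm (v + w) + L * norm v + L * norm w"])
    show "\<bar>s * (T (v + w) x - T v x - T w x)\<bar> \<le> L * norm (v + w) + L * norm v + L * norm w" for x
      using T_bd[of "v + w" x] T_bd[of v x] T_bd[of w x] s by (simp add: abs_mult)
    fix \<psi> :: "'a \<Rightarrow> real" and r
    assume \<psi>: "continuous_on UNIV \<psi>" "\<And>x. \<bar>\<psi> x\<bar> \<le> 1" "\<And>x. x \<notin> cball 0 r \<Longrightarrow> \<psi> x = 0"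
    have [measurable]: "f \<in> borel_measurable borel" "\<psi> \<in> borel_measurable borel"
      using lip \<psi> by (auto intro: borel_measurable_continuous_onI lipschitz_on_continuous_on)
    let ?q = "\<lambda>v n x. (f (x + h n *\<^sub>R v) - f x) / h n"
    have int: "integrable lborel (\<lambda>x. \<psi> x * G x)"
      if [measurable]: "G \<in> borel_measurable borel" and B: "\<And>x. \<bar>G x\<bar> \<le> B" for G B
    proof (rule Bochner_Integration.integrable_bound[of _ "\<lambda>x. B * indicator (cball 0 r) x"])
      show "integrable lborel (\<lambda>x. B * indicator (cball (0::'a) r) x)"
        by (intro integrable_mult_right integrable_real_indicator emeasure_compact_finite[OF compact_cball]) simp
      show "AE x in lborel. norm (\<psi> x * G x) \<le> norm (B * indicator (cball 0 r) x)"
      proof (intro AE_I2)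
        fix x
        have "\<bar>\<psi> x\<bar> * \<bar>G x\<bar> \<le> 1 * B" using \<psi>(2) B by (intro mult_mono) auto
        then show "norm (\<psi> x * G x) \<le> norm (B * indicator (cball 0 r) x)"
          using \<psi>(3)[of x] by (cases "x \<in> cball 0 r") (auto simp: abs_mult)
      qed
    qed measurable
    have int_q: "integrable lborel (\<lambda>x. \<psi> x * ?q v n x)" for v n
      by (rule int[where B="L * norm v"]) (use difference_quotient_bound[OF lip h_pos] in auto)
    have int_q': "integrable lborel (\<lambda>x. \<psi> x * ?q w n (x + h n *\<^sub>R v))" for v w n
      by (rule int[where B="L * norm w"]) (use difference_quotient_bound[OF lip h_pos] in auto)
    \<comment> \<open>The increment along v + w is the one along v followed by the one along w from
      the shifted point; translation invariance of the integral transfers the shift to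
      \<psi>.\<close>
    have "(\<integral>x. \<psi> x * ?q (v + w) n x \<partial>lborel) - (\<integral>x. \<psi> x * ?q v n x \<partial>lborel)
        = (\<integral>x. \<psi> (x - h n *\<^sub>R v) * ?q w n x \<partial>lborel)" for n
    proof -
      have "\<psi> x * ?q (v + w) n x = \<psi> x * ?q v n x + \<psi> x * ?q w n (x + h n *\<^sub>R v)" for x
        using h_pos[of n] by (simp add: field_simps scaleR_add_right)
      then have "(\<integral>x. \<psi> x * ?q (v + w) n x \<partial>lborel)
        = (\<integral>x. \<psi> x * ?q v n x \<partial>lborel) + (\<integral>x. \<psi> x * ?q w n (x + h n *\<^sub>R v) \<partial>lborel)"
        using Bochner_Integration.integral_add[OF int_q[where v=v and n=n] int_q'[where v=v and w=w and n=n]] by simp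
      also have "(\<integral>x. \<psi> x * ?q w n (x + h n *\<^sub>R v) \<partial>lborel)
          = (\<integral>x. \<psi> (x - h n *\<^sub>R v) * ?q w n x \<partial>distr lborel borel ((+) (h n *\<^sub>R v)))"
        by (subst integral_distr) (simp_all add: add.commute)
      finally show ?thesis by (simp only: lborel_distr_plus)
    qed
    moreover have "(\<lambda>n. (\<integral>x. \<psi> x * ?q (v + w) n x \<partial>lborel) - (\<integral>x. \<psi> x * ?q v n x \<partial>lborel))
        \<longlonglongrightarrow> (\<integral>x. \<psi> x * ?D (v + w) x \<partial>lborel) - (\<integral>x. \<psi> x * ?D v x \<partial>lborel)"
      using tendsto_integral_difference_quotient[OF lip \<psi> h, where w=0, unfolded scaleR_zero_right diff_zero]
      by (intro tendsto_diff)
    moreover have "(\<lambda>n. \<integral>x. \<psi> (x - h n *\<^sub>R v) * ?q w n x \<partial>lborel) \<longlonglongrightarrow> (\<integral>x. \<psi> x * ?D w x \<partial>lborel)"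
      by (rule tendsto_integral_difference_quotient[OF lip \<psi> h])
    ultimately have D: "(\<integral>x. \<psi> x * ?D (v + w) x \<partial>lborel) - (\<integral>x. \<psi> x * ?D v x \<partial>lborel) = (\<integral>x. \<psi> x * ?D w x \<partial>lborel)"
      using LIMSEQ_unique by simp
    have DT: "(\<integral>x. \<psi> x * ?D v x \<partial>lborel) = (\<integral>x. \<psi> x * T v x \<partial>lborel)" for v
      by (rule integral_cong_AE) (use T_eq[of v] in \<open>auto elim!: eventually_mono\<close>)
    have int_T: "integrable lborel (\<lambda>x. \<psi> x * T v x)" for v
      by (rule int[OF _ T_bd]) measurable
    have "(\<integral>x. \<psi> x * (s * (T (v + w) x - T v x - T w x)) \<partial>lborel)
       = (\<integral>x. s * (\<psi> x * T (v + w) x - \<psi> x * T v x - \<psi> x * T w x) \<partial>lborel)"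
      by (simp add: algebra_simps)
    also have "\<dots> = s * ((\<integral>x. \<psi> x * T (v + w) x \<partial>lborel) - (\<integral>x. \<psi> x * T v x \<partial>lborel) - (\<integral>x. \<psi> x * T w x \<partial>lborel))"
      by (simp only: integral_mult_right_zero Bochner_Integration.integral_diff Bochner_Integration.integrable_diff int_T)
    also have "\<dots> = 0" using D by (simp add: DT)
    finally show "(\<integral>x. \<psi> x * (s * (T (v + w) x - T v x - T w x)) \<partial>lborel) = 0" .
  qed measurable
  with T_eq[of v] T_eq[of w] T_eq[of "v + w"] show ?thesis
    by eventually_elim simp
qed

lemma AE_right_dderiv_add:
  fixes f :: "'a::euclidean_space \<Rightarrow> real"
  assumes lip: "L-lipschitz_on UNIV f"
  shows "AE x in lborel. right_dderiv f (v + w) x = right_dderiv f v x + right_dderiv f w x"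
proof -
  have "\<bar>1\<bar> = (1::real)" "\<bar>- 1\<bar> = (1::real)" by auto
  from this[THEN AE_right_dderiv_add_aux[OF lip, of _ v w]] show ?thesis
    by eventually_elim simp
qed

lemma right_dderiv_0: "right_dderiv f 0 x = 0"
  by (simp add: right_dderiv_def)

lemma AE_right_dderiv_scaleR_nonneg:
  fixes f :: "'a::euclidean_space \<Rightarrow> real"
  assumes lip: "L-lipschitz_on UNIV f" and c: "0 \<le> c"
  shows "AE x in lborel. right_dderiv f (c *\<^sub>R v) x = c * right_dderiv f v x"
proof (cases "c = 0")
  case True
  then show ?thesis by (simp add: right_dderiv_0)
next
  case False
  then have c: "0 < c" using c by simp
  show ?thesis
    using AE_right_dderiv[OF lip, of v]
  proof eventually_elim
    case (elim x)
    have "filterlim (\<lambda>h. c * h) (at_right 0) (at_right 0)"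
      unfolding filterlim_at
    proof
      show "\<forall>\<^sub>F h in at_right 0. c * h \<in> {0<..} \<and> c * h \<noteq> 0"
        using eventually_at_right_less[of 0] by eventually_elim (use c in simp)
      show "((*) c \<longlongrightarrow> 0) (at_right 0)" by (rule tendsto_eq_intros | simp)+
    qed
    from filterlim_compose[OF elim this]
    have "((\<lambda>h. c * ((f (x + (c * h) *\<^sub>R v) - f x) / (c * h))) \<longlongrightarrow> c * right_dderiv f v x) (at_right 0)"
      by (rule tendsto_mult[OF tendsto_const])
    then have "((\<lambda>h. (f (x + h *\<^sub>R (c *\<^sub>R v)) - f x) / h) \<longlongrightarrow> c * right_dderiv f v x) (at_right 0)"
      using c by (simp add: mult.commute)
    then show ?case by (rule right_dderiv_eqI)
  qed
qed

text \<open>Additivity along \<open>c *\<^sub>R v\<close> and its opposite, whose sum is the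
  direction 0 with derivative 0, reduces a negative factor to a positive one. Here the one-sided
  derivative becomes two-sided.\<close>

lemma AE_right_dderiv_scaleR:
  fixes f :: "'a::euclidean_space \<Rightarrow> real"
  assumes lip: "L-lipschitz_on UNIV f"
  shows "AE x in lborel. right_dderiv f (c *\<^sub>R v) x = c * right_dderiv f v x"
proof (cases "0 \<le> c")
  case False
  have "AE x in lborel. right_dderiv f ((- c) *\<^sub>R v) x = - c * right_dderiv f v x"
    using False by (intro AE_right_dderiv_scaleR_nonneg[OF lip]) simp
  with AE_right_dderiv_add[OF lip, of "c *\<^sub>R v" "(- c) *\<^sub>R v"] show ?thesis
    by eventually_elim (simp add: right_dderiv_0)
qed (rule AE_right_dderiv_scaleR_nonneg[OF lip])

lemma AE_right_dderiv_eq_inner: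
  fixes f :: "'a::euclidean_space \<Rightarrow> real"
  assumes lip: "L-lipschitz_on UNIV f"
  shows "AE x in lborel. right_dderiv f v x = v \<bullet> (\<Sum>b\<in>Basis. right_dderiv f b x *\<^sub>R b)"
proof -
  have "AE x in lborel. right_dderiv f (\<Sum>b\<in>B. (v \<bullet> b) *\<^sub>R b) x = (\<Sum>b\<in>B. (v \<bullet> b) * right_dderiv f b x)"
    if "finite B" "B \<subseteq> Basis" for B
    using that
  proof (induction B)
    case (insert b B)
    then have "AE x in lborel. right_dderiv f (\<Sum>b\<in>B. (v \<bullet> b) *\<^sub>R b) x = (\<Sum>b\<in>B. (v \<bullet> b) * right_dderiv f b x)" by simp
    with AE_right_dderiv_add[OF lip, of "(v \<bullet> b) *\<^sub>R b" "\<Sum>b\<in>B. (v \<bullet> b) *\<^sub>R b"] AE_right_dderiv_scaleR[OF lip, of "v \<bullet> b" b]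
    show ?case
      by eventually_elim (use insert.hyps in simp)
  qed (simp add: right_dderiv_0)
  from this[OF finite_Basis order_refl] show ?thesis
    by (simp add: euclidean_representation inner_sum_right mult.commute)
qed

section \<open>From directional derivatives to differentiability\<close>

text \<open>Almost everywhere the directional limits are given by one vector for a countable dense
  set of directions simultaneously. Finitely many of these directions form an \<eta>-net of the unit
  ball, on which the convergence is uniform, and the Lipschitz bound transfers the estimate from the
  net to every direction.\<close>

theorem Rademacher:
  fixes f :: "'a::euclidean_space \<Rightarrow> real"
  assumes lip: "L-lipschitz_on UNIV f"
  obtains g where "g \<in> borel_measurable borel" "AE x in lborel. GDERIV f x :> g x"
proof
  let ?g = "\<lambda>x. \<Sum>b\<in>Basis. right_dderiv f b x *\<^sub>R b"
  note borel_measurable_right_dderiv[OF lip, measurable]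
  show "?g \<in> borel_measurable borel" by measurable
  obtain S :: "'a set" where S: "countable S" "\<And>X. open X \<Longrightarrow> X \<noteq> {} \<Longrightarrow> \<exists>d\<in>S. d \<in> X"
    using countable_dense_setE by metis
  have "AE x in lborel. \<forall>v\<in>S. ((\<lambda>h. (f (x + h *\<^sub>R v) - f x) / h) \<longlongrightarrow> v \<bullet> ?g x) (at_right 0)"
  proof (subst AE_ball_countable[OF S(1)], intro ballI)
    fix v
    show "AE x in lborel. ((\<lambda>h. (f (x + h *\<^sub>R v) - f x) / h) \<longlongrightarrow> v \<bullet> ?g x) (at_right 0)"
      using AE_right_dderiv[OF lip, of v] AE_right_dderiv_eq_inner[OF lip, of v]
      by eventually_elim simp
  qed
  then show "AE x in lborel. GDERIV f x :> ?g x"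
  proof eventually_elim
    case (elim x)
    define g where "g = ?g x"
    have L: "0 \<le> L" using lip by (rule lipschitz_on_nonneg)
    show ?case
      unfolding gderiv_def g_def[symmetric] has_derivative_at_alt
    proof (intro conjI allI impI)
      show "bounded_linear (\<lambda>h. h \<bullet> g)" by (rule bounded_linear_inner_left)
      fix e :: real assume e: "0 < e"
      \<comment> \<open>Replacing a direction by its neighbour in the net costs at most \<eta> (L +
        norm g) per unit length, which this choice keeps below e / 2; the summand 1 keeps the
        denominator positive.\<close>
      define \<eta> where "\<eta> = e / (2 * (L + norm g + 1))"
      have \<eta>: "0 < \<eta>" using e L by (simp add: \<eta>_def add_nonneg_pos)
      have "cball (0::'a) 1 \<subseteq> (\<Union>v\<in>S. ball v \<eta>)"
      proof
        fix u :: 'a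
        obtain v where "v \<in> S" "v \<in> ball u \<eta>" using S(2)[of "ball u \<eta>"] \<eta> by auto
        then show "u \<in> (\<Union>v\<in>S. ball v \<eta>)" by (auto simp: dist_commute)
      qed
      then obtain S' where S': "S' \<subseteq> S" "finite S'" "cball 0 1 \<subseteq> (\<Union>v\<in>S'. ball v \<eta>)"
        using compactE_image[OF compact_cball, of S "\<lambda>v. ball v \<eta>"] by (metis open_ball)
      have "\<forall>\<^sub>F h in at_right 0. \<forall>v\<in>S'. \<bar>(f (x + h *\<^sub>R v) - f x) / h - v \<bullet> g\<bar> < e / 2"
      proof (rule eventually_ball_finite[OF S'(2)], intro ballI)
        fix v assume "v \<in> S'"
        then have "((\<lambda>h. (f (x + h *\<^sub>R v) - f x) / h) \<longlongrightarrow> v \<bullet> g) (at_right 0)"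
          using elim S'(1) unfolding g_def by blast
        from tendstoD[OF this, of "e / 2"] e
        show "\<forall>\<^sub>F h in at_right 0. \<bar>(f (x + h *\<^sub>R v) - f x) / h - v \<bullet> g\<bar> < e / 2"
          by (simp add: dist_real_def)
      qed
      then obtain d where d: "d > 0" "\<And>h v. 0 < h \<Longrightarrow> h < d \<Longrightarrow> v \<in> S' \<Longrightarrow> \<bar>(f (x + h *\<^sub>R v) - f x) / h - v \<bullet> g\<bar> < e / 2"
        unfolding eventually_at_right_field by blast
      show "\<exists>d>0. \<forall>y. norm (y - x) < d \<longrightarrow> norm (f y - f x - (y - x) \<bullet> g) \<le> e * norm (y - x)"
      proof (intro exI[of _ d] conjI allI impI d(1))
        fix y assume y: "norm (y - x) < d"
        show "norm (f y - f x - (y - x) \<bullet> g) \<le> e * norm (y - x)"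
        proof (cases "y = x")
          case False
          define t where "t = norm (y - x)"
          define u where "u = (1 / t) *\<^sub>R (y - x)"
          have t: "0 < t" "t < d" using False y by (auto simp: t_def)
          have yu: "y - x = t *\<^sub>R u" using t by (simp add: u_def)
          have "u \<in> cball 0 1" using t by (simp add: u_def t_def)
          then obtain v where v: "v \<in> S'" "dist v u < \<eta>" using S'(3) by auto
          have 1: "\<bar>f (x + t *\<^sub>R v) - f x - t * (v \<bullet> g)\<bar> \<le> t * (e / 2)"
          proof -
            have "\<bar>t * ((f (x + t *\<^sub>R v) - f x) / t - v \<bullet> g)\<bar> \<le> t * (e / 2)"
              using d(2)[OF t v(1)] t by (simp add: abs_mult)
            moreover have "t * ((f (x + t *\<^sub>R v) - f x) / t - v \<bullet> g) = f (x + t *\<^sub>R v) - f x - t * (v \<bullet> g)"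
              using t by (simp add: field_simps)
            ultimately show ?thesis by simp
          qed
          have 2: "\<bar>f y - f (x + t *\<^sub>R v)\<bar> \<le> L * (t * \<eta>)"
          proof -
            have "dist y (x + t *\<^sub>R v) = t * dist v u"
            proof -
              have "y - (x + t *\<^sub>R v) = t *\<^sub>R (u - v)" using yu by (simp add: algebra_simps)
              then show ?thesis using t by (simp add: dist_norm norm_minus_commute)
            qed
            also have "\<dots> \<le> t * \<eta>" using v(2) t by (intro mult_left_mono) auto
            finally have "L * dist y (x + t *\<^sub>R v) \<le> L * (t * \<eta>)" using L by (rule mult_left_mono)
            then show ?thesis using lipschitz_onD[OF lip, of y "x + t *\<^sub>R v"] by (simp add: dist_real_def)
          qed
          have 3: "\<bar>t * (v \<bullet> g) - (y - x) \<bullet> g\<bar> \<le> t * \<eta> * norm g"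
          proof -
            have "t * (v \<bullet> g) - (y - x) \<bullet> g = t * ((v - u) \<bullet> g)"
              by (simp add: yu inner_diff_left algebra_simps)
            moreover have "\<bar>(v - u) \<bullet> g\<bar> \<le> \<eta> * norm g"
              using v(2) by (intro order_trans[OF Cauchy_Schwarz_ineq2] mult_right_mono) (auto simp: dist_norm)
            ultimately show ?thesis using t by (simp add: abs_mult mult.assoc)
          qed
          have "\<bar>f y - f x - (y - x) \<bullet> g\<bar> \<le> t * (e / 2) + L * (t * \<eta>) + t * \<eta> * norm g"
            using 1 2 3 by linarith
          also have "\<dots> = t * (e / 2) + t * (\<eta> * (L + norm g))" by (simp add: algebra_simps)
          also have "\<dots> \<le> t * (e / 2) + t * (e / 2)"
          proof -
            have "L + norm g + 1 > 0" using L norm_ge_zero[of g] by linarith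
            then have "\<eta> * (L + norm g + 1) = e / 2" unfolding \<eta>_def by (simp add: field_simps del: add_pos_nonneg)
            moreover have "\<eta> * (L + norm g) \<le> \<eta> * (L + norm g + 1)" using \<eta> by (intro mult_left_mono) auto
            ultimately have "\<eta> * (L + norm g) \<le> e / 2" by linarith
            then have "t * (\<eta> * (L + norm g)) \<le> t * (e / 2)" using t by (intro mult_left_mono) auto
            then show ?thesis by linarith
          qed
          also have "\<dots> = t * e" by simp
          finally have "\<bar>f y - f x - (y - x) \<bullet> g\<bar> \<le> t * e" .
          then show ?thesis by (simp add: t_def mult.commute)
        qed simp
      qed
    qed
  qed
qed

subsection \<open>Second-order estimates\<close>

lemma GDERIV_imp_isCont: "GDERIV \<phi> x :> D \<Longrightarrow> isCont \<phi> x"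
  unfolding gderiv_def by (rule has_derivative_continuous)

text \<open>The mean value theorem in the direction u turns the second difference into a difference
  of gradients at two points near x. Both are compared with the linearisation of \<open>D\<close> at
  x, so differentiability of \<open>D\<close> at this single point is enough.\<close>

lemma mixed_difference_estimate:
  fixes \<phi> :: "'a::real_inner \<Rightarrow> real"
  assumes grad: "\<And>y. dist y x < d \<Longrightarrow> GDERIV \<phi> y :> D y"
    and A: "linear A" and e: "0 \<le> e"
    and est: "\<And>y. dist y x < d \<Longrightarrow> norm (D y - D x - A (y - x)) \<le> e * norm (y - x)"
    and t: "0 < t" "t * (norm u + norm w) < d"
  shows "\<bar>\<phi> (x + t *\<^sub>R u + t *\<^sub>R w) - \<phi> (x + t *\<^sub>R u) - \<phi> (x + t *\<^sub>R w) + \<phi> x - t\<^sup>2 * (u \<bullet> A w)\<bar>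
    \<le> t\<^sup>2 * (2 * e * norm u * (norm u + norm w))"
proof -
  let ?g = "\<lambda>\<tau>. \<phi> (x + \<tau> *\<^sub>R u + t *\<^sub>R w) - \<phi> (x + \<tau> *\<^sub>R u)"
  let ?g' = "\<lambda>\<tau>. u \<bullet> D (x + \<tau> *\<^sub>R u + t *\<^sub>R w) - u \<bullet> D (x + \<tau> *\<^sub>R u)"
  have in1: "dist (x + \<tau> *\<^sub>R u + t *\<^sub>R w) x < d" "dist (x + \<tau> *\<^sub>R u) x < d"
    and n1: "norm (\<tau> *\<^sub>R u + t *\<^sub>R w) \<le> t * (norm u + norm w)" "norm (\<tau> *\<^sub>R u) \<le> t * (norm u + norm w)"
    if \<tau>: "0 \<le> \<tau>" "\<tau> \<le> t" for \<tau>
  proof -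
    have a: "norm (\<tau> *\<^sub>R u) \<le> t * norm u" using \<tau> by (simp add: mult_right_mono)
    have b: "norm (\<tau> *\<^sub>R u + t *\<^sub>R w) \<le> norm (\<tau> *\<^sub>R u) + norm (t *\<^sub>R w)" by (rule norm_triangle_ineq)
    have c: "norm (t *\<^sub>R w) = t * norm w" using t by simp
    show *: "norm (\<tau> *\<^sub>R u + t *\<^sub>R w) \<le> t * (norm u + norm w)" using a b c unfolding distrib_left by linarith
    have "0 \<le> t * norm w" using t by simp
    then show **: "norm (\<tau> *\<^sub>R u) \<le> t * (norm u + norm w)" using a unfolding distrib_left by linarith
    show "dist (x + \<tau> *\<^sub>R u + t *\<^sub>R w) x < d" using * t(2) by (simp add: dist_norm add.assoc)
    show "dist (x + \<tau> *\<^sub>R u) x < d" using ** t(2) by (simp add: dist_norm)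
  qed
  have deriv: "(?g has_real_derivative ?g' \<tau>) (at \<tau>)" if \<tau>: "0 \<le> \<tau>" "\<tau> \<le> t" for \<tau>
  proof -
    have 1: "(\<phi> has_derivative (\<lambda>h. h \<bullet> D (x + \<tau> *\<^sub>R u + t *\<^sub>R w))) (at (x + \<tau> *\<^sub>R u + t *\<^sub>R w))"
      and 2: "(\<phi> has_derivative (\<lambda>h. h \<bullet> D (x + \<tau> *\<^sub>R u))) (at (x + \<tau> *\<^sub>R u))"
      using grad in1[OF \<tau>] by (simp_all add: gderiv_def)
    have "((\<lambda>\<tau>. \<phi> (x + \<tau> *\<^sub>R u + t *\<^sub>R w)) has_derivative (\<lambda>h. (h *\<^sub>R u) \<bullet> D (x + \<tau> *\<^sub>R u + t *\<^sub>R w))) (at \<tau>)"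
      by (rule has_derivative_compose[where f="\<lambda>\<tau>. x + \<tau> *\<^sub>R u + t *\<^sub>R w" and g=\<phi>, OF _ 1]) (auto intro!: derivative_eq_intros)
    moreover have "((\<lambda>\<tau>. \<phi> (x + \<tau> *\<^sub>R u)) has_derivative (\<lambda>h. (h *\<^sub>R u) \<bullet> D (x + \<tau> *\<^sub>R u))) (at \<tau>)"
      by (rule has_derivative_compose[where f="\<lambda>\<tau>. x + \<tau> *\<^sub>R u" and g=\<phi>, OF _ 2]) (auto intro!: derivative_eq_intros)
    ultimately have "(?g has_derivative (\<lambda>h. (h *\<^sub>R u) \<bullet> D (x + \<tau> *\<^sub>R u + t *\<^sub>R w) - (h *\<^sub>R u) \<bullet> D (x + \<tau> *\<^sub>R u))) (at \<tau>)"
      by (rule has_derivative_diff)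
    then show ?thesis
      by (rule has_derivative_imp_has_field_derivative) (simp add: algebra_simps)
  qed
  obtain \<xi> where \<xi>: "0 < \<xi>" "\<xi> < t" "?g t - ?g 0 = (t - 0) * ?g' \<xi>"
    using MVT2[OF t(1), of ?g ?g'] deriv by blast
  have \<xi>': "0 \<le> \<xi>" "\<xi> \<le> t" using \<xi> by auto
  let ?T = "t * (norm u + norm w)"
  have "norm (D (x + \<xi> *\<^sub>R u + t *\<^sub>R w) - D x - A (\<xi> *\<^sub>R u + t *\<^sub>R w)) \<le> e * ?T"
  proof -
    have eq: "x + \<xi> *\<^sub>R u + t *\<^sub>R w - x = \<xi> *\<^sub>R u + t *\<^sub>R w" by simp
    show ?thesis using est[OF in1(1)[OF \<xi>'], unfolded eq] mult_left_mono[OF n1(1)[OF \<xi>'] e] by linarith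
  qed
  moreover have "norm (D (x + \<xi> *\<^sub>R u) - D x - A (\<xi> *\<^sub>R u)) \<le> e * ?T"
    using est[OF in1(2)[OF \<xi>']] mult_left_mono[OF n1(2)[OF \<xi>'] e] by simp
  ultimately have "norm ((D (x + \<xi> *\<^sub>R u + t *\<^sub>R w) - D x - A (\<xi> *\<^sub>R u + t *\<^sub>R w))
      - (D (x + \<xi> *\<^sub>R u) - D x - A (\<xi> *\<^sub>R u))) \<le> e * ?T + e * ?T"
    by (rule order_trans[OF norm_triangle_ineq4 add_mono])
  moreover have "A (\<xi> *\<^sub>R u + t *\<^sub>R w) - A (\<xi> *\<^sub>R u) = t *\<^sub>R A w"
    using A by (simp add: linear_add linear_scale)
  then have "(D (x + \<xi> *\<^sub>R u + t *\<^sub>R w) - D x - A (\<xi> *\<^sub>R u + t *\<^sub>R w)) - (D (x + \<xi> *\<^sub>R u) - D x - A (\<xi> *\<^sub>R u))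
      = D (x + \<xi> *\<^sub>R u + t *\<^sub>R w) - D (x + \<xi> *\<^sub>R u) - t *\<^sub>R A w"
    by (simp add: algebra_simps)
  ultimately have N: "norm (D (x + \<xi> *\<^sub>R u + t *\<^sub>R w) - D (x + \<xi> *\<^sub>R u) - t *\<^sub>R A w) \<le> 2 * e * ?T" by simp
  have "\<phi> (x + t *\<^sub>R u + t *\<^sub>R w) - \<phi> (x + t *\<^sub>R u) - \<phi> (x + t *\<^sub>R w) + \<phi> x - t\<^sup>2 * (u \<bullet> A w)
      = t * (u \<bullet> (D (x + \<xi> *\<^sub>R u + t *\<^sub>R w) - D (x + \<xi> *\<^sub>R u) - t *\<^sub>R A w))"
    using \<xi>(3) by (simp add: inner_diff_right algebra_simps power2_eq_square)
  also have "\<bar>\<dots>\<bar> \<le> t * (norm u * (2 * e * ?T))"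
    using t N by (auto simp: abs_mult intro!: mult_left_mono order_trans[OF Cauchy_Schwarz_ineq2])
  finally show ?thesis by (simp add: power2_eq_square algebra_simps)
qed

text \<open>The second difference is symmetric in u and w, and its leading term can be computed as
  \<open>t\<^sup>2 * (u \<bullet> A w)\<close> or with u and w exchanged; comparing the two
  expansions leaves an error proportional to an arbitrary e > 0.\<close>

lemma second_derivative_symmetric:
  fixes \<phi> :: "'a::real_inner \<Rightarrow> real"
  assumes S: "open S" "x \<in> S" and grad: "\<And>y. y \<in> S \<Longrightarrow> GDERIV \<phi> y :> D y"
    and hess: "(D has_derivative A) (at x)"
  shows "u \<bullet> A w = w \<bullet> A u"
proof -
  have A: "linear A" using hess by (rule has_derivative_linear)
  define C where "C = 2 * (norm u + norm w) * (norm u + norm w)"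
  have C: "0 \<le> C" by (simp add: C_def)
  have bound: "\<bar>u \<bullet> A w - w \<bullet> A u\<bar> \<le> e * C" if e: "0 < e" for e
  proof -
    obtain d1 where d1: "d1 > 0" "\<And>y. dist y x < d1 \<Longrightarrow> y \<in> S"
      using S by (metis open_dist)
    obtain d2 where d2: "d2 > 0" "\<And>y. norm (y - x) < d2 \<Longrightarrow> norm (D y - D x - A (y - x)) \<le> e * norm (y - x)"
      using hess e unfolding has_derivative_at_alt by blast
    define d where "d = min d1 d2"
    have d: "d > 0" using d1 d2 by (simp add: d_def)
    define t where "t = d / (2 * (norm u + norm w + 1))"
    have t: "0 < t" using d by (simp add: t_def add_nonneg_pos)
    have "t * (norm u + norm w) \<le> t * (norm u + norm w + 1)" using t by (intro mult_left_mono) auto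
    also have "\<dots> = d / 2"
    proof -
      have "norm u + norm w + 1 \<noteq> 0" using norm_ge_zero[of u] norm_ge_zero[of w] by linarith
      then show ?thesis by (simp add: t_def field_simps)
    qed
    finally have td: "t * (norm u + norm w) < d" using d by simp
    have g: "GDERIV \<phi> y :> D y" if "dist y x < d" for y
      using that d1(2) grad by (simp add: d_def)
    have est: "norm (D y - D x - A (y - x)) \<le> e * norm (y - x)" if "dist y x < d" for y
      using that d2(2) by (simp add: d_def dist_norm)
    have e': "0 \<le> e" using e by simp
    have "\<bar>\<phi> (x + t *\<^sub>R u + t *\<^sub>R w) - \<phi> (x + t *\<^sub>R u) - \<phi> (x + t *\<^sub>R w) + \<phi> x - t\<^sup>2 * (u \<bullet> A w)\<bar>
        \<le> t\<^sup>2 * (2 * e * norm u * (norm u + norm w))"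
      by (rule mixed_difference_estimate[OF g A e' est t td])
    moreover have "\<bar>\<phi> (x + t *\<^sub>R u + t *\<^sub>R w) - \<phi> (x + t *\<^sub>R w) - \<phi> (x + t *\<^sub>R u) + \<phi> x - t\<^sup>2 * (w \<bullet> A u)\<bar>
        \<le> t\<^sup>2 * (2 * e * norm w * (norm w + norm u))"
      using mixed_difference_estimate[OF g A e' est t td[unfolded add.commute[of "norm u"]]]
      by (simp only: add.assoc add.commute[of "t *\<^sub>R w" "t *\<^sub>R u"])
    ultimately have "\<bar>t\<^sup>2 * (u \<bullet> A w) - t\<^sup>2 * (w \<bullet> A u)\<bar>
        \<le> t\<^sup>2 * (2 * e * norm u * (norm u + norm w)) + t\<^sup>2 * (2 * e * norm w * (norm w + norm u))" by linarith
    also have "\<dots> = t\<^sup>2 * (e * C)" by (simp add: C_def algebra_simps)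
    finally have "t\<^sup>2 * \<bar>u \<bullet> A w - w \<bullet> A u\<bar> \<le> t\<^sup>2 * (e * C)"
      by (simp add: right_diff_distrib[symmetric] abs_mult)
    then show ?thesis using t by simp
  qed
  have "\<bar>u \<bullet> A w - w \<bullet> A u\<bar> \<le> 0"
  proof (rule field_le_epsilon)
    fix e :: real assume e: "0 < e"
    have "\<bar>u \<bullet> A w - w \<bullet> A u\<bar> \<le> (e / (C + 1)) * C" using e C by (intro bound) simp
    also have "\<dots> \<le> e" using e C by (simp add: field_simps)
    finally show "\<bar>u \<bullet> A w - w \<bullet> A u\<bar> \<le> 0 + e" by simp
  qed
  then show ?thesis by simp
qed

lemma second_order_Taylor:
  fixes \<phi> :: "'a::real_inner \<Rightarrow> real"
  assumes S: "convex S" "x \<in> S" "x + v \<in> S" and grad: "\<And>y. y \<in> S \<Longrightarrow> GDERIV \<phi> y :> D y"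
    and hess: "\<And>y. y \<in> S \<Longrightarrow> (D has_derivative A y) (at y)"
  obtains \<xi> where "\<xi> \<in> S" "\<phi> (x + v) = \<phi> x + v \<bullet> D x + (v \<bullet> A \<xi> v) / 2"
proof -
  have seg: "x + t *\<^sub>R v \<in> S" if "0 \<le> t" "t \<le> 1" for t
  proof -
    have "(1 - t) *\<^sub>R x + t *\<^sub>R (x + v) \<in> S" using S that by (intro convexD) auto
    then show ?thesis by (simp add: algebra_simps)
  qed
  define diff where "diff m t = (if m = 0 then \<phi> (x + t *\<^sub>R v) else if m = 1 then v \<bullet> D (x + t *\<^sub>R v)
    else v \<bullet> A (x + t *\<^sub>R v) v)" for m :: nat and t :: real
  have "\<exists>t. 0 < t \<and> t < 1 \<and> \<phi> (x + 1 *\<^sub>R v) = (\<Sum>m<2. diff m 0 / fact m * 1 ^ m) + diff 2 t / fact 2 * 1 ^ 2"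
  proof (rule Maclaurin[where f="\<lambda>t. \<phi> (x + t *\<^sub>R v)"])
    show "diff 0 = (\<lambda>t. \<phi> (x + t *\<^sub>R v))" by (rule ext) (simp add: diff_def)
    show "\<forall>m t. m < 2 \<and> 0 \<le> t \<and> t \<le> 1 \<longrightarrow> (diff m has_real_derivative diff (Suc m) t) (at t)"
    proof (intro allI impI)
      fix m :: nat and t :: real assume mt: "m < 2 \<and> 0 \<le> t \<and> t \<le> 1"
      then have y: "x + t *\<^sub>R v \<in> S" by (intro seg) auto
      have line: "((\<lambda>t. x + t *\<^sub>R v) has_derivative (\<lambda>h. h *\<^sub>R v)) (at t)"
        by (auto intro!: derivative_eq_intros)
      show "(diff m has_real_derivative diff (Suc m) t) (at t)"
      proof (cases "m = 0")
        case True
        have "((\<lambda>t. \<phi> (x + t *\<^sub>R v)) has_derivative (\<lambda>h. (h *\<^sub>R v) \<bullet> D (x + t *\<^sub>R v))) (at t)"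
          by (rule has_derivative_compose[OF line]) (use grad[OF y] in \<open>simp add: gderiv_def\<close>)
        then have "((\<lambda>t. \<phi> (x + t *\<^sub>R v)) has_real_derivative v \<bullet> D (x + t *\<^sub>R v)) (at t)"
          by (rule has_derivative_imp_has_field_derivative) simp
        then show ?thesis using True by (simp add: diff_def[abs_def])
      next
        case False
        then have m: "m = 1" using mt by auto
        have lin: "linear (A (x + t *\<^sub>R v))" using hess[OF y] by (rule has_derivative_linear)
        have "((\<lambda>t. D (x + t *\<^sub>R v)) has_derivative (\<lambda>h. A (x + t *\<^sub>R v) (h *\<^sub>R v))) (at t)"
          by (rule has_derivative_compose[OF line hess[OF y]])
        then have "((\<lambda>t. v \<bullet> D (x + t *\<^sub>R v)) has_derivative (\<lambda>h. v \<bullet> A (x + t *\<^sub>R v) (h *\<^sub>R v))) (at t)"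
          by (rule has_derivative_inner_right)
        then have "((\<lambda>t. v \<bullet> D (x + t *\<^sub>R v)) has_real_derivative v \<bullet> A (x + t *\<^sub>R v) v) (at t)"
          by (rule has_derivative_imp_has_field_derivative) (simp add: linear_scale[OF lin])
        then show ?thesis using m by (simp add: diff_def[abs_def])
      qed
    qed
  qed auto
  then obtain t where t: "0 < t" "t < 1" "\<phi> (x + v) = \<phi> x + v \<bullet> D x + (v \<bullet> A (x + t *\<^sub>R v) v) / 2"
    by (auto simp: diff_def numeral_2_eq_2)
  show ?thesis by (rule that[OF seg t(3)]) (use t in auto)
qed

text \<open>Taylor expansion at the weighted mean: the displacements (1 - \<theta>) k and - \<theta>
  k have weighted mean 0, so the gradient terms cancel, and the quadratic terms carry the total
  weight \<open>\<theta> * (1 - \<theta>)\<^sup>2 + (1 - \<theta>) * \<theta>\<^sup>2 = \<theta> *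
  (1 - \<theta>)\<close>.\<close>

lemma Jensen_gap_ge:
  fixes \<phi> :: "'a::real_inner \<Rightarrow> real"
  assumes S: "convex S" "x1 \<in> S" "x2 \<in> S" and grad: "\<And>y. y \<in> S \<Longrightarrow> GDERIV \<phi> y :> D y"
    and hess: "\<And>y. y \<in> S \<Longrightarrow> (D has_derivative A y) (at y)"
    and \<theta>: "0 < \<theta>" "\<theta> < 1"
    and m: "\<And>\<xi>. \<xi> \<in> S \<Longrightarrow> m \<le> (x1 - x2) \<bullet> A \<xi> (x1 - x2)"
  shows "\<theta> * (1 - \<theta>) / 2 * m \<le> \<theta> * \<phi> x1 + (1 - \<theta>) * \<phi> x2 - \<phi> (\<theta> *\<^sub>R x1 + (1 - \<theta>) *\<^sub>R x2)"
proof -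
  define x where "x = \<theta> *\<^sub>R x1 + (1 - \<theta>) *\<^sub>R x2"
  define k where "k = x1 - x2"
  have x: "x \<in> S" unfolding x_def using S \<theta> by (intro convexD) auto
  have x1: "x1 = x + (1 - \<theta>) *\<^sub>R k" and x2: "x2 = x + (- \<theta>) *\<^sub>R k"
    by (simp_all add: x_def k_def algebra_simps)
  have T: "\<phi> x + c * (k \<bullet> D x) + c\<^sup>2 * m / 2 \<le> \<phi> (x + c *\<^sub>R k)" if xc: "x + c *\<^sub>R k \<in> S" for c
  proof -
    obtain \<xi> where \<xi>: "\<xi> \<in> S" "\<phi> (x + c *\<^sub>R k) = \<phi> x + (c *\<^sub>R k) \<bullet> D x + ((c *\<^sub>R k) \<bullet> A \<xi> (c *\<^sub>R k)) / 2"
      using second_order_Taylor[OF S(1) x xc grad hess] by blast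
    have "linear (A \<xi>)" using hess[OF \<xi>(1)] by (rule has_derivative_linear)
    then have "(c *\<^sub>R k) \<bullet> A \<xi> (c *\<^sub>R k) = c\<^sup>2 * (k \<bullet> A \<xi> k)"
      by (simp add: linear_scale power2_eq_square)
    moreover have "c\<^sup>2 * m \<le> c\<^sup>2 * (k \<bullet> A \<xi> k)" using m[OF \<xi>(1)] by (intro mult_left_mono) (auto simp: k_def)
    ultimately show ?thesis using \<xi>(2) by simp
  qed
  have "\<theta> * (\<phi> x + (1 - \<theta>) * (k \<bullet> D x) + (1 - \<theta>)\<^sup>2 * m / 2) \<le> \<theta> * \<phi> x1"
    using T[of "1 - \<theta>", folded x1, OF S(2)] \<theta> by (intro mult_left_mono) auto
  moreover have "(1 - \<theta>) * (\<phi> x + (- \<theta>) * (k \<bullet> D x) + (- \<theta>)\<^sup>2 * m / 2) \<le> (1 - \<theta>) * \<phi> x2"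
    using T[of "- \<theta>", folded x2, OF S(3)] \<theta> by (intro mult_left_mono) auto
  moreover have "\<theta> * (\<phi> x + (1 - \<theta>) * (k \<bullet> D x) + (1 - \<theta>)\<^sup>2 * m / 2)
      + (1 - \<theta>) * (\<phi> x + (- \<theta>) * (k \<bullet> D x) + (- \<theta>)\<^sup>2 * m / 2) = \<phi> x + \<theta> * (1 - \<theta>) / 2 * m"
    by (simp add: power2_eq_square) (simp add: field_simps)
  ultimately show ?thesis unfolding x_def[symmetric] by linarith
qed


section \<open>Quadratic forms with an inverse matrix\<close>

lemma matrix_inv_posdef_right:
  fixes H :: "real^'n^'n"
  assumes pos: "\<And>v. v \<noteq> 0 \<Longrightarrow> v \<bullet> (H *v v) > 0"
  shows "H *v (matrix_inv H *v g) = g"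
proof -
  have "inj ((*v) H)"
  proof (rule injI)
    fix x y assume "H *v x = H *v y"
    then have "H *v (x - y) = 0" by (simp add: matrix_vector_mult_diff_distrib)
    then have "(x - y) \<bullet> (H *v (x - y)) = 0" by simp
    then show "x = y" using pos[of "x - y"] by fastforce
  qed
  then have "invertible H"
    by (simp add: invertible_left_inverse matrix_left_invertible_injective)
  then have "H ** matrix_inv H = mat 1"
    unfolding invertible_def matrix_inv_def by (rule someI2_ex) simp
  then show ?thesis by (simp add: matrix_vector_mul_assoc)
qed

text \<open>Complete the square at \<open>k = r *\<^sub>R z\<close>, where \<open>H *v z = g\<close>
  and r = s / (2 a); this is the maximiser of the left side.\<close>

lemma matrix_inv_quadratic_le:
  fixes H :: "real^'n^'n"
  assumes pos: "\<And>v. v \<noteq> 0 \<Longrightarrow> v \<bullet> (H *v v) > 0" and sym: "\<And>u v. u \<bullet> (H *v v) = v \<bullet> (H *v u)"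
    and a: "0 < a"
  shows "s * (g \<bullet> k) - a * (k \<bullet> (H *v k)) \<le> s\<^sup>2 / (4 * a) * ((matrix_inv H *v g) \<bullet> g)"
proof -
  define z where "z = matrix_inv H *v g"
  have Hz: "H *v z = g" unfolding z_def by (rule matrix_inv_posdef_right[OF pos])
  define r where "r = s / (2 * a)"
  have "0 \<le> (k - r *\<^sub>R z) \<bullet> (H *v (k - r *\<^sub>R z))"
    using pos[of "k - r *\<^sub>R z"] by (cases "k - r *\<^sub>R z = 0") auto
  also have "\<dots> = k \<bullet> (H *v k) - 2 * r * (g \<bullet> k) + r\<^sup>2 * (z \<bullet> g)"
    using sym[of z k] by (simp add: matrix_vector_mult_diff_distrib matrix_vector_mult_scaleR Hz
        inner_diff_left inner_diff_right inner_commute power2_eq_square algebra_simps)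
  finally have "0 \<le> a * (k \<bullet> (H *v k) - 2 * r * (g \<bullet> k) + r\<^sup>2 * (z \<bullet> g))" using a by simp
  also have "\<dots> = a * (k \<bullet> (H *v k)) - s * (g \<bullet> k) + s\<^sup>2 / (4 * a) * (z \<bullet> g)"
    using a by (simp add: r_def power2_eq_square field_simps)
  finally show ?thesis unfolding z_def[symmetric] by linarith
qed

lemma matrix_inv_quadratic_nonneg:
  fixes H :: "real^'n^'n"
  assumes pos: "\<And>v. v \<noteq> 0 \<Longrightarrow> v \<bullet> (H *v v) > 0"
  shows "0 \<le> (matrix_inv H *v g) \<bullet> g"
proof -
  have "(matrix_inv H *v g) \<bullet> g = (matrix_inv H *v g) \<bullet> (H *v (matrix_inv H *v g))"
    by (simp add: matrix_inv_posdef_right[OF pos])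
  also have "\<dots> \<ge> 0" using pos[of "matrix_inv H *v g"] by (cases "matrix_inv H *v g = 0") auto
  finally show ?thesis .
qed

text \<open>The quadratic expression attains its maximum at \<open>matrix_inv H *v g\<close>, and by
  continuity a dense set comes arbitrarily close. For countable \<open>S\<close> this gives
  measurability of the energy without treating the matrix inverse as a function.\<close>

lemma matrix_inv_quadratic_eq_SUP:
  fixes H :: "real^'n^'n"
  assumes pos: "\<And>v. v \<noteq> 0 \<Longrightarrow> v \<bullet> (H *v v) > 0" and sym: "\<And>u v. u \<bullet> (H *v v) = v \<bullet> (H *v u)"
    and dense: "\<And>X :: (real^'n) set. open X \<Longrightarrow> X \<noteq> {} \<Longrightarrow> \<exists>d\<in>S. d \<in> X"
  shows "ennreal ((matrix_inv H *v g) \<bullet> g) = (SUP k\<in>S. ennreal (2 * (g \<bullet> k) - k \<bullet> (H *v k)))"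
proof (rule antisym)
  show "(SUP k\<in>S. ennreal (2 * (g \<bullet> k) - k \<bullet> (H *v k))) \<le> ennreal ((matrix_inv H *v g) \<bullet> g)"
    using matrix_inv_quadratic_le[OF pos sym, of 1 2 g] by (intro SUP_least ennreal_leI) simp
  define z where "z = matrix_inv H *v g"
  have Hz: "H *v z = g" unfolding z_def by (rule matrix_inv_posdef_right[OF pos])
  show "ennreal ((matrix_inv H *v g) \<bullet> g) \<le> (SUP k\<in>S. ennreal (2 * (g \<bullet> k) - k \<bullet> (H *v k)))"
  proof (rule ennreal_le_epsilon)
    fix e :: real assume e: "0 < e"
    let ?F = "\<lambda>k. 2 * (g \<bullet> k) - k \<bullet> (H *v k)"
    have Fz: "?F z = z \<bullet> g" by (simp add: Hz inner_commute)
    have "continuous_on UNIV ?F" by (intro continuous_intros)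
    then have "open {k. z \<bullet> g - e < ?F k}" by (intro open_Collect_less continuous_on_const)
    moreover have "z \<in> {k. z \<bullet> g - e < ?F k}" using e Fz by simp
    ultimately obtain k where k: "k \<in> S" "z \<bullet> g - e < ?F k" using dense by blast
    have "ennreal (z \<bullet> g) \<le> ennreal (?F k + e)" using k by (intro ennreal_leI) simp
    also have "\<dots> \<le> ennreal (?F k) + ennreal e"
      using e by (cases "0 \<le> ?F k") (auto simp: ennreal_plus ennreal_neg intro: ennreal_leI)
    also have "\<dots> \<le> (SUP k\<in>S. ennreal (?F k)) + ennreal e"
      using k(1) by (intro add_right_mono SUP_upper)
    finally show "ennreal ((matrix_inv H *v g) \<bullet> g) \<le> (SUP k\<in>S. ennreal (?F k)) + ennreal e"
      by (simp add: z_def)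
  qed
qed

lemma norm_matrix_vector_mult_le:
  fixes A :: "real^'n^'m"
  shows "norm (A *v x) \<le> norm A * norm x"
proof -
  have "norm (A *v x) = L2_set (\<lambda>i. norm ((A *v x) $ i)) UNIV" by (simp add: norm_vec_def)
  also have "\<dots> \<le> L2_set (\<lambda>i. norm (A $ i) * norm x) UNIV"
    by (intro L2_set_mono) (auto simp: matrix_vector_mul_component Cauchy_Schwarz_ineq2)
  also have "\<dots> = norm A * norm x" by (simp add: norm_vec_def[of A] L2_set_left_distrib)
  finally show ?thesis .
qed

section \<open>Integrals over the cone\<close>

lemma nn_integral_lborel_scaleR:
  fixes f :: "'a::euclidean_space \<Rightarrow> ennreal"
  assumes [measurable]: "f \<in> borel_measurable borel" and c: "c \<noteq> 0"
  shows "(\<integral>\<^sup>+x. f x \<partial>lborel) = ennreal (\<bar>c\<bar> ^ DIM('a)) * (\<integral>\<^sup>+x. f (c *\<^sub>R x) \<partial>lborel)"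
proof -
  have "(\<integral>\<^sup>+x. f x \<partial>lborel) = (\<integral>\<^sup>+x. f x \<partial>density (distr lborel borel (\<lambda>x. 0 + c *\<^sub>R x)) (\<lambda>_. \<bar>c\<bar> ^ DIM('a)))"
    by (subst lborel_affine[OF c, of 0, symmetric]) (rule refl)
  also have "\<dots> = ennreal (\<bar>c\<bar> ^ DIM('a)) * (\<integral>\<^sup>+x. f (c *\<^sub>R x) \<partial>lborel)"
    by (simp add: nn_integral_density nn_integral_distr nn_integral_cmult ennreal_power)
  finally show ?thesis .
qed

lemma nn_integral_Gamma_scaled:
  fixes a b :: real
  assumes a: "0 < a" and b: "0 < b"
  shows "(\<integral>\<^sup>+t. ennreal (indicator {0<..} t * (t powr (a - 1) * exp (- (t * b)))) \<partial>lborel) = ennreal (Gamma a * b powr (- a))"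
proof -
  have "ennreal (Gamma a) = (\<integral>\<^sup>+t. ennreal (indicator {0..} t * t powr (a - 1) / exp t) \<partial>lborel)"
    by (rule Gamma_conv_nn_integral_real[OF a])
  also have "\<dots> = ennreal \<bar>b\<bar> * (\<integral>\<^sup>+t. ennreal (indicator {0..} (0 + b * t) * (0 + b * t) powr (a - 1) / exp (0 + b * t)) \<partial>lborel)"
    using b by (intro nn_integral_real_affine) auto
  also have "(\<integral>\<^sup>+t. ennreal (indicator {0..} (0 + b * t) * (0 + b * t) powr (a - 1) / exp (0 + b * t)) \<partial>lborel)
     = (\<integral>\<^sup>+t. ennreal (b powr (a - 1)) * ennreal (indicator {0<..} t * (t powr (a - 1) * exp (- (t * b)))) \<partial>lborel)"
  proof (rule nn_integral_cong)
    fix t :: real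
    show "ennreal (indicator {0..} (0 + b * t) * (0 + b * t) powr (a - 1) / exp (0 + b * t))
      = ennreal (b powr (a - 1)) * ennreal (indicator {0<..} t * (t powr (a - 1) * exp (- (t * b))))"
    proof (cases "0 < t")
      case True
      then show ?thesis
        using b by (subst ennreal_mult[symmetric]) (auto simp: powr_mult exp_minus field_simps)
    next
      case False
      then show ?thesis using b by (cases "t = 0") (auto simp: indicator_def zero_le_mult_iff)
    qed
  qed
  also have "\<dots> = ennreal (b powr (a - 1)) * (\<integral>\<^sup>+t. ennreal (indicator {0<..} t * (t powr (a - 1) * exp (- (t * b)))) \<partial>lborel)"
    by (rule nn_integral_cmult) measurable
  finally have G: "ennreal (Gamma a) = ennreal (b powr a) * (\<integral>\<^sup>+t. ennreal (indicator {0<..} t * (t powr (a - 1) * exp (- (t * b)))) \<partial>lborel)"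
    using b by (simp add: mult.assoc[symmetric] ennreal_mult[symmetric] powr_mult_base)
  have "ennreal (Gamma a * b powr (- a)) = ennreal (b powr (- a)) * ennreal (Gamma a)"
    using a by (subst ennreal_mult) (auto intro: Gamma_real_nonneg simp: mult.commute)
  also have "\<dots> = (ennreal (b powr (- a)) * ennreal (b powr a))
      * (\<integral>\<^sup>+t. ennreal (indicator {0<..} t * (t powr (a - 1) * exp (- (t * b)))) \<partial>lborel)"
    by (simp add: G mult.assoc)
  also have "ennreal (b powr (- a)) * ennreal (b powr a) = 1"
    using b by (simp add: ennreal_mult[symmetric] powr_add[symmetric])
  finally show ?thesis by simp
qed

text \<open>For p = 4 \<theta> (1 - \<theta>) < 1 only the fraction p of the convexity gain is
  available, which raises the maximum from A to A / p. The excess is at most 2 A (1 - p) for p \<ge>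
  1 / 2, and \<open>\<alpha> * ln p \<le> - (\<alpha> * (1 - p))\<close> repays it.\<close>

lemma divide_add_mult_ln_le:
  fixes A p \<alpha> :: real
  assumes p: "1 / 2 \<le> p" "p \<le> 1" and A: "0 \<le> A" "2 * A \<le> \<alpha>"
  shows "A / p + \<alpha> * ln p \<le> A"
proof -
  have "A / p - A = A * (1 - p) / p" using p by (simp add: field_simps)
  also have "\<dots> \<le> 2 * A * (1 - p)"
  proof -
    have "A * (1 - p) * 1 \<le> A * (1 - p) * (2 * p)" using p A by (intro mult_left_mono mult_nonneg_nonneg) auto
    then have "A * (1 - p) / p \<le> A * (1 - p) * (2 * p) / p" using p by (intro divide_right_mono) auto
    moreover have "A * (1 - p) * (2 * p) / p = 2 * A * (1 - p)" using p by simp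
    ultimately show ?thesis by (simp only:)
  qed
  also have "\<dots> \<le> \<alpha> * (1 - p)" using A p by (intro mult_right_mono) auto
  also have "\<dots> \<le> - (\<alpha> * ln p)"
    using mult_left_mono[OF ln_le_minus_one[of p], of \<alpha>] p A by (simp add: algebra_simps)
  finally show ?thesis by simp
qed

lemma linear_minus_quadratic_le:
  fixes a b r :: real
  assumes "0 < a"
  shows "b * r - a * r\<^sup>2 \<le> b\<^sup>2 / (4 * a)"
proof -
  have "0 \<le> (2 * a * r - b)\<^sup>2 / (4 * a)" using assms by simp
  also have "\<dots> = a * r\<^sup>2 - b * r + b\<^sup>2 / (4 * a)" using assms by (simp add: power2_eq_square field_simps)
  finally show ?thesis by simp
qed

lemma borel_measurable_fst_snd_euclidean[measurable]:
  "(fst :: 'a::euclidean_space \<times> 'b::euclidean_space \<Rightarrow> 'a) \<in> borel_measurable borel"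
  "(snd :: 'a::euclidean_space \<times> 'b::euclidean_space \<Rightarrow> 'b) \<in> borel_measurable borel"
  by (intro borel_measurable_continuous_onI continuous_intros)+

lemma AE_lborel_snd:
  assumes "AE x in lborel. P (x :: 'b::euclidean_space)"
  shows "AE z in (lborel :: ('a::euclidean_space \<times> 'b) measure). P (snd z)"
proof -
  obtain N where N: "{x \<in> space lborel. \<not> P x} \<subseteq> N" "emeasure lborel N = 0" "N \<in> sets lborel"
    using assms by (rule AE_E)
  have "AE z in lborel \<Otimes>\<^sub>M lborel. snd (z :: 'a \<times> 'b) \<notin> N"
  proof (rule lborel_pair.AE_pair_measure)
    show "{z \<in> space (lborel \<Otimes>\<^sub>M lborel). snd (z :: 'a \<times> 'b) \<notin> N} \<in> sets (lborel \<Otimes>\<^sub>M lborel)"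
      using N(3) by measurable
    show "AE x in lborel. AE y in lborel. snd (x :: 'a, y) \<notin> N"
      using N by (auto intro!: AE_I2 AE_not_in simp: null_sets_def)
  qed
  then have "AE z in (lborel :: ('a \<times> 'b) measure). snd z \<notin> N" by (simp only: lborel_prod)
  then show ?thesis by eventually_elim (use N(1) in auto)
qed

lemma nn_integral_lborel_fst:
  fixes F :: "'a::euclidean_space \<times> 'b::euclidean_space \<Rightarrow> ennreal"
  assumes [measurable]: "F \<in> borel_measurable borel"
  shows "(\<integral>\<^sup>+z. F z \<partial>lborel) = (\<integral>\<^sup>+x. \<integral>\<^sup>+y. F (x, y) \<partial>lborel \<partial>lborel)"
  unfolding lborel_prod[symmetric]
  by (rule lborel.nn_integral_fst[symmetric]) (simp add: lborel_prod)

lemma nn_integral_lborel_snd: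
  fixes F :: "'a::euclidean_space \<times> 'b::euclidean_space \<Rightarrow> ennreal"
  assumes [measurable]: "F \<in> borel_measurable borel"
  shows "(\<integral>\<^sup>+z. F z \<partial>lborel) = (\<integral>\<^sup>+y. \<integral>\<^sup>+x. F (x, y) \<partial>lborel \<partial>lborel)"
  unfolding lborel_prod[symmetric]
  by (rule lborel_pair.nn_integral_snd[symmetric]) (simp add: lborel_prod)

text \<open>At fixed height t the substitution y = t x has Jacobian t ^ n, and only positive heights
  contribute.\<close>

lemma nn_integral_cone_coordinates:
  fixes F :: "(real^'n) \<times> real \<Rightarrow> ennreal"
  assumes F[measurable]: "F \<in> borel_measurable borel" and 0: "\<And>y t. t \<le> 0 \<Longrightarrow> F (y, t) = 0"
  shows "(\<integral>\<^sup>+P. F P \<partial>lborel) = (\<integral>\<^sup>+z. ennreal (indicator {0<..} (fst z) * fst z ^ CARD('n)) * F (fst z *\<^sub>R snd z, fst z) \<partial>lborel)"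
proof -
  have m[measurable]: "(\<lambda>z. F (fst z *\<^sub>R snd z, fst z)) \<in> borel_measurable borel"
    by (rule measurable_compose[OF _ F], rule borel_measurable_continuous_onI) (intro continuous_intros)
  have "(\<integral>\<^sup>+P. F P \<partial>lborel) = (\<integral>\<^sup>+t. \<integral>\<^sup>+y. F (y, t) \<partial>lborel \<partial>lborel)"
    by (rule nn_integral_lborel_snd[OF F])
  also have "\<dots> = (\<integral>\<^sup>+t. \<integral>\<^sup>+x. ennreal (indicator {0<..} t * t ^ CARD('n)) * F (t *\<^sub>R x, t) \<partial>lborel \<partial>lborel)"
  proof (rule nn_integral_cong)
    fix t :: real
    have Ft: "(\<lambda>y. F (y, t)) \<in> borel_measurable borel"
      by (rule measurable_compose[OF _ F], rule borel_measurable_continuous_onI) (intro continuous_intros)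
    show "(\<integral>\<^sup>+y. F (y, t) \<partial>lborel) = (\<integral>\<^sup>+x. ennreal (indicator {0<..} t * t ^ CARD('n)) * F (t *\<^sub>R x, t) \<partial>lborel)"
    proof (cases "0 < t")
      case True
      have Fx: "(\<lambda>x. F (t *\<^sub>R x, t)) \<in> borel_measurable borel"
        by (rule measurable_compose[OF _ F], rule borel_measurable_continuous_onI) (intro continuous_intros)
      show ?thesis
        using True Fx by (subst nn_integral_lborel_scaleR[OF Ft, of t]) (simp_all add: nn_integral_cmult)
    next
      case False
      then show ?thesis using 0[of t] by simp
    qed
  qed
  also have "\<dots> = (\<integral>\<^sup>+z. ennreal (indicator {0<..} (fst z) * fst z ^ CARD('n)) * F (fst z *\<^sub>R snd z, fst z) \<partial>lborel)"
    by (subst nn_integral_lborel_fst) simp_all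
  finally show ?thesis .
qed

section \<open>Reading off the second order\<close>

text \<open>A cubic error is good enough, since it vanishes after division by the square of the
  parameter; the constant 1 comes from the Maclaurin remainder because exp 1 \<le> 6.\<close>

lemma exp_ge_cubic:
  fixes y :: real
  assumes "\<bar>y\<bar> \<le> 1"
  shows "1 + y + y\<^sup>2 / 2 - \<bar>y\<bar> ^ 3 \<le> exp y"
proof -
  obtain t where t: "\<bar>t\<bar> \<le> \<bar>y\<bar>" "exp y = (\<Sum>m<3. y ^ m / fact m) + exp t / fact 3 * y ^ 3"
    using Maclaurin_exp_le[of y 3] by auto
  have "exp t \<le> exp 1" using t(1) assms by simp
  also have "\<dots> \<le> (6::real)" using exp_le by linarith
  finally have "exp t / 6 * \<bar>y\<bar> ^ 3 \<le> 1 * \<bar>y\<bar> ^ 3" by (intro mult_right_mono) auto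
  moreover have "exp t / 6 * (- (y ^ 3)) \<le> exp t / 6 * \<bar>y\<bar> ^ 3"
    using abs_ge_minus_self[of "y ^ 3"] by (intro mult_left_mono) (simp_all only: power_abs, simp)
  ultimately have "- (exp t / 6 * y ^ 3) \<le> \<bar>y\<bar> ^ 3" by simp
  moreover have "(\<Sum>m<3. y ^ m / fact m) = 1 + y + y\<^sup>2 / 2" "fact 3 = (6::real)"
    by (simp_all add: eval_nat_numeral)
  ultimately show ?thesis using t(2) by simp
qed

text \<open>\<open>Z\<^sup>2\<close> cancels on both sides, and after division by
  \<open>(s m)\<^sup>2\<close> both sides converge.\<close>

lemma variance_limit:
  fixes Z M1 M2 K Q :: real
  assumes s: "filterlim s (at_right 0) sequentially"
    and ev: "\<forall>\<^sub>F m in sequentially. (Z + s m * M1 + (s m)\<^sup>2 * M2 / 2 - s m ^ 3 * K) * (Z - s m * M1 + (s m)\<^sup>2 * M2 / 2 - s m ^ 3 * K)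
      \<le> (Z + (s m)\<^sup>2 * Q)\<^sup>2"
  shows "Z * M2 - M1\<^sup>2 \<le> 2 * Z * Q"
proof (rule tendsto_le[OF sequentially_bot])
  have s0: "s \<longlonglongrightarrow> 0" and spos: "\<forall>\<^sub>F m in sequentially. 0 < s m" using s by (auto simp: filterlim_at elim: eventually_mono)
  show "(\<lambda>m. 2 * Z * Q + (s m)\<^sup>2 * Q\<^sup>2) \<longlonglongrightarrow> 2 * Z * Q"
    by (auto intro!: tendsto_eq_intros s0)
  show "(\<lambda>m. (2 * Z + (s m)\<^sup>2 * M2 / 2 - s m ^ 3 * K) * (M2 / 2 - s m * K) - M1\<^sup>2) \<longlonglongrightarrow> Z * M2 - M1\<^sup>2"
    by (auto intro!: tendsto_eq_intros s0)
  show "\<forall>\<^sub>F m in sequentially. (2 * Z + (s m)\<^sup>2 * M2 / 2 - s m ^ 3 * K) * (M2 / 2 - s m * K) - M1\<^sup>2 \<le> 2 * Z * Q + (s m)\<^sup>2 * Q\<^sup>2"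
    using ev spos
  proof eventually_elim
    case (elim m)
    define r where "r = s m"
    \<comment> \<open>With \<open>A = Z + r\<^sup>2 * N - r ^ 3 * K\<close> the product is
      \<open>A\<^sup>2 - r\<^sup>2 * M1\<^sup>2\<close>, and
      \<open>A\<^sup>2 - Z\<^sup>2 = (A + Z) * (A - Z)\<close> contains the factor
      \<open>r\<^sup>2\<close>.\<close>
    have id: "r\<^sup>2 * ((2 * Z + r\<^sup>2 * N - r ^ 3 * K) * (N - r * K) - M1\<^sup>2)
      = (Z + r * M1 + r\<^sup>2 * N - r ^ 3 * K) * (Z - r * M1 + r\<^sup>2 * N - r ^ 3 * K) - Z\<^sup>2" for N
      by (simp add: power2_eq_square power3_eq_cube algebra_simps)
    have "r\<^sup>2 * ((2 * Z + r\<^sup>2 * M2 / 2 - r ^ 3 * K) * (M2 / 2 - r * K) - M1\<^sup>2)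
      = (Z + r * M1 + r\<^sup>2 * M2 / 2 - r ^ 3 * K) * (Z - r * M1 + r\<^sup>2 * M2 / 2 - r ^ 3 * K) - Z\<^sup>2"
      using id[of "M2 / 2"] by simp
    also have "\<dots> \<le> (Z + r\<^sup>2 * Q)\<^sup>2 - Z\<^sup>2" using elim by (simp add: r_def)
    also have "\<dots> = r\<^sup>2 * (2 * Z * Q + r\<^sup>2 * Q\<^sup>2)" by (simp add: power2_eq_square algebra_simps)
    finally show ?case using elim(2) by (simp add: r_def)
  qed
qed

subsection \<open>The inequality on relatively compact convex subsets\<close>

abbreviation weighted_integral :: "(real^'n) set \<Rightarrow> (real^'n \<Rightarrow> real) \<Rightarrow> real \<Rightarrow> (real^'n \<Rightarrow> real) \<Rightarrow> real" where
  "weighted_integral U \<phi> \<beta> h \<equiv> (\<integral>x. indicator U x * \<phi> x powr (- \<beta>) * h x \<partial>lborel)"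

text \<open>The exponent 1 - \<beta> joins the weight \<open>\<phi> x powr (- \<beta>)\<close> with
  the factor \<phi> of the energy. Values in \<open>ennreal\<close> admit infinite energy.\<close>

abbreviation energy_integral ::
  "(real^'n) set \<Rightarrow> (real^'n \<Rightarrow> real) \<Rightarrow> real \<Rightarrow> (real^'n \<Rightarrow> real^'n^'n) \<Rightarrow> (real^'n \<Rightarrow> real^'n) \<Rightarrow> ennreal" where
  "energy_integral U \<phi> \<beta> H g \<equiv> (\<integral>\<^sup>+x. ennreal (indicator U x * \<phi> x powr (1 - \<beta>))
    * ennreal (indicator U x * ((matrix_inv (H x) *v g x) \<bullet> g x)) \<partial>lborel)"

text \<open>Collects what compactness provides on the interior of a compact convex subset: bounds
  for \<phi> and uniform convexity. The function f is Lipschitz on the whole space because an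
  extension will be put in its place, so that Rademacher's theorem applies without
  localisation.\<close>

locale bounded_convex_weight =
  fixes U :: "(real^'n) set" and \<phi> :: "real^'n \<Rightarrow> real" and D\<phi> :: "real^'n \<Rightarrow> real^'n"
    and H\<phi> :: "real^'n \<Rightarrow> real^'n^'n" and c a b :: real and f :: "real^'n \<Rightarrow> real" and L :: real
  assumes openU: "open U" and convexU: "convex U" and boundedU: "bounded U"
    and a: "0 < a" and \<phi>_ge: "\<And>x. x \<in> U \<Longrightarrow> a \<le> \<phi> x" and \<phi>_le: "\<And>x. x \<in> U \<Longrightarrow> \<phi> x \<le> b"
    and grad: "\<And>x. x \<in> U \<Longrightarrow> GDERIV \<phi> x :> D\<phi> x"
    and hess: "\<And>x. x \<in> U \<Longrightarrow> (D\<phi> has_derivative (\<lambda>h. H\<phi> x *v h)) (at x)"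
    and contH: "continuous_on U H\<phi>"
    and c: "0 < c" and coercive: "\<And>x v. x \<in> U \<Longrightarrow> c * (norm v)\<^sup>2 \<le> v \<bullet> (H\<phi> x *v v)"
    and lip: "L-lipschitz_on UNIV f"
begin

lemma posdef: "x \<in> U \<Longrightarrow> v \<noteq> 0 \<Longrightarrow> v \<bullet> (H\<phi> x *v v) > 0"
  using coercive[of x v] c by (auto intro: order_less_le_trans[rotated])

lemma symmetric: "x \<in> U \<Longrightarrow> u \<bullet> (H\<phi> x *v v) = v \<bullet> (H\<phi> x *v u)"
  by (rule second_derivative_symmetric[OF openU _ grad hess]) auto

lemma L_nonneg: "0 \<le> L"
  using lip by (rule lipschitz_on_nonneg)

section \<open>Bounds for the exponent \<open>Psi\<close>\<close>

definition gap :: "real \<Rightarrow> real^'n \<Rightarrow> real^'n \<Rightarrow> real" where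
  "gap \<theta> x1 x2 = \<theta> * \<phi> x1 + (1 - \<theta>) * \<phi> x2 - \<phi> (\<theta> *\<^sub>R x1 + (1 - \<theta>) *\<^sub>R x2)"

text \<open>Twice the logarithm of the ratio between the geometric mean of the two perturbed cone densities at points of
  heights \<open>2 * \<theta> * t\<close>, \<open>2 * (1 - \<theta>) * t\<close> over \<open>x1\<close>, \<open>x2\<close> and the unperturbed density at their midpoint
  (see \<open>cone_product\<close>).\<close>

definition Psi :: "real \<Rightarrow> real \<Rightarrow> real \<Rightarrow> real \<Rightarrow> real^'n \<Rightarrow> real^'n \<Rightarrow> real" where
  "Psi \<alpha> t s \<theta> x1 x2 = \<alpha> * ln (4 * \<theta> * (1 - \<theta>)) - 2 * t * gap \<theta> x1 x2 + s * (f x1 - f x2)"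

lemma gap_ge:
  assumes "x1 \<in> U" "x2 \<in> U" "0 < \<theta>" "\<theta> < 1"
  shows "\<theta> * (1 - \<theta>) / 2 * (c * (norm (x1 - x2))\<^sup>2) \<le> gap \<theta> x1 x2"
  unfolding gap_def using assms by (intro Jensen_gap_ge[OF convexU _ _ grad hess] coercive) auto

lemma gap_nonneg:
  assumes "x1 \<in> U" "x2 \<in> U" "0 < \<theta>" "\<theta> < 1"
  shows "0 \<le> gap \<theta> x1 x2"
proof -
  have "0 \<le> \<theta> * (1 - \<theta>) / 2 * (c * (norm (x1 - x2))\<^sup>2)" using assms c by simp
  then show ?thesis using gap_ge[OF assms] by linarith
qed

lemma four_theta: "0 < \<theta> \<Longrightarrow> \<theta> < 1 \<Longrightarrow> 0 < 4 * \<theta> * (1 - \<theta>) \<and> 4 * \<theta> * (1 - \<theta>) \<le> (1::real)"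
  using zero_le_power2[of "2 * \<theta> - 1"] by (simp add: power2_eq_square algebra_simps)

lemma f_diff_le: "0 \<le> s \<Longrightarrow> s * (f x1 - f x2) \<le> s * L * norm (x1 - x2)"
  using mult_left_mono[OF order_trans[OF abs_ge_self lipschitz_onD[OF lip, of x1 x2, unfolded dist_real_def dist_norm]], of s]
  by (simp add: mult.assoc)

text \<open>At very unequal heights the logarithm alone contributes at most - \<alpha> ln 2, enough
  to absorb the difference of f; the convexity gap only helps.\<close>

lemma Psi_small_p:
  assumes x: "x1 \<in> U" "x2 \<in> U" "0 < \<theta>" "\<theta> < 1" and s: "0 \<le> s" and t: "0 < t" and \<alpha>: "0 < \<alpha>"
    and p: "4 * \<theta> * (1 - \<theta>) < 1 / 2" and small: "s * L * norm (x1 - x2) \<le> \<alpha> * ln 2"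
  shows "Psi \<alpha> t s \<theta> x1 x2 \<le> 0"
proof -
  have "ln (4 * \<theta> * (1 - \<theta>)) \<le> ln (1 / 2)" using p four_theta[OF x(3,4)] by (subst ln_le_cancel_iff) auto
  then have "\<alpha> * ln (4 * \<theta> * (1 - \<theta>)) \<le> \<alpha> * (- ln 2)" using \<alpha> by (intro mult_left_mono) (auto simp: ln_div)
  moreover have "0 \<le> 2 * t * gap \<theta> x1 x2" using gap_nonneg[OF x] t by simp
  ultimately show ?thesis using f_diff_le[OF s, of x1 x2] small unfolding Psi_def by simp
qed

text \<open>At comparable heights \<theta> (1 - \<theta>) \<ge> 1 / 8, so a fixed share of the
  convexity gap survives: 2 t times c / 16 gives the coefficient t c / 8.\<close>

lemma Psi_large_p:
  assumes x: "x1 \<in> U" "x2 \<in> U" "0 < \<theta>" "\<theta> < 1" and s: "0 \<le> s" and t: "0 < t" and \<alpha>: "0 < \<alpha>"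
    and p: "1 / 2 \<le> 4 * \<theta> * (1 - \<theta>)"
  shows "Psi \<alpha> t s \<theta> x1 x2 \<le> s * L * norm (x1 - x2) - t * c / 8 * (norm (x1 - x2))\<^sup>2"
proof -
  have "ln (4 * \<theta> * (1 - \<theta>)) \<le> 0" using four_theta[OF x(3,4)] by simp
  then have 1: "\<alpha> * ln (4 * \<theta> * (1 - \<theta>)) \<le> 0" using \<alpha> by (simp add: mult_le_0_iff)
  have "1 / 16 * (c * (norm (x1 - x2))\<^sup>2) \<le> \<theta> * (1 - \<theta>) / 2 * (c * (norm (x1 - x2))\<^sup>2)"
    using p c by (intro mult_right_mono) auto
  also have "\<dots> \<le> gap \<theta> x1 x2" by (rule gap_ge[OF x])
  finally have "2 * t * (1 / 16 * (c * (norm (x1 - x2))\<^sup>2)) \<le> 2 * t * gap \<theta> x1 x2"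
    using t by (intro mult_left_mono) auto
  moreover have "2 * t * (1 / 16 * (c * (norm (x1 - x2))\<^sup>2)) = t * c / 8 * (norm (x1 - x2))\<^sup>2" by simp
  ultimately show ?thesis using 1 f_diff_le[OF s, of x1 x2] unfolding Psi_def by linarith
qed

text \<open>Maximising the bound for comparable heights over the distance gives the first estimate.
  It blows up as t tends to 0; the second one does not depend on t and keeps the exponential bounded
  there.\<close>

lemma Psi_le_dominating:
  assumes x: "x1 \<in> U" "x2 \<in> U" "0 < \<theta>" "\<theta> < 1" and s: "0 \<le> s" and t: "0 < t" and \<alpha>: "0 < \<alpha>"
    and small: "s * L * norm (x1 - x2) \<le> \<alpha> * ln 2"
  shows "Psi \<alpha> t s \<theta> x1 x2 \<le> 2 * s\<^sup>2 * L\<^sup>2 / (t * c)" "Psi \<alpha> t s \<theta> x1 x2 \<le> \<alpha> * ln 2"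
proof -
  show "Psi \<alpha> t s \<theta> x1 x2 \<le> 2 * s\<^sup>2 * L\<^sup>2 / (t * c)"
  proof (cases "4 * \<theta> * (1 - \<theta>) < 1 / 2")
    case True
    have "0 \<le> 2 * s\<^sup>2 * L\<^sup>2 / (t * c)" using t c by simp
    then show ?thesis using Psi_small_p[OF x s t \<alpha> True small] by linarith
  next
    case False
    have "Psi \<alpha> t s \<theta> x1 x2 \<le> (s * L) * norm (x1 - x2) - (t * c / 8) * (norm (x1 - x2))\<^sup>2"
      using Psi_large_p[OF x s t \<alpha>] False by simp
    also have "\<dots> \<le> (s * L)\<^sup>2 / (4 * (t * c / 8))"
      by (rule linear_minus_quadratic_le) (use t c in simp)
    also have "\<dots> = 2 * s\<^sup>2 * L\<^sup>2 / (t * c)" by (simp add: power_mult_distrib field_simps)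
    finally show ?thesis .
  qed
  have "\<alpha> * ln (4 * \<theta> * (1 - \<theta>)) \<le> 0" using four_theta[OF x(3,4)] \<alpha> by (simp add: mult_le_0_iff)
  moreover have "0 \<le> 2 * t * gap \<theta> x1 x2" using gap_nonneg[OF x] t by simp
  ultimately show "Psi \<alpha> t s \<theta> x1 x2 \<le> \<alpha> * ln 2" using f_diff_le[OF s, of x1 x2] small unfolding Psi_def by linarith
qed

text \<open>From \<open>exp y \<le> 1 + y * exp y\<close>, with the first estimate used for the
  factor y and the second for the exponential. The outcome is of order \<open>s\<^sup>2 / t\<close>,
  and the cone density stays integrable after division by t.\<close>

lemma exp_half_Psi_le_dominating:
  assumes x: "x1 \<in> U" "x2 \<in> U" "0 < \<theta>" "\<theta> < 1" and s: "0 \<le> s" and t: "0 < t" and \<alpha>: "0 < \<alpha>"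
    and small: "s * L * norm (x1 - x2) \<le> \<alpha> * ln 2"
  shows "exp (Psi \<alpha> t s \<theta> x1 x2 / 2) \<le> 1 + s\<^sup>2 * (exp (\<alpha> * ln 2 / 2) * L\<^sup>2 / c / t)"
proof (cases "Psi \<alpha> t s \<theta> x1 x2 \<le> 0")
  case True
  have "0 \<le> s\<^sup>2 * (exp (\<alpha> * ln 2 / 2) * L\<^sup>2 / c / t)" using t c by simp
  moreover have "exp (Psi \<alpha> t s \<theta> x1 x2 / 2) \<le> 1" using True by simp
  ultimately show ?thesis by linarith
next
  case False
  let ?y = "Psi \<alpha> t s \<theta> x1 x2 / 2"
  have "1 - ?y \<le> exp (- ?y)" using exp_ge_add_one_self[of "- ?y"] by simp
  then have "(1 - ?y) * exp ?y \<le> exp (- ?y) * exp ?y" by (intro mult_right_mono) auto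
  then have "exp ?y \<le> 1 + ?y * exp ?y" by (simp add: exp_minus algebra_simps)
  also have "?y * exp ?y \<le> (s\<^sup>2 * L\<^sup>2 / (t * c)) * exp (\<alpha> * ln 2 / 2)"
  proof (rule mult_mono)
    have "2 * s\<^sup>2 * L\<^sup>2 / (t * c) = 2 * (s\<^sup>2 * L\<^sup>2 / (t * c))" by simp
    then show "?y \<le> s\<^sup>2 * L\<^sup>2 / (t * c)" using Psi_le_dominating(1)[OF x s t \<alpha> small] by linarith
    show "exp ?y \<le> exp (\<alpha> * ln 2 / 2)" using Psi_le_dominating(2)[OF x s t \<alpha> small] by simp
  qed (use t c in auto)
  finally show ?thesis by (simp add: field_simps)
qed

lemma Hessian_near:
  assumes x: "x \<in> U" and e: "0 < e"
  obtains \<delta> where "0 < \<delta>" "\<And>\<xi> k. \<xi> \<in> U \<Longrightarrow> dist \<xi> x < \<delta> \<Longrightarrow> k \<bullet> (H\<phi> x *v k) - e * (norm k)\<^sup>2 \<le> k \<bullet> (H\<phi> \<xi> *v k)"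
proof -
  obtain \<delta> where \<delta>: "0 < \<delta>" "\<And>\<xi>. \<xi> \<in> U \<Longrightarrow> dist \<xi> x < \<delta> \<Longrightarrow> dist (H\<phi> \<xi>) (H\<phi> x) < e"
    using contH x e unfolding continuous_on_iff by meson
  show ?thesis
  proof (rule that[OF \<delta>(1)])
    fix \<xi> k assume \<xi>: "\<xi> \<in> U" "dist \<xi> x < \<delta>"
    have "k \<bullet> (H\<phi> x *v k) - k \<bullet> (H\<phi> \<xi> *v k) = k \<bullet> ((H\<phi> x - H\<phi> \<xi>) *v k)"
      by (simp add: matrix_vector_mult_diff_rdistrib inner_diff_right)
    also have "\<dots> \<le> norm k * norm ((H\<phi> x - H\<phi> \<xi>) *v k)" by (rule norm_cauchy_schwarz)
    also have "\<dots> \<le> norm k * (norm (H\<phi> x - H\<phi> \<xi>) * norm k)" by (intro mult_left_mono norm_matrix_vector_mult_le) auto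
    also have "\<dots> \<le> norm k * (e * norm k)"
      using \<delta>(2)[OF \<xi>] by (intro mult_left_mono mult_right_mono) (auto simp: dist_norm norm_minus_commute)
    finally show "k \<bullet> (H\<phi> x *v k) - e * (norm k)\<^sup>2 \<le> k \<bullet> (H\<phi> \<xi> *v k)" by (simp add: power2_eq_square algebra_simps)
  qed
qed

text \<open>Near x the errors are paid out of the quadratic form. In units of t p / 4, with p = 4
  \<theta> (1 - \<theta>), replacing the Hessian costs \<open>e * (norm k)\<^sup>2\<close> and
  linearising f costs twice that, so by coercivity the fraction 3 e / c of the form is spent and
  \<kappa> = 1 - 3 e / c remains. Maximising over k then gives a bound with a factor 1 / p, which
  the logarithm removes. The radius \<delta> does not depend on s, t, \<alpha> or \<theta>.\<close>

lemma Psi_le_near: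
  assumes x: "x \<in> U" and fx: "GDERIV f x :> g" and e: "0 < e" "6 * e \<le> c"
  obtains \<delta> where "0 < \<delta>"
    "\<And>\<alpha> t s \<theta> x1 x2. \<lbrakk>x1 \<in> U; x2 \<in> U; 0 < \<theta>; \<theta> < 1; x = \<theta> *\<^sub>R x1 + (1 - \<theta>) *\<^sub>R x2; norm (x1 - x2) < \<delta>; 0 \<le> s; 0 < t;
        0 < \<alpha>; 1 / 2 \<le> 4 * \<theta> * (1 - \<theta>); 2 * (s\<^sup>2 * ((matrix_inv (H\<phi> x) *v g) \<bullet> g) / (t * (1 - 3 * e / c))) \<le> \<alpha>\<rbrakk>
      \<Longrightarrow> Psi \<alpha> t s \<theta> x1 x2 \<le> s\<^sup>2 * (((matrix_inv (H\<phi> x) *v g) \<bullet> g) / (1 - 3 * e / c) + e) / t"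
proof -
  define q where "q = (matrix_inv (H\<phi> x) *v g) \<bullet> g"
  define \<kappa> where "\<kappa> = 1 - 3 * e / c"
  have \<kappa>: "0 < \<kappa>" using e c by (simp add: \<kappa>_def field_simps)
  have q: "0 \<le> q" unfolding q_def by (rule matrix_inv_quadratic_nonneg[OF posdef[OF x]])
  obtain \<delta>1 where \<delta>1: "0 < \<delta>1" "\<And>\<xi> k. \<xi> \<in> U \<Longrightarrow> dist \<xi> x < \<delta>1 \<Longrightarrow> k \<bullet> (H\<phi> x *v k) - e * (norm k)\<^sup>2 \<le> k \<bullet> (H\<phi> \<xi> *v k)"
    using Hessian_near[OF x e(1)] by blast
  obtain \<delta>2 where \<delta>2: "0 < \<delta>2" "\<And>y. norm (y - x) < \<delta>2 \<Longrightarrow> norm (f y - f x - (y - x) \<bullet> g) \<le> e * norm (y - x)"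
    using fx e(1) unfolding gderiv_def has_derivative_at_alt by blast
  show ?thesis
  proof (rule that[of "min \<delta>1 \<delta>2"])
    show "0 < min \<delta>1 \<delta>2" using \<delta>1 \<delta>2 by simp
    fix \<alpha> t s \<theta> x1 x2
    assume 1: "x1 \<in> U" "x2 \<in> U" "0 < \<theta>" "\<theta> < 1" and xeq: "x = \<theta> *\<^sub>R x1 + (1 - \<theta>) *\<^sub>R x2"
      and near: "norm (x1 - x2) < min \<delta>1 \<delta>2" and s: "0 \<le> s" and t: "0 < t" and \<alpha>: "0 < \<alpha>" and p2: "1 / 2 \<le> 4 * \<theta> * (1 - \<theta>)"
      and small: "2 * (s\<^sup>2 * ((matrix_inv (H\<phi> x) *v g) \<bullet> g) / (t * (1 - 3 * e / c))) \<le> \<alpha>"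
    define k where "k = x1 - x2"
    define p where "p = 4 * \<theta> * (1 - \<theta>)"
    have p: "1 / 2 \<le> p" "p \<le> 1" "0 < p" using p2 four_theta[OF 1(3,4)] by (auto simp: p_def)
    have d1: "x1 - x = (1 - \<theta>) *\<^sub>R k" and d2: "x2 - x = (- \<theta>) *\<^sub>R k" by (simp_all add: xeq k_def algebra_simps)
    have n1: "norm (x1 - x) = (1 - \<theta>) * norm k" and n2: "norm (x2 - x) = \<theta> * norm k" using 1 by (simp_all add: d1 d2)
    have nle: "norm (x1 - x) \<le> norm k" "norm (x2 - x) \<le> norm k"
      using 1 mult_right_mono[of "1 - \<theta>" 1 "norm k"] mult_right_mono[of \<theta> 1 "norm k"] by (auto simp: n1 n2)
    have nk: "norm k < \<delta>1" "norm k < \<delta>2" using near by (auto simp: k_def)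
    have f1: "\<bar>f x1 - f x - (1 - \<theta>) * (k \<bullet> g)\<bar> \<le> e * ((1 - \<theta>) * norm k)"
      using \<delta>2(2)[of x1] nle nk unfolding n1 by (simp add: d1)
    have f2: "\<bar>f x2 - f x - (- \<theta>) * (k \<bullet> g)\<bar> \<le> e * (\<theta> * norm k)"
      using \<delta>2(2)[of x2] nle nk unfolding n2 by (simp add: d2)
    have "f x1 - f x2 \<le> (1 - \<theta>) * (k \<bullet> g) - (- \<theta>) * (k \<bullet> g) + (e * ((1 - \<theta>) * norm k) + e * (\<theta> * norm k))"
      using f1 f2 by linarith
    also have "\<dots> = g \<bullet> k + e * norm k" by (simp add: algebra_simps inner_commute)
    finally have "f x1 - f x2 \<le> g \<bullet> k + e * norm k" .
    from mult_left_mono[OF this s] have F: "s * (f x1 - f x2) \<le> s * (g \<bullet> k) + e * (s * norm k)"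
      by (simp add: algebra_simps)
    have AG: "s * norm k \<le> s\<^sup>2 / t + t / 4 * (norm k)\<^sup>2"
    proof -
      have "s * norm k - t / 4 * (norm k)\<^sup>2 \<le> s\<^sup>2 / (4 * (t / 4))"
        by (rule linear_minus_quadratic_le) (use t in simp)
      then show ?thesis by simp
    qed
    \<comment> \<open>Here p \<ge> 1 / 2 serves to express the error with the prefactor t p / 4 that
      the convexity gap carries.\<close>
    have "t / 4 * (norm k)\<^sup>2 \<le> t * p / 4 * (2 * (norm k)\<^sup>2)"
    proof -
      have "t / 4 * (norm k)\<^sup>2 * 1 \<le> t / 4 * (norm k)\<^sup>2 * (2 * p)" using p t by (intro mult_left_mono) auto
      then show ?thesis by (simp add: algebra_simps)
    qed
    then have "e * (s * norm k) \<le> e * (s\<^sup>2 / t + t * p / 4 * (2 * (norm k)\<^sup>2))"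
      using e AG by (intro mult_left_mono) linarith+
    also have "\<dots> = e * (s\<^sup>2 / t) + t * p / 4 * (2 * e * (norm k)\<^sup>2)" by (simp add: algebra_simps)
    finally have AG': "e * (s * norm k) \<le> e * (s\<^sup>2 / t) + t * p / 4 * (2 * e * (norm k)\<^sup>2)" .
    have G: "\<theta> * (1 - \<theta>) / 2 * (k \<bullet> (H\<phi> x *v k) - e * (norm k)\<^sup>2) \<le> gap \<theta> x1 x2"
      unfolding gap_def
    proof (rule Jensen_gap_ge[where S="U \<inter> ball x \<delta>1" and D=D\<phi> and A="\<lambda>\<xi> h. H\<phi> \<xi> *v h"])
      show "convex (U \<inter> ball x \<delta>1)" by (intro convex_Int convexU convex_ball)
      show "x1 \<in> U \<inter> ball x \<delta>1" "x2 \<in> U \<inter> ball x \<delta>1" using 1 nle nk by (auto simp: dist_norm norm_minus_commute)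
      show "k \<bullet> (H\<phi> x *v k) - e * (norm k)\<^sup>2 \<le> (x1 - x2) \<bullet> (H\<phi> \<xi> *v (x1 - x2))" if "\<xi> \<in> U \<inter> ball x \<delta>1" for \<xi>
        using \<delta>1(2)[of \<xi> k] that by (simp add: k_def dist_commute)
    qed (use grad hess 1 in auto)
    have Hc: "c * (norm k)\<^sup>2 \<le> k \<bullet> (H\<phi> x *v k)" by (rule coercive[OF x])
    have "2 * t * (\<theta> * (1 - \<theta>) / 2 * (k \<bullet> (H\<phi> x *v k) - e * (norm k)\<^sup>2)) \<le> 2 * t * gap \<theta> x1 x2"
      using G t by (intro mult_left_mono) auto
    then have G': "t * p / 4 * (k \<bullet> (H\<phi> x *v k) - e * (norm k)\<^sup>2) \<le> 2 * t * gap \<theta> x1 x2"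
      by (simp add: p_def)
    have "\<kappa> * (k \<bullet> (H\<phi> x *v k)) \<le> k \<bullet> (H\<phi> x *v k) - 3 * e * (norm k)\<^sup>2"
    proof -
      have "3 * e / c * (c * (norm k)\<^sup>2) \<le> 3 * e / c * (k \<bullet> (H\<phi> x *v k))"
        using Hc e c by (intro mult_left_mono) auto
      then show ?thesis using c by (simp add: \<kappa>_def algebra_simps)
    qed
    then have K: "t * p / 4 * (\<kappa> * (k \<bullet> (H\<phi> x *v k))) \<le> t * p / 4 * (k \<bullet> (H\<phi> x *v k) - 3 * e * (norm k)\<^sup>2)"
      using t p by (intro mult_left_mono) auto
    have S: "s * (g \<bullet> k) - (t * p * \<kappa> / 4) * (k \<bullet> (H\<phi> x *v k)) \<le> s\<^sup>2 / (4 * (t * p * \<kappa> / 4)) * q"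
      unfolding q_def using t p \<kappa> by (intro matrix_inv_quadratic_le posdef symmetric x) auto
    have S': "s\<^sup>2 / (4 * (t * p * \<kappa> / 4)) * q = (s\<^sup>2 * q / (t * \<kappa>)) / p" by (simp add: field_simps)
    have A: "(s\<^sup>2 * q / (t * \<kappa>)) / p + \<alpha> * ln p \<le> s\<^sup>2 * q / (t * \<kappa>)"
      using p q t \<kappa> small by (intro divide_add_mult_ln_le) (auto simp: q_def \<kappa>_def)
    have "Psi \<alpha> t s \<theta> x1 x2 \<le> \<alpha> * ln p - 2 * t * gap \<theta> x1 x2 + (s * (g \<bullet> k) + (e * (s\<^sup>2 / t) + t * p / 4 * (2 * e * (norm k)\<^sup>2)))"
      using F AG' unfolding Psi_def p_def by linarith
    also have "\<dots> \<le> \<alpha> * ln p + s * (g \<bullet> k) + e * (s\<^sup>2 / t) - t * p / 4 * (k \<bullet> (H\<phi> x *v k) - 3 * e * (norm k)\<^sup>2)"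
      using G' by (simp add: algebra_simps)
    also have "\<dots> \<le> \<alpha> * ln p + s * (g \<bullet> k) + e * (s\<^sup>2 / t) - (t * p * \<kappa> / 4) * (k \<bullet> (H\<phi> x *v k))"
      using K by (simp add: algebra_simps)
    also have "\<dots> \<le> s\<^sup>2 * q / (t * \<kappa>) + e * (s\<^sup>2 / t)" using S A unfolding S' by linarith
    also have "\<dots> = s\<^sup>2 * (q / \<kappa> + e) / t" using t \<kappa> by (simp add: field_simps)
    finally show "Psi \<alpha> t s \<theta> x1 x2 \<le> s\<^sup>2 * ((matrix_inv (H\<phi> x) *v g) \<bullet> g / (1 - 3 * e / c) + e) / t"
      by (simp add: q_def \<kappa>_def)
  qed
qed

text \<open>Three cases for the pair of base points: very unequal heights lose by the logarithm,
  pairs at distance \<delta> or more lose because s L becomes smaller than t c \<delta> / 8, and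
  near pairs obey the sharp bound. The range of s may depend on x and t, which suffices for a
  pointwise limit.\<close>

lemma eventually_exp_half_Psi_le:
  assumes x: "x \<in> U" and fx: "GDERIV f x :> g" and t: "0 < t" and \<alpha>: "0 < \<alpha>" and e: "0 < e"
  shows "\<forall>\<^sub>F s in at_right 0. \<forall>\<theta> x1 x2. x1 \<in> U \<longrightarrow> x2 \<in> U \<longrightarrow> 0 < \<theta> \<longrightarrow> \<theta> < 1 \<longrightarrow> x = \<theta> *\<^sub>R x1 + (1 - \<theta>) *\<^sub>R x2
    \<longrightarrow> exp (Psi \<alpha> t s \<theta> x1 x2 / 2) \<le> 1 + s\<^sup>2 * (((matrix_inv (H\<phi> x) *v g) \<bullet> g + e) / (2 * t))"
proof -
  define q where "q = (matrix_inv (H\<phi> x) *v g) \<bullet> g"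
  have q: "0 \<le> q" unfolding q_def by (rule matrix_inv_quadratic_nonneg[OF posdef[OF x]])
  \<comment> \<open>Since \<kappa> \<ge> 1 / 2, dividing q by \<kappa> adds at most 6 e1 q / c; the
    choice keeps this together with e1 at most e / 2.\<close>
  define e1 where "e1 = min (c / 6) (e / 2 / (1 + 6 * q / c))"
  define \<kappa> where "\<kappa> = 1 - 3 * e1 / c"
  have pos: "0 < 1 + 6 * q / c" using q c by (simp add: add_pos_nonneg)
  have e1: "0 < e1" "6 * e1 \<le> c" using e c pos by (auto simp: e1_def)
  have e1': "e1 * (1 + 6 * q / c) \<le> e / 2"
  proof -
    have "e1 \<le> e / 2 / (1 + 6 * q / c)" by (simp add: e1_def)
    then show ?thesis by (simp only: pos_le_divide_eq[OF pos])
  qed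
  have ec: "0 \<le> 3 * e1 / c" "3 * e1 / c \<le> 1 / 2" using e1 c by (simp_all add: pos_divide_le_eq)
  then have "1 / 2 \<le> \<kappa>" "\<kappa> \<le> 1" unfolding \<kappa>_def by linarith+
  then have \<kappa>: "1 / 2 \<le> \<kappa>" "\<kappa> \<le> 1" "\<kappa> \<noteq> 0" by auto
  have q\<kappa>: "q / \<kappa> + e1 \<le> q + e / 2"
  proof -
    have "q / \<kappa> - q = q * (1 - \<kappa>) / \<kappa>" using \<kappa>(3) by (simp add: field_simps)
    also have "\<dots> \<le> q * (1 - \<kappa>) / (1 / 2)"
      using \<kappa> q by (intro divide_left_mono mult_nonneg_nonneg) auto
    also have "\<dots> = e1 * (6 * q / c)" by (simp add: \<kappa>_def)
    finally show ?thesis using e1' unfolding distrib_left mult_1_right by linarith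
  qed
  show ?thesis
  proof (rule Psi_le_near[OF x fx e1, folded q_def \<kappa>_def])
    fix \<delta> assume \<delta>: "0 < \<delta>"
      "\<And>\<alpha> t s \<theta> x1 x2. \<lbrakk>x1 \<in> U; x2 \<in> U; 0 < \<theta>; \<theta> < 1; x = \<theta> *\<^sub>R x1 + (1 - \<theta>) *\<^sub>R x2; norm (x1 - x2) < \<delta>; 0 \<le> s; 0 < t;
          0 < \<alpha>; 1 / 2 \<le> 4 * \<theta> * (1 - \<theta>); 2 * (s\<^sup>2 * q / (t * \<kappa>)) \<le> \<alpha>\<rbrakk>
        \<Longrightarrow> Psi \<alpha> t s \<theta> x1 x2 \<le> s\<^sup>2 * (q / \<kappa> + e1) / t"
    obtain B where B: "\<And>x. x \<in> U \<Longrightarrow> norm x \<le> B" using boundedU unfolding bounded_iff by blast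
    \<comment> \<open>Half of e stays in reserve: y' - y = e / (4 t) pays for the quadratic term of
      the exponential.\<close>
    define y where "y = (q + e / 2) / (2 * t)"
    define y' where "y' = (q + e) / (2 * t)"
    have y: "0 < y" "y < y'" using q e t by (auto simp: y_def y'_def divide_strict_right_mono)
    have small: "\<forall>\<^sub>F s in at_right 0. F s < r" if "(F \<longlongrightarrow> 0) (at_right 0)" "0 < r" for F :: "real \<Rightarrow> real" and r
      using that by (rule order_tendstoD)
    have "\<forall>\<^sub>F s in at_right 0. s * L * (2 * B) < \<alpha> * ln 2"
      by (rule small) (use \<alpha> in \<open>auto intro!: tendsto_eq_intros\<close>)
    moreover have "\<forall>\<^sub>F s in at_right 0. s * L < t * c / 8 * \<delta>"
      by (rule small) (use t c \<delta>(1) in \<open>auto intro!: tendsto_eq_intros\<close>)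
    moreover have "\<forall>\<^sub>F s in at_right 0. 2 * (s\<^sup>2 * q / (t * \<kappa>)) < \<alpha>"
      by (rule small) (use t \<kappa> \<alpha> in \<open>auto intro!: tendsto_eq_intros\<close>)
    moreover have "\<forall>\<^sub>F s in at_right 0. s\<^sup>2 * y < 1"
      by (rule small) (auto intro!: tendsto_eq_intros)
    moreover have "\<forall>\<^sub>F s in at_right 0. s\<^sup>2 * y\<^sup>2 < y' - y"
      by (rule small) (use y in \<open>auto intro!: tendsto_eq_intros\<close>)
    moreover have "\<forall>\<^sub>F s in at_right 0. 0 < (s::real)" by (rule eventually_at_right_less)
    ultimately show ?thesis
    proof eventually_elim
      case (elim s)
      show ?case
      proof (intro allI impI)
        fix \<theta> x1 x2
        assume 1: "x1 \<in> U" "x2 \<in> U" "0 < \<theta>" "\<theta> < 1" and xeq: "x = \<theta> *\<^sub>R x1 + (1 - \<theta>) *\<^sub>R x2"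
        have s: "0 \<le> s" using elim by simp
        have "norm (x1 - x2) \<le> 2 * B"
          using norm_triangle_ineq4[of x1 x2] B[OF 1(1)] B[OF 1(2)] by linarith
        then have "s * L * norm (x1 - x2) \<le> s * L * (2 * B)" using s L_nonneg by (intro mult_left_mono) auto
        then have dm: "s * L * norm (x1 - x2) \<le> \<alpha> * ln 2" using elim by linarith
        have "Psi \<alpha> t s \<theta> x1 x2 / 2 \<le> s\<^sup>2 * y"
        proof (cases "4 * \<theta> * (1 - \<theta>) < 1 / 2")
          case True
          have "0 \<le> s\<^sup>2 * y" using y by simp
          then show ?thesis using Psi_small_p[OF 1 s t \<alpha> True dm] by linarith
        next
          case False
          then have p: "1 / 2 \<le> 4 * \<theta> * (1 - \<theta>)" by simp
          show ?thesis
          proof (cases "norm (x1 - x2) < \<delta>")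
            case True
            have "Psi \<alpha> t s \<theta> x1 x2 \<le> s\<^sup>2 * (q / \<kappa> + e1) / t"
              using elim by (intro \<delta>(2)[OF 1 xeq True s t \<alpha> p]) simp
            also have "\<dots> \<le> s\<^sup>2 * (q + e / 2) / t"
              using t q\<kappa> by (intro divide_right_mono mult_left_mono) auto
            also have "\<dots> = 2 * (s\<^sup>2 * y)" using t by (simp add: y_def field_simps)
            finally show ?thesis by simp
          next
            case far: False
            have "Psi \<alpha> t s \<theta> x1 x2 \<le> s * L * norm (x1 - x2) - t * c / 8 * (norm (x1 - x2))\<^sup>2"
              by (rule Psi_large_p[OF 1 s t \<alpha> p])
            also have "\<dots> = norm (x1 - x2) * (s * L - t * c / 8 * norm (x1 - x2))"
              by (simp add: power2_eq_square algebra_simps)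
            also have "\<dots> \<le> 0"
            proof -
              have "t * c / 8 * \<delta> \<le> t * c / 8 * norm (x1 - x2)" using far t c by (intro mult_left_mono) auto
              then have "s * L - t * c / 8 * norm (x1 - x2) \<le> 0" using elim by linarith
              then show ?thesis by (simp add: mult_nonneg_nonpos)
            qed
            also have "0 \<le> 2 * (s\<^sup>2 * y)" using y by simp
            finally show ?thesis by simp
          qed
        qed
        then have "exp (Psi \<alpha> t s \<theta> x1 x2 / 2) \<le> exp (s\<^sup>2 * y)" by simp
        also have "\<dots> \<le> 1 + s\<^sup>2 * y + (s\<^sup>2 * y)\<^sup>2" using y elim by (intro exp_bound) auto
        also have "(s\<^sup>2 * y)\<^sup>2 = s\<^sup>2 * (s\<^sup>2 * y\<^sup>2)" by (simp add: power2_eq_square)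
        also have "1 + s\<^sup>2 * y + s\<^sup>2 * (s\<^sup>2 * y\<^sup>2) \<le> 1 + s\<^sup>2 * y + s\<^sup>2 * (y' - y)"
          using elim by (intro add_left_mono mult_left_mono) auto
        also have "\<dots> = 1 + s\<^sup>2 * y'" by (simp add: algebra_simps)
        finally show "exp (Psi \<alpha> t s \<theta> x1 x2 / 2) \<le> 1 + s\<^sup>2 * (((matrix_inv (H\<phi> x) *v g) \<bullet> g + e) / (2 * t))"
          by (simp add: y'_def q_def)
      qed
    qed
  qed
qed

section \<open>The cone density and its midpoint envelope\<close>

definition cone_density :: "real \<Rightarrow> real \<Rightarrow> (real^'n) \<times> real \<Rightarrow> real" where
  "cone_density \<alpha> s P = (if 0 < snd P \<and> fst P /\<^sub>R snd P \<in> U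
    then snd P powr \<alpha> * exp (- snd P * \<phi> (fst P /\<^sub>R snd P) + s * f (fst P /\<^sub>R snd P)) else 0)"

text \<open>The least function admissible on the right of Prekopa-Leindler for the densities
  perturbed by s and - s. Indexing by the half difference \<open>H\<close> keeps the midpoint
  \<open>P\<close> fixed.\<close>

definition midpoint_envelope :: "real \<Rightarrow> real \<Rightarrow> (real^'n) \<times> real \<Rightarrow> ennreal" where
  "midpoint_envelope \<alpha> s P = (SUP H. ennreal (sqrt (cone_density \<alpha> s (P + H) * cone_density \<alpha> (- s) (P - H))))"

lemma cone_density_nonneg: "0 \<le> cone_density \<alpha> s P"
  by (simp add: cone_density_def)

text \<open>Points of heights t1 and t2 over x1 and x2 have a midpoint of height t over the weighted
  mean of x1 and x2, where the weight \<theta> is the share of t1 in the total height. Then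
  \<open>t1 * t2 / t\<^sup>2 = 4 * \<theta> * (1 - \<theta>)\<close> accounts for the logarithm in
  \<open>Psi\<close>, and the perspective of \<phi> for the gap.\<close>

lemma cone_product:
  assumes t: "0 < t" "0 < t1" "0 < t2" "t1 + t2 = 2 * t" and \<theta>: "\<theta> = t1 / (2 * t)"
  shows "(t1 powr \<alpha> * exp (- t1 * \<phi> x1 + s * f x1)) * (t2 powr \<alpha> * exp (- t2 * \<phi> x2 + (- s) * f x2))
    = (t powr \<alpha> * exp (- (t * \<phi> (\<theta> *\<^sub>R x1 + (1 - \<theta>) *\<^sub>R x2))) * exp (Psi \<alpha> t s \<theta> x1 x2 / 2))\<^sup>2"
proof -
  have \<theta>1: "1 - \<theta> = t2 / (2 * t)" using t by (simp add: \<theta> field_simps)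
  have "4 * \<theta> * (1 - \<theta>) = (t1 * t2) / t\<^sup>2" unfolding \<theta>1 unfolding \<theta> by (simp add: power2_eq_square)
  then have ln4: "ln (4 * \<theta> * (1 - \<theta>)) = ln t1 + ln t2 - 2 * ln t"
    using t by (simp add: ln_div ln_mult ln_realpow)
  have gap2: "2 * t * gap \<theta> x1 x2 = t1 * \<phi> x1 + t2 * \<phi> x2 - 2 * t * \<phi> (\<theta> *\<^sub>R x1 + (1 - \<theta>) *\<^sub>R x2)"
  proof -
    have "2 * t * \<theta> = t1" "2 * t * (1 - \<theta>) = t2" unfolding \<theta>1 unfolding \<theta> using t by simp_all
    then show ?thesis unfolding gap_def by (simp add: right_diff_distrib distrib_left mult.assoc[symmetric])
  qed
  have "(t1 powr \<alpha> * exp (- t1 * \<phi> x1 + s * f x1)) * (t2 powr \<alpha> * exp (- t2 * \<phi> x2 + (- s) * f x2))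
    = exp (\<alpha> * ln t1 + (- t1 * \<phi> x1 + s * f x1) + (\<alpha> * ln t2 + (- t2 * \<phi> x2 + (- s) * f x2)))"
    using t by (simp add: powr_def exp_add)
  also have "\<alpha> * ln t1 + (- t1 * \<phi> x1 + s * f x1) + (\<alpha> * ln t2 + (- t2 * \<phi> x2 + (- s) * f x2))
    = 2 * (\<alpha> * ln t - t * \<phi> (\<theta> *\<^sub>R x1 + (1 - \<theta>) *\<^sub>R x2)) + Psi \<alpha> t s \<theta> x1 x2"
    unfolding Psi_def ln4 gap2 by (simp add: algebra_simps)
  also have "\<dots> = 2 * (\<alpha> * ln t + - (t * \<phi> (\<theta> *\<^sub>R x1 + (1 - \<theta>) *\<^sub>R x2)) + Psi \<alpha> t s \<theta> x1 x2 / 2)" by simp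
  also have "exp \<dots> = (t powr \<alpha> * exp (- (t * \<phi> (\<theta> *\<^sub>R x1 + (1 - \<theta>) *\<^sub>R x2))) * exp (Psi \<alpha> t s \<theta> x1 x2 / 2))\<^sup>2"
  proof -
    have "t powr \<alpha> = exp (\<alpha> * ln t)" using t by (simp add: powr_def)
    then show ?thesis by (simp only: exp_double exp_add)
  qed
  finally show ?thesis .
qed

lemma midpoint_envelope_le:
  assumes t: "0 < t" and X: "0 \<le> X"
    and le: "\<And>\<theta> x1 x2. x1 \<in> U \<Longrightarrow> x2 \<in> U \<Longrightarrow> 0 < \<theta> \<Longrightarrow> \<theta> < 1 \<Longrightarrow> x = \<theta> *\<^sub>R x1 + (1 - \<theta>) *\<^sub>R x2
      \<Longrightarrow> exp (Psi \<alpha> t s \<theta> x1 x2 / 2) \<le> X"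
  shows "midpoint_envelope \<alpha> s (t *\<^sub>R x, t) \<le> ennreal (indicator U x * (t powr \<alpha> * exp (- (t * \<phi> x))) * X)"
  unfolding midpoint_envelope_def
proof (intro SUP_least ennreal_leI)
  fix H :: "(real^'n) \<times> real"
  obtain \<eta> \<tau> where H: "H = (\<eta>, \<tau>)" by (cases H)
  let ?P = "(t *\<^sub>R x, t)"
  show "sqrt (cone_density \<alpha> s (?P + H) * cone_density \<alpha> (- s) (?P - H)) \<le> indicator U x * (t powr \<alpha> * exp (- (t * \<phi> x))) * X"
  proof (cases "0 < t + \<tau> \<and> (t *\<^sub>R x + \<eta>) /\<^sub>R (t + \<tau>) \<in> U \<and> 0 < t - \<tau> \<and> (t *\<^sub>R x - \<eta>) /\<^sub>R (t - \<tau>) \<in> U")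
    case True
    define t1 where "t1 = t + \<tau>"
    define t2 where "t2 = t - \<tau>"
    define x1 where "x1 = (t *\<^sub>R x + \<eta>) /\<^sub>R t1"
    define x2 where "x2 = (t *\<^sub>R x - \<eta>) /\<^sub>R t2"
    define \<theta> where "\<theta> = t1 / (2 * t)"
    have pos: "0 < t1" "0 < t2" "t1 + t2 = 2 * t" and xU: "x1 \<in> U" "x2 \<in> U" using True by (auto simp: t1_def t2_def x1_def x2_def)
    have \<theta>: "0 < \<theta>" "\<theta> < 1" and \<theta>1: "1 - \<theta> = t2 / (2 * t)" using pos t by (auto simp: \<theta>_def field_simps)
    have "\<theta> *\<^sub>R x1 + (1 - \<theta>) *\<^sub>R x2 = (1 / (2 * t)) *\<^sub>R (t *\<^sub>R x + \<eta>) + (1 / (2 * t)) *\<^sub>R (t *\<^sub>R x - \<eta>)"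
    proof -
      have "t1 / (2 * t) * inverse t1 = 1 / (2 * t)" "t2 / (2 * t) * inverse t2 = 1 / (2 * t)"
        using pos t by (simp_all add: field_simps)
      then show ?thesis unfolding \<theta>1 unfolding \<theta>_def x1_def x2_def scaleR_scaleR by (simp only:)
    qed
    also have "\<dots> = (1 / (2 * t)) *\<^sub>R ((2 * t) *\<^sub>R x)" by (simp add: scaleR_add_right[symmetric] scaleR_2[symmetric])
    also have "\<dots> = x" using t by simp
    finally have xeq: "x = \<theta> *\<^sub>R x1 + (1 - \<theta>) *\<^sub>R x2" ..
    have x: "x \<in> U" unfolding xeq using xU \<theta> convexU by (intro convexD) auto
    have "cone_density \<alpha> s (?P + H) * cone_density \<alpha> (- s) (?P - H)
      = (t1 powr \<alpha> * exp (- t1 * \<phi> x1 + s * f x1)) * (t2 powr \<alpha> * exp (- t2 * \<phi> x2 + (- s) * f x2))"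
      using True by (simp add: cone_density_def H t1_def t2_def x1_def x2_def)
    also have "\<dots> = (t powr \<alpha> * exp (- (t * \<phi> x)) * exp (Psi \<alpha> t s \<theta> x1 x2 / 2))\<^sup>2"
      unfolding cone_product[OF t pos \<theta>_def] xeq[symmetric] ..
    finally have "sqrt (cone_density \<alpha> s (?P + H) * cone_density \<alpha> (- s) (?P - H)) = t powr \<alpha> * exp (- (t * \<phi> x)) * exp (Psi \<alpha> t s \<theta> x1 x2 / 2)"
      by (simp add: real_sqrt_abs abs_mult)
    also have "\<dots> \<le> t powr \<alpha> * exp (- (t * \<phi> x)) * X"
      by (intro mult_left_mono le[OF xU \<theta> xeq]) auto
    finally show ?thesis using x by simp
  next
    case False
    then have "cone_density \<alpha> s (?P + H) * cone_density \<alpha> (- s) (?P - H) = 0" by (auto simp: cone_density_def H)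
    moreover have "0 \<le> indicator U x * (t powr \<alpha> * exp (- (t * \<phi> x))) * X" using X by (simp add: indicator_def)
    ultimately show ?thesis by (simp only: real_sqrt_zero)
  qed
qed

lemma midpoint_envelope_eq_0:
  assumes "t \<le> 0"
  shows "midpoint_envelope \<alpha> s (y, t) = 0"
proof -
  have "cone_density \<alpha> s ((y, t) + H) * cone_density \<alpha> (- s) ((y, t) - H) = 0" for H
    using assms by (cases H) (auto simp: cone_density_def)
  then show ?thesis unfolding midpoint_envelope_def by (simp only: real_sqrt_zero ennreal_0 SUP_const UNIV_not_empty simp_thms)
qed

text \<open>At \<open>H = 0\<close> the two perturbations cancel. Hence the envelope dominates the
  unperturbed density, and the truncated subtraction in \<open>excess\<close> loses nothing.\<close>

lemma midpoint_envelope_ge: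
  assumes t: "0 < t" and x: "x \<in> U"
  shows "ennreal (t powr \<alpha> * exp (- (t * \<phi> x))) \<le> midpoint_envelope \<alpha> s (t *\<^sub>R x, t)"
proof -
  have "cone_density \<alpha> s (t *\<^sub>R x, t) * cone_density \<alpha> (- s) (t *\<^sub>R x, t) = (t powr \<alpha> * exp (- (t * \<phi> x)))\<^sup>2"
    using t x by (simp add: cone_density_def power2_eq_square exp_add[symmetric])
  then have "ennreal (t powr \<alpha> * exp (- (t * \<phi> x)))
      = ennreal (sqrt (cone_density \<alpha> s ((t *\<^sub>R x, t) + 0) * cone_density \<alpha> (- s) ((t *\<^sub>R x, t) - 0)))"
    by (simp add: real_sqrt_abs abs_mult)
  also have "\<dots> \<le> midpoint_envelope \<alpha> s (t *\<^sub>R x, t)"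
    unfolding midpoint_envelope_def by (rule SUP_upper) simp
  finally show ?thesis .
qed

lemma continuous_on_\<phi>: "continuous_on U \<phi>"
by (intro continuous_at_imp_continuous_on ballI GDERIV_imp_isCont[OF grad])

definition perspective_cone :: "((real^'n) \<times> real) set" where
  "perspective_cone = {P. 0 < snd P \<and> fst P /\<^sub>R snd P \<in> U}"

lemma open_perspective_cone: "open perspective_cone"
proof -
  have "open {P :: (real^'n) \<times> real. 0 < snd P}" by (intro open_Collect_less continuous_intros)
  moreover have "continuous_on {P :: (real^'n) \<times> real. 0 < snd P} (\<lambda>P. fst P /\<^sub>R snd P)"
    by (intro continuous_intros) auto
  ultimately have "open ({P :: (real^'n) \<times> real. 0 < snd P} \<inter> (\<lambda>P. fst P /\<^sub>R snd P) -` U)"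
    by (rule continuous_open_preimage[rotated, OF _ openU])
  also have "{P :: (real^'n) \<times> real. 0 < snd P} \<inter> (\<lambda>P. fst P /\<^sub>R snd P) -` U = perspective_cone"
    by (auto simp: perspective_cone_def)
  finally show ?thesis .
qed

lemma continuous_on_cone_density: "continuous_on perspective_cone (cone_density \<alpha> s)"
proof -
  have dir: "continuous_on perspective_cone (\<lambda>P. fst P /\<^sub>R snd P)"
    by (intro continuous_intros) (auto simp: perspective_cone_def)
  have "continuous_on perspective_cone (\<lambda>P. \<phi> (fst P /\<^sub>R snd P))"
    by (rule continuous_on_compose2[OF continuous_on_\<phi> dir]) (auto simp: perspective_cone_def)
  moreover have "continuous_on perspective_cone (\<lambda>P. f (fst P /\<^sub>R snd P))"
    by (rule continuous_on_compose2[OF lipschitz_on_continuous_on[OF lip] dir]) auto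
  ultimately have "continuous_on perspective_cone (\<lambda>P. snd P powr \<alpha> * exp (- snd P * \<phi> (fst P /\<^sub>R snd P) + s * f (fst P /\<^sub>R snd P)))"
    by (intro continuous_intros) (auto simp: perspective_cone_def)
  then show ?thesis
    by (rule continuous_on_eq) (auto simp: perspective_cone_def cone_density_def)
qed

lemma borel_measurable_cone_density: "cone_density \<alpha> s \<in> borel_measurable borel"
proof -
  have "(\<lambda>P. if P \<in> perspective_cone then cone_density \<alpha> s P else 0) \<in> borel_measurable borel"
    by (rule borel_measurable_continuous_on_if) (use open_perspective_cone continuous_on_cone_density in \<open>auto intro: continuous_intros\<close>)
  moreover have "(\<lambda>P. if P \<in> perspective_cone then cone_density \<alpha> s P else 0) = cone_density \<alpha> s"
    by (auto simp: perspective_cone_def cone_density_def)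
  ultimately show ?thesis by simp
qed

text \<open>The cone density is continuous on an open cone and vanishes outside, so the envelope is lower semicontinuous.\<close>

lemma borel_measurable_midpoint_envelope: "midpoint_envelope \<alpha> s \<in> borel_measurable borel"
proof (rule borel_measurableI_greater)
  fix y :: ennreal
  show "{P \<in> space borel. y < midpoint_envelope \<alpha> s P} \<in> sets borel"
  proof (cases y)
    case (real r)
    have "open {P. r < sqrt (cone_density \<alpha> s (P + H) * cone_density \<alpha> (- s) (P - H))}" for H
    proof -
      let ?C = "(\<lambda>P. P + H) -` perspective_cone \<inter> (\<lambda>P. P - H) -` perspective_cone"
      let ?g = "\<lambda>P. sqrt (cone_density \<alpha> s (P + H) * cone_density \<alpha> (- s) (P - H))"
      have oC: "open ?C"
        by (intro open_Int continuous_open_vimage open_perspective_cone continuous_intros)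
      have "continuous_on ?C ?g"
        by (intro continuous_intros continuous_on_compose2[OF continuous_on_cone_density]) auto
      then have "open (?C \<inter> ?g -` {r<..})"
        by (rule continuous_open_preimage[OF _ oC open_greaterThan])
      also have "?C \<inter> ?g -` {r<..} = {P. r < ?g P}"
        using real(1) by (auto simp: cone_density_def perspective_cone_def split: if_splits)
      finally show ?thesis .
    qed
    then have "open (\<Union>H. {P. r < sqrt (cone_density \<alpha> s (P + H) * cone_density \<alpha> (- s) (P - H))})" by blast
    also have "(\<Union>H. {P. r < sqrt (cone_density \<alpha> s (P + H) * cone_density \<alpha> (- s) (P - H))}) = {P. y < midpoint_envelope \<alpha> s P}"
      using real by (auto simp: midpoint_envelope_def less_SUP_iff ennreal_less_iff)
    finally show ?thesis by simp
  next
    case top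
    then show ?thesis by simp
  qed
qed

lemma Prekopa_Leindler_cone:
  "(\<integral>\<^sup>+P. ennreal (cone_density \<alpha> s P) \<partial>lborel) * (\<integral>\<^sup>+P. ennreal (cone_density \<alpha> (- s) P) \<partial>lborel) \<le> (\<integral>\<^sup>+P. midpoint_envelope \<alpha> s P \<partial>lborel)\<^sup>2"
proof (rule Prekopa_Leindler)
  fix P Q :: "(real^'n) \<times> real"
  let ?M = "(1 / 2) *\<^sub>R (P + Q)" and ?H = "(1 / 2) *\<^sub>R (P - Q)"
  have PQ: "?M + ?H = P" "?M - ?H = Q"
    by (simp_all add: scaleR_add_right[symmetric] scaleR_diff_right[symmetric] scaleR_2[symmetric])
  have "ennreal (cone_density \<alpha> s P) * ennreal (cone_density \<alpha> (- s) Q) = (ennreal (sqrt (cone_density \<alpha> s (?M + ?H) * cone_density \<alpha> (- s) (?M - ?H))))\<^sup>2"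
    unfolding PQ by (simp add: ennreal_mult[symmetric] ennreal_power cone_density_nonneg)
  also have "\<dots> \<le> (midpoint_envelope \<alpha> s ?M)\<^sup>2"
    unfolding midpoint_envelope_def by (intro power_mono SUP_upper) auto
  finally show "ennreal (cone_density \<alpha> s P) * ennreal (cone_density \<alpha> (- s) Q) \<le> (midpoint_envelope \<alpha> s ?M)\<^sup>2" .
qed (use borel_measurable_cone_density borel_measurable_midpoint_envelope in auto)

section \<open>Coordinates t and x with y = t x\<close>

text \<open>The unperturbed density in the coordinates (t, x), with the Jacobian t ^ n included when
  \<gamma> = \<beta>; lowering \<gamma> by 1 divides it by t. The inner indicator in front of \<phi>
  serves measurability, since \<phi> is known to be continuous only on \<open>U\<close>.\<close>

definition base :: "real \<Rightarrow> real \<times> (real^'n) \<Rightarrow> real" where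
  "base \<gamma> z = indicator {0<..} (fst z) * (fst z powr (\<gamma> - 1) * (indicator U (snd z) * exp (- (fst z * (indicator U (snd z) * \<phi> (snd z))))))"

lemma base_nonneg: "0 \<le> base \<gamma> z"
  by (simp add: base_def)

lemma borel_measurable_indicator_\<phi>[measurable]: "(\<lambda>x. indicator U x * \<phi> x) \<in> borel_measurable borel"
  using borel_measurable_continuous_on_indicator[OF _ continuous_on_\<phi>] openU by simp

lemma U_sets[measurable]: "U \<in> sets borel" using openU by simp

lemma borel_measurable_f[measurable]: "f \<in> borel_measurable borel"
  by (intro borel_measurable_continuous_onI lipschitz_on_continuous_on[OF lip])

lemma borel_measurable_base[measurable]: "base \<gamma> \<in> borel_measurable borel"
proof -
  have [measurable]: "(\<lambda>z :: real \<times> (real^'n). indicator U (snd z) * \<phi> (snd z)) \<in> borel_measurable borel"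
    by (rule measurable_compose[OF _ borel_measurable_indicator_\<phi>]) (intro borel_measurable_continuous_onI continuous_intros)
  have [measurable]: "(\<lambda>z :: real \<times> (real^'n). indicator U (snd z) :: real) \<in> borel_measurable borel"
    by (rule measurable_compose[where N=borel and g="indicator U"]) auto
  show ?thesis unfolding base_def[abs_def] by measurable
qed

lemma base_minus_1: "0 < fst z \<Longrightarrow> base (\<beta> - 1) z = base \<beta> z / fst z"
  by (simp add: base_def powr_diff power2_eq_square)

lemma \<phi>_pos: "x \<in> U \<Longrightarrow> 0 < \<phi> x"
  using \<phi>_ge[of x] a by simp

lemma borel_measurable_\<phi>_powr[measurable]: "(\<lambda>x. indicator U x * \<phi> x powr \<gamma>) \<in> borel_measurable borel"
proof -
  have "(\<lambda>x. indicator U x * \<phi> x powr \<gamma>) = (\<lambda>x. indicator U x * (indicator U x * \<phi> x) powr \<gamma>)"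
    by (auto simp: indicator_def)
  then show ?thesis by simp
qed

lemma nn_integral_base:
  assumes \<gamma>: "0 < \<gamma>" and h[measurable]: "h \<in> borel_measurable borel"
  shows "(\<integral>\<^sup>+z. ennreal (base \<gamma> z) * h (snd z) \<partial>lborel)
    = ennreal (Gamma \<gamma>) * (\<integral>\<^sup>+x. ennreal (indicator U x * \<phi> x powr (- \<gamma>)) * h x \<partial>lborel)"
proof -
  have [measurable]: "(\<lambda>z :: real \<times> (real^'n). h (snd z)) \<in> borel_measurable borel"
    by (rule measurable_compose[OF _ h]) (intro borel_measurable_continuous_onI continuous_intros)
  have "(\<integral>\<^sup>+z. ennreal (base \<gamma> z) * h (snd z) \<partial>lborel) = (\<integral>\<^sup>+x. \<integral>\<^sup>+t. ennreal (base \<gamma> (t, x)) * h x \<partial>lborel \<partial>lborel)"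
    by (subst nn_integral_lborel_snd) simp_all
  also have "\<dots> = (\<integral>\<^sup>+x. ennreal (Gamma \<gamma>) * (ennreal (indicator U x * \<phi> x powr (- \<gamma>)) * h x) \<partial>lborel)"
  proof (rule nn_integral_cong)
    fix x
    have m: "(\<lambda>t. ennreal (base \<gamma> (t, x))) \<in> borel_measurable borel" unfolding base_def by simp
    show "(\<integral>\<^sup>+t. ennreal (base \<gamma> (t, x)) * h x \<partial>lborel) = ennreal (Gamma \<gamma>) * (ennreal (indicator U x * \<phi> x powr (- \<gamma>)) * h x)"
    proof (cases "x \<in> U")
      case True
      have "(\<integral>\<^sup>+t. ennreal (base \<gamma> (t, x)) * h x \<partial>lborel) = (\<integral>\<^sup>+t. ennreal (base \<gamma> (t, x)) \<partial>lborel) * h x"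
        using m by (intro nn_integral_multc) simp
      also have "(\<integral>\<^sup>+t. ennreal (base \<gamma> (t, x)) \<partial>lborel) = ennreal (Gamma \<gamma> * \<phi> x powr (- \<gamma>))"
        using True nn_integral_Gamma_scaled[OF \<gamma> \<phi>_pos[OF True]] by (simp add: base_def)
      finally show ?thesis using True \<gamma> by (simp add: ennreal_mult Gamma_real_nonneg mult.assoc)
    next
      case False
      then show ?thesis by (simp add: base_def)
    qed
  qed
  also have "\<dots> = ennreal (Gamma \<gamma>) * (\<integral>\<^sup>+x. ennreal (indicator U x * \<phi> x powr (- \<gamma>)) * h x \<partial>lborel)"
    by (rule nn_integral_cmult) measurable
  finally show ?thesis .
qed

definition envelope :: "real \<Rightarrow> real \<Rightarrow> real \<times> (real^'n) \<Rightarrow> ennreal" where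
  "envelope \<alpha> s z = ennreal (indicator {0<..} (fst z) * fst z ^ CARD('n)) * midpoint_envelope \<alpha> s (fst z *\<^sub>R snd z, fst z)"

lemma borel_measurable_envelope[measurable]: "envelope \<alpha> s \<in> borel_measurable borel"
proof -
  have [measurable]: "(\<lambda>z. midpoint_envelope \<alpha> s (fst z *\<^sub>R snd z, fst z)) \<in> borel_measurable borel"
    by (rule measurable_compose[OF _ borel_measurable_midpoint_envelope], rule borel_measurable_continuous_onI) (intro continuous_intros)
  show ?thesis unfolding envelope_def[abs_def] by measurable
qed

lemma nn_integral_envelope: "(\<integral>\<^sup>+z. envelope \<alpha> s z \<partial>lborel) = (\<integral>\<^sup>+P. midpoint_envelope \<alpha> s P \<partial>lborel)"
  unfolding envelope_def by (rule nn_integral_cone_coordinates[symmetric]) (auto simp: borel_measurable_midpoint_envelope midpoint_envelope_eq_0)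

lemma base_eq:
  assumes "0 < t" "\<beta> = \<alpha> + real CARD('n) + 1"
  shows "base \<beta> (t, x) = t ^ CARD('n) * (indicator U x * (t powr \<alpha> * exp (- (t * \<phi> x))))"
proof -
  have "t powr (\<beta> - 1) = t powr \<alpha> * t ^ CARD('n)"
    using assms by (simp add: powr_add powr_realpow)
  then show ?thesis using assms(1) by (simp add: base_def indicator_def)
qed

lemma nn_integral_cone_density:
  assumes \<beta>: "\<beta> = \<alpha> + real CARD('n) + 1"
  shows "(\<integral>\<^sup>+P. ennreal (cone_density \<alpha> s P) \<partial>lborel) = (\<integral>\<^sup>+z. ennreal (base \<beta> z) * ennreal (exp (s * f (snd z))) \<partial>lborel)"
proof -
  have "(\<integral>\<^sup>+P. ennreal (cone_density \<alpha> s P) \<partial>lborel)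
    = (\<integral>\<^sup>+z. ennreal (indicator {0<..} (fst z) * fst z ^ CARD('n)) * ennreal (cone_density \<alpha> s (fst z *\<^sub>R snd z, fst z)) \<partial>lborel)"
  proof (rule nn_integral_cone_coordinates)
    show "(\<lambda>P. ennreal (cone_density \<alpha> s P)) \<in> borel_measurable borel" using borel_measurable_cone_density by simp
  qed (simp add: cone_density_def)
  also have "\<dots> = (\<integral>\<^sup>+z. ennreal (base \<beta> z) * ennreal (exp (s * f (snd z))) \<partial>lborel)"
  proof (rule nn_integral_cong)
    fix z :: "real \<times> (real^'n)"
    obtain t x where z: "z = (t, x)" by (cases z)
    show "ennreal (indicator {0<..} (fst z) * fst z ^ CARD('n)) * ennreal (cone_density \<alpha> s (fst z *\<^sub>R snd z, fst z))
      = ennreal (base \<beta> z) * ennreal (exp (s * f (snd z)))"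
    proof (cases "0 < t")
      case True
      have "t ^ CARD('n) * cone_density \<alpha> s (t *\<^sub>R x, t) = base \<beta> (t, x) * exp (s * f x)"
        unfolding base_eq[OF True \<beta>] using True by (simp add: cone_density_def exp_diff exp_minus divide_inverse indicator_def)
      then show ?thesis using True by (simp add: z ennreal_mult[symmetric] cone_density_nonneg base_nonneg)
    next
      case False
      then show ?thesis by (simp add: z base_def)
    qed
  qed
  finally show ?thesis .
qed

lemma envelope_ge_base:
  assumes \<beta>: "\<beta> = \<alpha> + real CARD('n) + 1"
  shows "ennreal (base \<beta> z) \<le> envelope \<alpha> s z"
proof -
  obtain t x where z: "z = (t, x)" by (cases z)
  show ?thesis
  proof (cases "0 < t \<and> x \<in> U")
    case True
    then have "ennreal (base \<beta> z) = ennreal (t ^ CARD('n)) * ennreal (t powr \<alpha> * exp (- (t * \<phi> x)))"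
      using base_eq[of t \<beta> \<alpha> x] \<beta> by (simp add: z ennreal_mult[symmetric])
    also have "\<dots> \<le> ennreal (t ^ CARD('n)) * midpoint_envelope \<alpha> s (t *\<^sub>R x, t)"
      using True by (intro mult_left_mono midpoint_envelope_ge) auto
    also have "\<dots> = envelope \<alpha> s z" using True by (simp add: envelope_def z)
    finally show ?thesis .
  next
    case False
    then have "base \<beta> z = 0" by (auto simp: base_def z)
    then show ?thesis by simp
  qed
qed

lemma envelope_le_base:
  assumes \<beta>: "\<beta> = \<alpha> + real CARD('n) + 1" and X: "0 \<le> X"
    and le: "\<And>\<theta> x1 x2. 0 < fst z \<Longrightarrow> x1 \<in> U \<Longrightarrow> x2 \<in> U \<Longrightarrow> 0 < \<theta> \<Longrightarrow> \<theta> < 1 \<Longrightarrow> snd z = \<theta> *\<^sub>R x1 + (1 - \<theta>) *\<^sub>R x2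
      \<Longrightarrow> exp (Psi \<alpha> (fst z) s \<theta> x1 x2 / 2) \<le> X"
  shows "envelope \<alpha> s z \<le> ennreal (base \<beta> z * X)"
proof -
  obtain t x where z: "z = (t, x)" by (cases z)
  show ?thesis
  proof (cases "0 < t")
    case True
    have "envelope \<alpha> s z = ennreal (t ^ CARD('n)) * midpoint_envelope \<alpha> s (t *\<^sub>R x, t)" using True by (simp add: envelope_def z)
    also have "\<dots> \<le> ennreal (t ^ CARD('n)) * ennreal (indicator U x * (t powr \<alpha> * exp (- (t * \<phi> x))) * X)"
      using True le X by (intro mult_left_mono midpoint_envelope_le) (auto simp: z)
    also have "\<dots> = ennreal (base \<beta> z * X)"
      using base_eq[OF True \<beta>, of x] True X by (simp add: z ennreal_mult[symmetric] mult.assoc)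
    finally show ?thesis .
  next
    case False
    then show ?thesis by (simp add: envelope_def z)
  qed
qed

section \<open>The second-order quotient and its limit\<close>

definition excess :: "real \<Rightarrow> real \<Rightarrow> real \<Rightarrow> real \<times> (real^'n) \<Rightarrow> ennreal" where
  "excess \<alpha> \<beta> s z = (envelope \<alpha> s z - ennreal (base \<beta> z)) / ennreal (s\<^sup>2)"

lemma borel_measurable_excess[measurable]: "excess \<alpha> \<beta> s \<in> borel_measurable borel"
  unfolding excess_def[abs_def] by measurable

lemma nn_integral_envelope_eq:
  assumes \<beta>: "\<beta> = \<alpha> + real CARD('n) + 1" and s: "s \<noteq> 0"
  shows "(\<integral>\<^sup>+z. envelope \<alpha> s z \<partial>lborel) = (\<integral>\<^sup>+z. ennreal (base \<beta> z) \<partial>lborel) + ennreal (s\<^sup>2) * (\<integral>\<^sup>+z. excess \<alpha> \<beta> s z \<partial>lborel)"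
proof -
  have "envelope \<alpha> s z = ennreal (base \<beta> z) + ennreal (s\<^sup>2) * excess \<alpha> \<beta> s z" for z
  proof -
    have "ennreal (s\<^sup>2) * excess \<alpha> \<beta> s z = envelope \<alpha> s z - ennreal (base \<beta> z)"
      unfolding excess_def by (subst ennreal_times_divide, subst mult.commute, subst mult_divide_eq_ennreal) (use s in auto)
    then show ?thesis using envelope_ge_base[OF \<beta>, of z s] by (simp add: add_diff_inverse_ennreal)
  qed
  then show ?thesis by (simp add: nn_integral_add nn_integral_cmult)
qed

lemma excess_le:
  assumes \<beta>: "\<beta> = \<alpha> + real CARD('n) + 1" and s: "s \<noteq> 0" and Y: "0 \<le> Y"
    and le: "\<And>\<theta> x1 x2. 0 < fst z \<Longrightarrow> x1 \<in> U \<Longrightarrow> x2 \<in> U \<Longrightarrow> 0 < \<theta> \<Longrightarrow> \<theta> < 1 \<Longrightarrow> snd z = \<theta> *\<^sub>R x1 + (1 - \<theta>) *\<^sub>R x2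
      \<Longrightarrow> exp (Psi \<alpha> (fst z) s \<theta> x1 x2 / 2) \<le> 1 + s\<^sup>2 * Y"
  shows "excess \<alpha> \<beta> s z \<le> ennreal (base \<beta> z * Y)"
proof -
  have "envelope \<alpha> s z \<le> ennreal (base \<beta> z * (1 + s\<^sup>2 * Y))"
    using Y le by (intro envelope_le_base[OF \<beta>]) auto
  also have "\<dots> = ennreal (base \<beta> z) + ennreal (s\<^sup>2) * ennreal (base \<beta> z * Y)"
    using Y base_nonneg[of \<beta> z] by (simp add: ennreal_mult[symmetric] ennreal_plus[symmetric] algebra_simps del: ennreal_plus)
  finally have "envelope \<alpha> s z - ennreal (base \<beta> z) \<le> ennreal (s\<^sup>2) * ennreal (base \<beta> z * Y)"
    by (simp add: ennreal_minus_le_iff)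
  then have "excess \<alpha> \<beta> s z \<le> ennreal (s\<^sup>2) * ennreal (base \<beta> z * Y) / ennreal (s\<^sup>2)"
    unfolding excess_def by (rule divide_right_mono_ennreal)
  also have "\<dots> = ennreal (base \<beta> z * Y)"
    using s by (subst mult.commute, subst mult_divide_eq_ennreal) auto
  finally show ?thesis .
qed

lemma borel_measurable_energy[measurable]:
  assumes g[measurable]: "g \<in> borel_measurable borel"
  shows "(\<lambda>x. ennreal (indicator U x * ((matrix_inv (H\<phi> x) *v g x) \<bullet> g x))) \<in> borel_measurable borel"
proof -
  obtain S :: "(real^'n) set" where S: "countable S" "\<And>X. open X \<Longrightarrow> X \<noteq> {} \<Longrightarrow> \<exists>d\<in>S. d \<in> X"
    using countable_dense_setE by metis
  have "S \<noteq> {}" using S(2)[of UNIV] by auto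
  have [measurable]: "(\<lambda>x. indicator U x *\<^sub>R H\<phi> x) \<in> borel_measurable borel"
    using borel_measurable_continuous_on_indicator[OF _ contH] openU by simp
  have quad[measurable]: "(\<lambda>x. k \<bullet> ((indicator U x *\<^sub>R H\<phi> x) *v k)) \<in> borel_measurable borel" for k
  proof (rule measurable_compose[where N=borel and g="\<lambda>M. k \<bullet> (M *v k)"])
    have "linear (\<lambda>M::real^'n^'n. k \<bullet> (M *v k))"
      by (rule linearI) (simp_all add: matrix_vector_mult_add_rdistrib inner_add_right scaleR_matrix_vector_assoc[symmetric])
    then show "(\<lambda>M::real^'n^'n. k \<bullet> (M *v k)) \<in> borel_measurable borel"
      by (intro borel_measurable_continuous_onI linear_continuous_on linear_conv_bounded_linear[THEN iffD1])
  qed measurable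
  have "(\<lambda>x. SUP k\<in>S. ennreal (indicator U x * (2 * (g x \<bullet> k) - k \<bullet> ((indicator U x *\<^sub>R H\<phi> x) *v k)))) \<in> borel_measurable borel"
    by (intro borel_measurable_SUP S(1)) measurable
  moreover have "ennreal (indicator U x * ((matrix_inv (H\<phi> x) *v g x) \<bullet> g x))
    = (SUP k\<in>S. ennreal (indicator U x * (2 * (g x \<bullet> k) - k \<bullet> ((indicator U x *\<^sub>R H\<phi> x) *v k))))" for x
  proof (cases "x \<in> U")
    case True
    then show ?thesis using matrix_inv_quadratic_eq_SUP[OF posdef[OF True] symmetric[OF True] S(2), of "g x"] by simp
  next
    case False
    then show ?thesis using \<open>S \<noteq> {}\<close> by simp
  qed
  ultimately show ?thesis by simp
qed

text \<open>At a point of differentiability the envelope is bounded with q + e for every e > 0, and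
  the 1 / t in this bound turns \<open>base \<beta>\<close> into
  \<open>base (\<beta> - 1)\<close>.\<close>

lemma limsup_excess_le:
  assumes \<alpha>: "0 < \<alpha>" and \<beta>: "\<beta> = \<alpha> + real CARD('n) + 1" and g: "GDERIV f x :> g"
    and s: "filterlim s (at_right 0) sequentially"
  shows "limsup (\<lambda>m. excess \<alpha> \<beta> (s m) (t, x)) \<le> ennreal (base (\<beta> - 1) (t, x)) * ennreal (indicator U x * ((matrix_inv (H\<phi> x) *v g) \<bullet> g) / 2)"
proof (cases "0 < t \<and> x \<in> U")
  case True
  define q where "q = (matrix_inv (H\<phi> x) *v g) \<bullet> g"
  have q: "0 \<le> q" unfolding q_def by (rule matrix_inv_quadratic_nonneg[OF posdef]) (use True in auto)
  have bnd: "limsup (\<lambda>m. excess \<alpha> \<beta> (s m) (t, x)) \<le> ennreal (base \<beta> (t, x) * ((q + e) / (2 * t)))" if e: "0 < e" for e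
  proof (rule Limsup_bounded)
    have "\<forall>\<^sub>F s in at_right 0. (\<forall>\<theta> x1 x2. x1 \<in> U \<longrightarrow> x2 \<in> U \<longrightarrow> 0 < \<theta> \<longrightarrow> \<theta> < 1 \<longrightarrow> x = \<theta> *\<^sub>R x1 + (1 - \<theta>) *\<^sub>R x2
      \<longrightarrow> exp (Psi \<alpha> t s \<theta> x1 x2 / 2) \<le> 1 + s\<^sup>2 * ((q + e) / (2 * t))) \<and> 0 < s"
      unfolding q_def using True by (intro eventually_conj eventually_exp_half_Psi_le g \<alpha> e eventually_at_right_less) auto
    then have "\<forall>\<^sub>F s in at_right 0. excess \<alpha> \<beta> s (t, x) \<le> ennreal (base \<beta> (t, x) * ((q + e) / (2 * t)))"
    proof eventually_elim
      case (elim s)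
      then show ?case using q e True by (intro excess_le[OF \<beta>]) auto
    qed
    then show "\<forall>\<^sub>F m in sequentially. excess \<alpha> \<beta> (s m) (t, x) \<le> ennreal (base \<beta> (t, x) * ((q + e) / (2 * t)))"
      using s by (rule eventually_compose_filterlim)
  qed
  have "limsup (\<lambda>m. excess \<alpha> \<beta> (s m) (t, x)) \<le> ennreal (base (\<beta> - 1) (t, x) * (q / 2))"
  proof (rule ennreal_le_epsilon)
    fix e' :: real assume e': "0 < e'"
    define b where "b = base \<beta> (t, x) / (2 * t)"
    have b: "0 \<le> b" using True by (simp add: b_def base_nonneg)
    define e where "e = e' / (b + 1)"
    have e: "0 < e" using e' b by (simp add: e_def)
    have "b * e \<le> e'" using e' b by (simp add: e_def field_simps)
    moreover have "base \<beta> (t, x) * ((q + e) / (2 * t)) = base (\<beta> - 1) (t, x) * (q / 2) + b * e"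
      using True by (simp add: base_minus_1 b_def field_simps)
    ultimately have "base \<beta> (t, x) * ((q + e) / (2 * t)) \<le> base (\<beta> - 1) (t, x) * (q / 2) + e'"
      by simp
    then have "ennreal (base \<beta> (t, x) * ((q + e) / (2 * t))) \<le> ennreal (base (\<beta> - 1) (t, x) * (q / 2) + e')"
      by (rule ennreal_leI)
    also have "\<dots> = ennreal (base (\<beta> - 1) (t, x) * (q / 2)) + ennreal e'"
      using e' q base_nonneg[of "\<beta> - 1" "(t, x)"] by (intro ennreal_plus) auto
    finally have "ennreal (base \<beta> (t, x) * ((q + e) / (2 * t))) \<le> ennreal (base (\<beta> - 1) (t, x) * (q / 2)) + ennreal e'" .
    with bnd[OF e] show "limsup (\<lambda>m. excess \<alpha> \<beta> (s m) (t, x)) \<le> ennreal (base (\<beta> - 1) (t, x) * (q / 2)) + ennreal e'"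
      by (rule order_trans)
  qed
  also have "ennreal (base (\<beta> - 1) (t, x) * (q / 2)) = ennreal (base (\<beta> - 1) (t, x)) * ennreal (q / 2)"
    using q base_nonneg[of "\<beta> - 1" "(t, x)"] by (intro ennreal_mult) auto
  finally show ?thesis using True by (simp add: q_def)
next
  \<comment> \<open>Outside the cone nothing contributes: convexity of \<open>U\<close> forbids a
    weighted mean x outside \<open>U\<close>, so the hypothesis of \<open>excess_le\<close> is
    vacuous and holds even with bound 0.\<close>
  case False
  then have b: "base \<beta> (t, x) = 0" by (auto simp: base_def)
  have "\<forall>\<^sub>F s in at_right 0. excess \<alpha> \<beta> s (t, x) \<le> 0"
    using eventually_at_right_less[of 0]
  proof eventually_elim
    case (elim s)
    have "excess \<alpha> \<beta> s (t, x) \<le> ennreal (base \<beta> (t, x) * 0)"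
    proof (rule excess_le[OF \<beta>])
      fix \<theta> x1 x2
      assume *: "0 < fst (t, x)" "x1 \<in> U" "x2 \<in> U" "0 < \<theta>" "\<theta> < 1" "snd (t, x) = \<theta> *\<^sub>R x1 + (1 - \<theta>) *\<^sub>R x2"
      then have "x \<in> U" using convexU by (auto intro!: convexD)
      then show "exp (Psi \<alpha> (fst (t, x)) s \<theta> x1 x2 / 2) \<le> 1 + s\<^sup>2 * 0" using * False by simp
    qed (use elim in auto)
    then show ?case by simp
  qed
  then have "\<forall>\<^sub>F m in sequentially. excess \<alpha> \<beta> (s m) (t, x) \<le> 0"
    using s by (rule eventually_compose_filterlim)
  then have "limsup (\<lambda>m. excess \<alpha> \<beta> (s m) (t, x)) \<le> 0" by (rule Limsup_bounded)
  then show ?thesis by (rule order_trans) simp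
qed

section \<open>Moments of f and the variance inequality for \<beta> > n + 1\<close>

lemma integrable_weight:
  assumes h[measurable]: "h \<in> borel_measurable borel" and B: "\<And>x. x \<in> U \<Longrightarrow> \<bar>h x\<bar> \<le> B"
  shows "integrable lborel (\<lambda>x. indicator U x * \<phi> x powr (- \<beta>) * h x)"
\<comment> \<open>The sum of the two powers dominates \<open>\<phi> x powr (- \<beta>)\<close> on
  \<open>U\<close> for either sign of \<beta>.\<close>
proof (rule Bochner_Integration.integrable_bound[of _ "\<lambda>x. (a powr (- \<beta>) + b powr (- \<beta>)) * B * indicator U x"])
  have "emeasure lborel U < \<infinity>" using boundedU by (rule emeasure_bounded_finite)
  then show "integrable lborel (\<lambda>x. (a powr (- \<beta>) + b powr (- \<beta>)) * B * indicator U x)"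
    by (intro integrable_mult_right integrable_real_indicator) (use openU in auto)
  show "AE x in lborel. norm (indicator U x * \<phi> x powr (- \<beta>) * h x) \<le> norm ((a powr (- \<beta>) + b powr (- \<beta>)) * B * indicator U x)"
  proof (intro AE_I2)
    fix x
    show "norm (indicator U x * \<phi> x powr (- \<beta>) * h x) \<le> norm ((a powr (- \<beta>) + b powr (- \<beta>)) * B * indicator U x)"
    proof (cases "x \<in> U")
      case True
      have "\<phi> x powr (- \<beta>) \<le> a powr (- \<beta>) + b powr (- \<beta>)"
      proof (cases "0 \<le> \<beta>")
        case True
        then have "\<phi> x powr (- \<beta>) \<le> a powr (- \<beta>)" using \<phi>_ge[OF \<open>x \<in> U\<close>] a by (intro powr_mono2') auto
        then show ?thesis by (simp add: add_increasing2)
      next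
        case False
        then have "\<phi> x powr (- \<beta>) \<le> b powr (- \<beta>)" using \<phi>_le[OF \<open>x \<in> U\<close>] \<phi>_pos[OF \<open>x \<in> U\<close>] by (intro powr_mono2) auto
        then show ?thesis by (simp add: add_increasing)
      qed
      then have "\<phi> x powr (- \<beta>) * \<bar>h x\<bar> \<le> (a powr (- \<beta>) + b powr (- \<beta>)) * B"
        using B[OF True] by (intro mult_mono) auto
      moreover have "0 \<le> B" using order_trans[OF abs_ge_zero B[OF True]] .
      ultimately show ?thesis using True by (simp add: abs_mult)
    qed simp
  qed
qed measurable


abbreviation weighted :: "real \<Rightarrow> (real^'n \<Rightarrow> real) \<Rightarrow> real" where
  "weighted \<equiv> weighted_integral U \<phi>"

lemma f_bounded:
  obtains F where "0 < F" "\<And>x. x \<in> U \<Longrightarrow> \<bar>f x\<bar> \<le> F"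
proof -
  obtain B where B: "\<And>x. x \<in> U \<Longrightarrow> norm x \<le> B" using boundedU unfolding bounded_iff by blast
  show ?thesis
  proof (rule that[of "\<bar>f 0\<bar> + L * \<bar>B\<bar> + 1"])
    show "0 < \<bar>f 0\<bar> + L * \<bar>B\<bar> + 1" using L_nonneg by (simp add: add_nonneg_pos)
    fix x assume "x \<in> U"
    then have "L * norm x \<le> L * \<bar>B\<bar>" using B[of x] L_nonneg by (intro mult_left_mono) auto
    then show "\<bar>f x\<bar> \<le> \<bar>f 0\<bar> + L * \<bar>B\<bar> + 1"
      using lipschitz_onD[OF lip, of x 0] by (simp add: dist_real_def)
  qed
qed

lemma nn_integral_base_exp:
  assumes \<beta>: "0 < \<beta>"
  shows "(\<integral>\<^sup>+z. ennreal (base \<beta> z) * ennreal (exp (s * f (snd z))) \<partial>lborel) = ennreal (Gamma \<beta> * weighted \<beta> (\<lambda>x. exp (s * f x)))"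
proof -
  obtain F where F: "0 < F" "\<And>x. x \<in> U \<Longrightarrow> \<bar>f x\<bar> \<le> F" using f_bounded by blast
  have int: "integrable lborel (\<lambda>x. indicator U x * \<phi> x powr (- \<beta>) * exp (s * f x))"
  proof (rule integrable_weight[where B="exp (\<bar>s\<bar> * F)"])
    fix x assume "x \<in> U"
    then have "\<bar>s * f x\<bar> \<le> \<bar>s\<bar> * F" using F(2) by (simp add: abs_mult mult_left_mono)
    then show "\<bar>exp (s * f x)\<bar> \<le> exp (\<bar>s\<bar> * F)" by simp
  qed measurable
  have "(\<integral>\<^sup>+z. ennreal (base \<beta> z) * ennreal (exp (s * f (snd z))) \<partial>lborel)
    = ennreal (Gamma \<beta>) * (\<integral>\<^sup>+x. ennreal (indicator U x * \<phi> x powr (- \<beta>)) * ennreal (exp (s * f x)) \<partial>lborel)"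
    by (rule nn_integral_base[OF \<beta>]) measurable
  also have "(\<integral>\<^sup>+x. ennreal (indicator U x * \<phi> x powr (- \<beta>)) * ennreal (exp (s * f x)) \<partial>lborel)
    = (\<integral>\<^sup>+x. ennreal (indicator U x * \<phi> x powr (- \<beta>) * exp (s * f x)) \<partial>lborel)"
    by (intro nn_integral_cong) (simp add: ennreal_mult)
  also have "\<dots> = ennreal (weighted \<beta> (\<lambda>x. exp (s * f x)))"
    by (rule nn_integral_eq_integral[OF int]) simp
  finally show ?thesis using \<beta> by (simp add: ennreal_mult Gamma_real_nonneg)
qed

lemma weighted_exp_ge:
  assumes F: "0 < F" "\<And>x. x \<in> U \<Longrightarrow> \<bar>f x\<bar> \<le> F" and s: "\<bar>s\<bar> * F \<le> 1"
  shows "weighted \<beta> (\<lambda>x. 1) + s * weighted \<beta> f + s\<^sup>2 * weighted \<beta> (\<lambda>x. (f x)\<^sup>2) / 2 - \<bar>s\<bar> ^ 3 * (F ^ 3 * weighted \<beta> (\<lambda>x. 1))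
    \<le> weighted \<beta> (\<lambda>x. exp (s * f x))"
proof -
  have i0: "integrable lborel (\<lambda>x. indicator U x * \<phi> x powr (- \<beta>) * 1)"
    by (rule integrable_weight[where B=1]) auto
  have i1: "integrable lborel (\<lambda>x. indicator U x * \<phi> x powr (- \<beta>) * f x)"
    by (rule integrable_weight[where B=F]) (use F in auto)
  have i2: "integrable lborel (\<lambda>x. indicator U x * \<phi> x powr (- \<beta>) * (f x)\<^sup>2)"
  proof (rule integrable_weight[where B="F\<^sup>2"])
    show "\<bar>(f x)\<^sup>2\<bar> \<le> F\<^sup>2" if "x \<in> U" for x
      using power_mono[OF F(2)[OF that], of 2] by simp
  qed measurable
  have ie: "integrable lborel (\<lambda>x. indicator U x * \<phi> x powr (- \<beta>) * exp (s * f x))"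
  proof (rule integrable_weight[where B="exp (\<bar>s\<bar> * F)"])
    fix x assume "x \<in> U"
    then have "\<bar>s * f x\<bar> \<le> \<bar>s\<bar> * F" using F(2) by (simp add: abs_mult mult_left_mono)
    then show "\<bar>exp (s * f x)\<bar> \<le> exp (\<bar>s\<bar> * F)" by simp
  qed measurable
  let ?w = "\<lambda>x. indicator U x * \<phi> x powr (- \<beta>)"
  let ?l = "\<lambda>x. (1 - \<bar>s\<bar> ^ 3 * F ^ 3) * (?w x * 1) + s * (?w x * f x) + (s\<^sup>2 / 2) * (?w x * (f x)\<^sup>2)"
  have "(\<integral>x. ?l x \<partial>lborel) \<le> weighted \<beta> (\<lambda>x. exp (s * f x))"
  proof (rule integral_mono[OF _ ie])
    show "integrable lborel ?l"
      by (intro Bochner_Integration.integrable_add integrable_mult_right i0 i1 i2)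
    fix x
    show "?l x \<le> indicator U x * \<phi> x powr (- \<beta>) * exp (s * f x)"
    proof (cases "x \<in> U")
      case True
      have sf: "\<bar>s * f x\<bar> \<le> \<bar>s\<bar> * F" using F(2)[OF True] by (simp add: abs_mult mult_left_mono)
      then have "\<bar>s * f x\<bar> ^ 3 \<le> (\<bar>s\<bar> * F) ^ 3" by (intro power_mono) auto
      moreover have "1 + s * f x + (s * f x)\<^sup>2 / 2 - \<bar>s * f x\<bar> ^ 3 \<le> exp (s * f x)"
        using sf s by (intro exp_ge_cubic) linarith
      ultimately have "1 + s * f x + s\<^sup>2 * (f x)\<^sup>2 / 2 - \<bar>s\<bar> ^ 3 * F ^ 3 \<le> exp (s * f x)"
        by (simp add: power_mult_distrib)
      then have "\<phi> x powr (- \<beta>) * (1 + s * f x + s\<^sup>2 * (f x)\<^sup>2 / 2 - \<bar>s\<bar> ^ 3 * F ^ 3) \<le> \<phi> x powr (- \<beta>) * exp (s * f x)"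
        by (intro mult_left_mono) auto
      then show ?thesis using True by (simp add: algebra_simps)
    qed simp
  qed
  also have "(\<integral>x. ?l x \<partial>lborel) = (1 - \<bar>s\<bar> ^ 3 * F ^ 3) * weighted \<beta> (\<lambda>x. 1) + s * weighted \<beta> f + (s\<^sup>2 / 2) * weighted \<beta> (\<lambda>x. (f x)\<^sup>2)"
    by (simp only: Bochner_Integration.integral_add Bochner_Integration.integrable_add integrable_mult_right i0 i1 i2 integral_mult_right_zero)
  finally show ?thesis by (simp add: algebra_simps)
qed

text \<open>Reverse Fatou passes the upper limit under the integral; the bound of order 1 / t
  obtained from coercivity is the integrable majorant. The pointwise limit is available at almost
  every (t, x), because exceptions depend on x alone.\<close>

lemma limsup_nn_integral_excess_le:
  assumes \<alpha>: "0 < \<alpha>" and \<beta>: "\<beta> = \<alpha> + real CARD('n) + 1"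
    and g[measurable]: "g \<in> borel_measurable borel" and fg: "AE x in lborel. GDERIV f x :> g x"
  obtains s where "filterlim s (at_right 0) sequentially" "\<And>m. 0 < s m"
    "limsup (\<lambda>m. \<integral>\<^sup>+z. excess \<alpha> \<beta> (s m) z \<partial>lborel) \<le> ennreal (Gamma (\<beta> - 1) / 2)
      * (energy_integral U \<phi> \<beta> H\<phi> g)"
proof -
  obtain B where B: "\<And>x. x \<in> U \<Longrightarrow> norm x \<le> B" using boundedU unfolding bounded_iff by blast
  \<comment> \<open>For s up to \<sigma> the condition
    \<open>s * L * norm (x1 - x2) \<le> \<alpha> * ln 2\<close> holds on all of \<open>U\<close>,
    whose points have norm at most B; the summand 1 keeps the denominator positive even if L =
    0.\<close>
  define \<sigma> where "\<sigma> = \<alpha> * ln 2 / (L * (2 * \<bar>B\<bar>) + 1)"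
  have den: "0 < L * (2 * \<bar>B\<bar>) + 1" using L_nonneg by (simp add: add_nonneg_pos)
  have \<sigma>: "0 < \<sigma>" using \<alpha> den by (simp add: \<sigma>_def)
  define s where "s m = \<sigma> / real (Suc m)" for m
  have spos: "0 < s m" for m using \<sigma> by (simp add: s_def)
  have "s \<longlonglongrightarrow> 0"
    unfolding s_def using LIMSEQ_Suc[OF lim_const_over_n[of \<sigma>]] by simp
  then have slim: "filterlim s (at_right 0) sequentially"
    using spos by (intro tendsto_imp_filterlim_at_right) auto
  have small: "s m * L * norm (x1 - x2) \<le> \<alpha> * ln 2" if x: "x1 \<in> U" "x2 \<in> U" for m x1 x2
  proof -
    have "norm (x1 - x2) \<le> 2 * \<bar>B\<bar>"
      using norm_triangle_ineq4[of x1 x2] B[OF x(1)] B[OF x(2)] by linarith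
    then have 1: "L * norm (x1 - x2) \<le> L * (2 * \<bar>B\<bar>) + 1" using mult_left_mono[of _ _ L] L_nonneg by fastforce
    have "s m \<le> \<sigma>" using \<sigma> by (simp add: s_def field_simps)
    then have "s m * (L * norm (x1 - x2)) \<le> \<sigma> * (L * (2 * \<bar>B\<bar>) + 1)"
      using 1 L_nonneg \<sigma> by (intro mult_mono) auto
    also have "\<dots> = \<alpha> * ln 2" using den by (simp add: \<sigma>_def)
    finally show ?thesis by (simp add: mult.assoc)
  qed
  define C where "C = exp (\<alpha> * ln 2 / 2) * L\<^sup>2 / c"
  have C: "0 \<le> C" using c by (simp add: C_def)
  have \<beta>1: "0 < \<beta> - 1" using \<alpha> by (simp add: \<beta> add_pos_nonneg)
  have dom: "excess \<alpha> \<beta> (s m) z \<le> ennreal C * ennreal (base (\<beta> - 1) z)" for m z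
  proof -
    define Y where "Y = (if 0 < fst z then C / fst z else 0)"
    have "excess \<alpha> \<beta> (s m) z \<le> ennreal (base \<beta> z * Y)"
    proof (rule excess_le[OF \<beta>])
      show "s m \<noteq> 0" using spos[of m] by simp
      show "0 \<le> Y" using C by (simp add: Y_def)
      fix \<theta> :: real and x1 x2 :: "real^'n"
      assume z: "0 < fst z" and x: "x1 \<in> U" "x2 \<in> U" "0 < \<theta>" "\<theta> < 1"
      show "exp (Psi \<alpha> (fst z) (s m) \<theta> x1 x2 / 2) \<le> 1 + (s m)\<^sup>2 * Y"
        using exp_half_Psi_le_dominating[OF x less_imp_le[OF spos] z \<alpha> small[OF x(1,2)]] z
        by (simp add: Y_def C_def)
    qed
    also have "base \<beta> z * Y = C * base (\<beta> - 1) z"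
    proof (cases "0 < fst z")
      case True
      then show ?thesis by (simp add: Y_def base_minus_1)
    next
      case False
      then show ?thesis by (simp add: base_def)
    qed
    finally show ?thesis using C by (simp add: ennreal_mult base_nonneg)
  qed
  let ?h = "\<lambda>x. ennreal (indicator U x * ((matrix_inv (H\<phi> x) *v g x) \<bullet> g x))"
  note borel_measurable_energy[OF g, measurable]
  have [measurable]: "(\<lambda>z :: real \<times> (real^'n). ?h (snd z)) \<in> borel_measurable borel"
    by (rule measurable_compose[OF _ borel_measurable_energy[OF g]]) measurable
  have fin: "(\<integral>\<^sup>+z. ennreal C * ennreal (base (\<beta> - 1) z) \<partial>lborel) < \<infinity>"
  proof -
    have "(\<integral>\<^sup>+z. ennreal (base (\<beta> - 1) z) * ennreal (exp (0 * f (snd z))) \<partial>lborel) < \<infinity>"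
      unfolding nn_integral_base_exp[OF \<beta>1] by simp
    then have "(\<integral>\<^sup>+z. ennreal (base (\<beta> - 1) z) \<partial>lborel) < \<infinity>" by simp
    then show ?thesis by (simp add: nn_integral_cmult ennreal_mult_less_top)
  qed
  have "limsup (\<lambda>m. \<integral>\<^sup>+z. excess \<alpha> \<beta> (s m) z \<partial>lborel) \<le> (\<integral>\<^sup>+z. limsup (\<lambda>m. excess \<alpha> \<beta> (s m) z) \<partial>lborel)"
    by (rule nn_integral_limsup[OF _ _ _ fin]) (use dom in auto)
  also have "\<dots> \<le> (\<integral>\<^sup>+z. ennreal (1 / 2) * (ennreal (base (\<beta> - 1) z) * ?h (snd z)) \<partial>lborel)"
  proof (rule nn_integral_mono_AE)
    show "AE z in lborel. limsup (\<lambda>m. excess \<alpha> \<beta> (s m) z) \<le> ennreal (1 / 2) * (ennreal (base (\<beta> - 1) z) * ?h (snd z))"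
      using AE_lborel_snd[OF fg]
    proof eventually_elim
      case (elim z)
      obtain t x where z: "z = (t, x)" by (cases z)
      have "limsup (\<lambda>m. excess \<alpha> \<beta> (s m) (t, x)) \<le> ennreal (base (\<beta> - 1) (t, x)) * ennreal (indicator U x * ((matrix_inv (H\<phi> x) *v g x) \<bullet> g x) / 2)"
        using elim by (intro limsup_excess_le[OF \<alpha> \<beta> _ slim]) (simp add: z)
      also have "ennreal (indicator U x * ((matrix_inv (H\<phi> x) *v g x) \<bullet> g x) / 2) = ennreal (1 / 2) * ?h x"
        by (subst ennreal_mult'[symmetric]) simp_all
      finally show ?case by (simp add: z ac_simps)
    qed
  qed
  also have "\<dots> = ennreal (1 / 2) * (\<integral>\<^sup>+z. ennreal (base (\<beta> - 1) z) * ?h (snd z) \<partial>lborel)"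
    by (rule nn_integral_cmult) measurable
  also have "(\<integral>\<^sup>+z. ennreal (base (\<beta> - 1) z) * ?h (snd z) \<partial>lborel)
    = ennreal (Gamma (\<beta> - 1)) * (\<integral>\<^sup>+x. ennreal (indicator U x * \<phi> x powr (- (\<beta> - 1))) * ?h x \<partial>lborel)"
    by (rule nn_integral_base[OF \<beta>1]) measurable
  also have "ennreal (1 / 2) * (ennreal (Gamma (\<beta> - 1)) * (\<integral>\<^sup>+x. ennreal (indicator U x * \<phi> x powr (- (\<beta> - 1))) * ?h x \<partial>lborel))
    = ennreal (Gamma (\<beta> - 1) / 2) * (\<integral>\<^sup>+x. ennreal (indicator U x * \<phi> x powr (1 - \<beta>)) * ?h x \<partial>lborel)"
  proof -
    have "ennreal (Gamma (\<beta> - 1) / 2) = ennreal (1 / 2) * ennreal (Gamma (\<beta> - 1))"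
      by (subst ennreal_mult'[symmetric]) simp_all
    then show ?thesis by (simp only: mult.assoc minus_diff_eq)
  qed
  finally show ?thesis by (rule that[OF slim spos])
qed

text \<open>A vanishing integral of the nonnegative weight makes the weight zero almost everywhere.
  This settles degenerate cases such as an empty \<open>U\<close>.\<close>

lemma weighted_eq_0:
  assumes "weighted \<beta> (\<lambda>x. 1) = 0"
  shows "weighted \<beta> h = 0"
proof (rule integral_eq_zero_AE)
  have "integrable lborel (\<lambda>x. indicator U x * \<phi> x powr (- \<beta>) * 1)"
    by (rule integrable_weight[where B=1]) auto
  then have "AE x in lborel. indicator U x * \<phi> x powr (- \<beta>) * 1 = 0"
    using assms by (subst (asm) integral_nonneg_eq_0_iff_AE) auto
  then show "AE x in lborel. indicator U x * \<phi> x powr (- \<beta>) * h x = 0"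
    by eventually_elim simp
qed

text \<open>Prekopa-Leindler bounds the product of the exponential moments at s and - s by the
  square of the envelope integral. All integrals carry the factor \<open>G = Gamma \<beta>\<close>,
  and comparing second orders gives the variance. If the energy is infinite, a positive total mass
  makes the right side infinite.\<close>

lemma variance_le_of_gt:
  assumes \<alpha>: "0 < \<alpha>" and \<beta>: "\<beta> = \<alpha> + real CARD('n) + 1"
    and g: "g \<in> borel_measurable borel" and fg: "AE x in lborel. GDERIV f x :> g x"
  shows "ennreal (weighted \<beta> (\<lambda>x. 1) * weighted \<beta> (\<lambda>x. (f x)\<^sup>2) - (weighted \<beta> f)\<^sup>2)
    \<le> ennreal (weighted \<beta> (\<lambda>x. 1) / (\<beta> - 1))
      * (energy_integral U \<phi> \<beta> H\<phi> g)"
proof -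
  let ?z = "weighted \<beta> (\<lambda>x. 1)" and ?m1 = "weighted \<beta> f" and ?m2 = "weighted \<beta> (\<lambda>x. (f x)\<^sup>2)"
  define R where "R = (energy_integral U \<phi> \<beta> H\<phi> g)"
  have \<beta>0: "0 < \<beta>" and \<beta>1: "0 < \<beta> - 1" using \<alpha> by (simp_all add: \<beta> add_pos_nonneg)
  obtain F where F: "0 < F" "\<And>x. x \<in> U \<Longrightarrow> \<bar>f x\<bar> \<le> F" using f_bounded by blast
  have z0: "0 \<le> ?z" by (intro integral_nonneg_AE AE_I2) simp
  consider "?z = 0" | "0 < ?z" "R = \<infinity>" | r where "0 < ?z" "0 \<le> r" "R = ennreal r"
    using z0 by (cases R) (auto simp: order_less_le)
  then show ?thesis
  proof cases
    case 1
    then show ?thesis using weighted_eq_0[OF 1] by simp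
  next
    case 2
    then have "ennreal (?z / (\<beta> - 1)) * R = \<infinity>" using \<beta>1 by (simp add: ennreal_mult_top)
    then show ?thesis unfolding R_def by simp
  next
    case (3 r)
    define G where "G = Gamma \<beta>"
    have G: "0 < G" unfolding G_def using \<beta>0 by (rule Gamma_real_pos)
    have GG: "G = (\<beta> - 1) * Gamma (\<beta> - 1)"
    proof -
      have "\<beta> - 1 \<notin> \<int>\<^sub>\<le>\<^sub>0" using \<beta>1 nonpos_Ints_nonpos[of "\<beta> - 1"] by auto
      then show ?thesis unfolding G_def using Gamma_plus1[of "\<beta> - 1"] by simp
    qed
    obtain s where s: "filterlim s (at_right 0) sequentially" "\<And>m. 0 < s m"
      "limsup (\<lambda>m. \<integral>\<^sup>+z. excess \<alpha> \<beta> (s m) z \<partial>lborel) \<le> ennreal (Gamma (\<beta> - 1) / 2) * R"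
      using limsup_nn_integral_excess_le[OF \<alpha> \<beta> g fg] unfolding R_def by blast
    \<comment> \<open>The limit of the second-order quotient carries Gamma (\<beta> - 1) / 2; after
      division by \<open>G\<^sup>2\<close> the recursion for Gamma leaves 1 / (\<beta> - 1).\<close>
    define Q0 where "Q0 = Gamma (\<beta> - 1) / 2 * r"
    have Q0: "0 \<le> Q0" using \<beta>1 3 by (simp add: Q0_def Gamma_real_nonneg)
    have s0: "s \<longlonglongrightarrow> 0" using s(1) by (simp add: filterlim_at)
    \<comment> \<open>An upper limit bounded by \<open>Q0\<close> puts the integrals eventually
      below \<open>Q0 + \<delta>\<close>, not below \<open>Q0\<close>; the slack \<delta> is removed
      afterwards.\<close>
    have main: "G * ?z * (G * ?m2) - (G * ?m1)\<^sup>2 \<le> 2 * (G * ?z) * (Q0 + \<delta>)" if \<delta>: "0 < \<delta>" for \<delta>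
    proof (rule variance_limit[OF s(1), where K="G * (F ^ 3 * ?z)"])
      have "limsup (\<lambda>m. \<integral>\<^sup>+z. excess \<alpha> \<beta> (s m) z \<partial>lborel) < ennreal (Q0 + \<delta>)"
      proof (rule order_le_less_trans[OF s(3)])
        show "ennreal (Gamma (\<beta> - 1) / 2) * R < ennreal (Q0 + \<delta>)"
          using 3 \<delta> \<beta>1 Q0 by (simp add: Q0_def ennreal_mult'[symmetric] ennreal_less_iff Gamma_real_nonneg)
      qed
      then have "\<forall>\<^sub>F m in sequentially. (\<integral>\<^sup>+z. excess \<alpha> \<beta> (s m) z \<partial>lborel) < ennreal (Q0 + \<delta>)"
        by (rule Limsup_lessD)
      moreover have "\<forall>\<^sub>F m in sequentially. s m < 1 / F"
        by (rule order_tendstoD[OF s0]) (use F in simp)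
      \<comment> \<open>Both lower bounds are made positive so that the two inequalities can be
        multiplied.\<close>
      moreover have "\<forall>\<^sub>F m in sequentially. 0 < G * ?z + s m * (G * ?m1) + (s m)\<^sup>2 * (G * ?m2) / 2 - s m ^ 3 * (G * (F ^ 3 * ?z))"
      proof (rule order_tendstoD)
        show "(\<lambda>m. G * ?z + s m * (G * ?m1) + (s m)\<^sup>2 * (G * ?m2) / 2 - s m ^ 3 * (G * (F ^ 3 * ?z))) \<longlonglongrightarrow> G * ?z"
          by (auto intro!: tendsto_eq_intros s0)
      qed (use G 3 in simp)
      moreover have "\<forall>\<^sub>F m in sequentially. 0 < G * ?z - s m * (G * ?m1) + (s m)\<^sup>2 * (G * ?m2) / 2 - s m ^ 3 * (G * (F ^ 3 * ?z))"
      proof (rule order_tendstoD)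
        show "(\<lambda>m. G * ?z - s m * (G * ?m1) + (s m)\<^sup>2 * (G * ?m2) / 2 - s m ^ 3 * (G * (F ^ 3 * ?z))) \<longlonglongrightarrow> G * ?z"
          by (auto intro!: tendsto_eq_intros s0)
      qed (use G 3 in simp)
      ultimately show "\<forall>\<^sub>F m in sequentially. (G * ?z + s m * (G * ?m1) + (s m)\<^sup>2 * (G * ?m2) / 2 - s m ^ 3 * (G * (F ^ 3 * ?z)))
          * (G * ?z - s m * (G * ?m1) + (s m)\<^sup>2 * (G * ?m2) / 2 - s m ^ 3 * (G * (F ^ 3 * ?z))) \<le> (G * ?z + (s m)\<^sup>2 * (Q0 + \<delta>))\<^sup>2"
      proof eventually_elim
        case (elim m)
        define \<sigma> where "\<sigma> = s m"
        have \<sigma>: "0 < \<sigma>" "\<sigma> * F \<le> 1" using s(2)[of m] elim(2) F(1) by (auto simp: \<sigma>_def field_simps)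
        define J where "J \<tau> = weighted \<beta> (\<lambda>x. exp (\<tau> * f x))" for \<tau>
        have J1: "G * ?z + \<sigma> * (G * ?m1) + \<sigma>\<^sup>2 * (G * ?m2) / 2 - \<sigma> ^ 3 * (G * (F ^ 3 * ?z)) \<le> G * J \<sigma>"
          using mult_left_mono[OF weighted_exp_ge[OF F, of \<sigma> \<beta>], of G] G \<sigma> unfolding J_def
          by (simp add: algebra_simps)
        have J2: "G * ?z - \<sigma> * (G * ?m1) + \<sigma>\<^sup>2 * (G * ?m2) / 2 - \<sigma> ^ 3 * (G * (F ^ 3 * ?z)) \<le> G * J (- \<sigma>)"
          using mult_left_mono[OF weighted_exp_ge[OF F, of "- \<sigma>" \<beta>], of G] G \<sigma> unfolding J_def
          by (simp add: algebra_simps)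
        have Jpos: "0 < G * J \<sigma>" "0 < G * J (- \<sigma>)" using J1 J2 elim(3,4) by (auto simp: \<sigma>_def)
        have "ennreal (G * J \<sigma>) * ennreal (G * J (- \<sigma>)) \<le> (\<integral>\<^sup>+z. envelope \<alpha> \<sigma> z \<partial>lborel)\<^sup>2"
          using Prekopa_Leindler_cone[of \<alpha> \<sigma>]
          unfolding nn_integral_envelope nn_integral_cone_density[OF \<beta>] nn_integral_base_exp[OF \<beta>0] J_def G_def .
        also have "(\<integral>\<^sup>+z. envelope \<alpha> \<sigma> z \<partial>lborel) = (\<integral>\<^sup>+z. ennreal (base \<beta> z) \<partial>lborel) + ennreal (\<sigma>\<^sup>2) * (\<integral>\<^sup>+z. excess \<alpha> \<beta> \<sigma> z \<partial>lborel)"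
          by (rule nn_integral_envelope_eq[OF \<beta>]) (use \<sigma> in simp)
        also have "(\<integral>\<^sup>+z. ennreal (base \<beta> z) \<partial>lborel) = ennreal (G * ?z)"
          using nn_integral_base_exp[OF \<beta>0, of 0] by (simp add: G_def)
        also have "(ennreal (G * ?z) + ennreal (\<sigma>\<^sup>2) * (\<integral>\<^sup>+z. excess \<alpha> \<beta> \<sigma> z \<partial>lborel))\<^sup>2 \<le> (ennreal (G * ?z) + ennreal (\<sigma>\<^sup>2) * ennreal (Q0 + \<delta>))\<^sup>2"
          using elim(1) by (intro power_mono add_left_mono mult_left_mono) (auto simp: \<sigma>_def)
        also have "\<dots> = ennreal ((G * ?z + \<sigma>\<^sup>2 * (Q0 + \<delta>))\<^sup>2)"
          using G z0 Q0 \<delta> by (simp add: ennreal_mult[symmetric] ennreal_plus[symmetric] ennreal_power del: ennreal_plus)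
        finally have "ennreal (G * J \<sigma> * (G * J (- \<sigma>))) \<le> ennreal ((G * ?z + \<sigma>\<^sup>2 * (Q0 + \<delta>))\<^sup>2)"
          using Jpos by (simp add: ennreal_mult[symmetric])
        then have "G * J \<sigma> * (G * J (- \<sigma>)) \<le> (G * ?z + \<sigma>\<^sup>2 * (Q0 + \<delta>))\<^sup>2"
          by (subst (asm) ennreal_le_iff) auto
        moreover have "(G * ?z + \<sigma> * (G * ?m1) + \<sigma>\<^sup>2 * (G * ?m2) / 2 - \<sigma> ^ 3 * (G * (F ^ 3 * ?z)))
          * (G * ?z - \<sigma> * (G * ?m1) + \<sigma>\<^sup>2 * (G * ?m2) / 2 - \<sigma> ^ 3 * (G * (F ^ 3 * ?z))) \<le> G * J \<sigma> * (G * J (- \<sigma>))"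
          using J1 J2 Jpos elim(3,4) by (intro mult_mono) (auto simp: \<sigma>_def)
        ultimately show ?case unfolding \<sigma>_def by linarith
      qed
    qed
    have "G * ?z * (G * ?m2) - (G * ?m1)\<^sup>2 \<le> 2 * (G * ?z) * Q0"
    proof (rule field_le_epsilon)
      fix e :: real assume e: "0 < e"
      define D where "D = 2 * (G * ?z)"
      have D: "0 < D" using G 3 by (simp add: D_def)
      then have "D * (Q0 + e / D) = D * Q0 + e" by (simp add: distrib_left)
      then show "G * ?z * (G * ?m2) - (G * ?m1)\<^sup>2 \<le> 2 * (G * ?z) * Q0 + e"
        using main[of "e / D"] e D unfolding D_def[symmetric] by simp
    qed
    also have "\<dots> = G\<^sup>2 * (?z / (\<beta> - 1) * r)"
      unfolding Q0_def using \<beta>1 by (simp add: GG power2_eq_square)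
    finally have "G\<^sup>2 * (?z * ?m2 - ?m1\<^sup>2) \<le> G\<^sup>2 * (?z / (\<beta> - 1) * r)"
      by (simp add: power2_eq_square algebra_simps)
    then have "?z * ?m2 - ?m1\<^sup>2 \<le> ?z / (\<beta> - 1) * r" using G by (subst (asm) mult_le_cancel_left_pos) auto
    then have "ennreal (?z * ?m2 - ?m1\<^sup>2) \<le> ennreal (?z / (\<beta> - 1) * r)" by (rule ennreal_leI)
    also have "\<dots> = ennreal (?z / (\<beta> - 1)) * R"
      unfolding 3(3) using 3 \<beta>1 by (intro ennreal_mult divide_nonneg_nonneg) auto
    finally show ?thesis unfolding R_def .
  qed
qed

section \<open>The limiting exponent \<beta> = n + 1\<close>

lemma powr_shift_le:
  assumes x: "x \<in> U" and e: "0 \<le> e"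
  shows "\<phi> x powr (\<gamma> - e) \<le> a powr (- e) * \<phi> x powr \<gamma>"
proof -
  have "\<phi> x powr (\<gamma> - e) = \<phi> x powr (- e) * \<phi> x powr \<gamma>"
    using \<phi>_pos[OF x] by (simp add: powr_add[symmetric])
  also have "\<dots> \<le> a powr (- e) * \<phi> x powr \<gamma>"
    using \<phi>_ge[OF x] a e by (intro mult_right_mono powr_mono2') auto
  finally show ?thesis .
qed

text \<open>The additional power of \<phi> is at most \<open>a powr (- (1 / Suc m))\<close>, which
  lies between 1 and 1 / a; the sum 1 + 1 / a covers both positions of a relative to 1 and gives the
  majorant.\<close>

lemma weighted_tendsto:
  assumes h[measurable]: "h \<in> borel_measurable borel" and B: "\<And>x. x \<in> U \<Longrightarrow> \<bar>h x\<bar> \<le> B"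
  shows "(\<lambda>m. weighted (\<beta> + 1 / Suc m) h) \<longlonglongrightarrow> weighted \<beta> h"
proof (rule integral_dominated_convergence[where w="\<lambda>x. indicator U x * \<phi> x powr (- \<beta>) * ((1 + 1 / a) * \<bar>h x\<bar>)"])
  show "integrable lborel (\<lambda>x. indicator U x * \<phi> x powr (- \<beta>) * ((1 + 1 / a) * \<bar>h x\<bar>))"
  proof (rule integrable_weight[where B="(1 + 1 / a) * B"])
    fix x assume "x \<in> U"
    then show "\<bar>(1 + 1 / a) * \<bar>h x\<bar>\<bar> \<le> (1 + 1 / a) * B"
      using B a by (simp add: abs_mult mult_left_mono)
  qed measurable
  show "AE x in lborel. (\<lambda>m. indicator U x * \<phi> x powr (- (\<beta> + 1 / Suc m)) * h x) \<longlonglongrightarrow> indicator U x * \<phi> x powr (- \<beta>) * h x"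
  proof (intro AE_I2)
    fix x
    show "(\<lambda>m. indicator U x * \<phi> x powr (- (\<beta> + 1 / Suc m)) * h x) \<longlonglongrightarrow> indicator U x * \<phi> x powr (- \<beta>) * h x"
    proof (cases "x \<in> U")
      case True
      have "(\<lambda>m. 1 / real (Suc m)) \<longlonglongrightarrow> 0" using LIMSEQ_inverse_real_of_nat by (simp add: inverse_eq_divide)
      then have "(\<lambda>m. - (\<beta> + 1 / Suc m)) \<longlonglongrightarrow> - (\<beta> + 0)" by (intro tendsto_intros)
      then have lim: "(\<lambda>m. - (\<beta> + 1 / Suc m)) \<longlonglongrightarrow> - \<beta>" by simp
      show ?thesis
        using \<phi>_pos[OF True] by (intro tendsto_mult tendsto_const tendsto_powr[OF tendsto_const lim]) simp
    qed simp
  qed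
  show "AE x in lborel. norm (indicator U x * \<phi> x powr (- (\<beta> + 1 / Suc m)) * h x) \<le> indicator U x * \<phi> x powr (- \<beta>) * ((1 + 1 / a) * \<bar>h x\<bar>)" for m
  proof (intro AE_I2)
    fix x
    show "norm (indicator U x * \<phi> x powr (- (\<beta> + 1 / Suc m)) * h x) \<le> indicator U x * \<phi> x powr (- \<beta>) * ((1 + 1 / a) * \<bar>h x\<bar>)"
    proof (cases "x \<in> U")
      case True
      have "\<phi> x powr (- \<beta> - 1 / Suc m) \<le> a powr (- (1 / Suc m)) * \<phi> x powr (- \<beta>)"
        by (rule powr_shift_le[OF True]) simp
      also have "\<dots> \<le> (1 + 1 / a) * \<phi> x powr (- \<beta>)"
      proof (rule mult_right_mono)
        show "a powr (- (1 / Suc m)) \<le> 1 + 1 / a"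
        proof (cases "a \<le> 1")
          case True
          then have "a powr (- (1 / Suc m)) \<le> a powr (- 1)" using a by (intro powr_mono') auto
          then show ?thesis using a by (simp add: powr_minus_divide)
        next
          case False
          then have "a powr (- (1 / Suc m)) \<le> a powr 0" by (intro powr_mono) auto
          then show ?thesis using a by (simp add: add_increasing2)
        qed
      qed simp
      finally have "\<phi> x powr (- \<beta> - 1 / Suc m) * \<bar>h x\<bar> \<le> (1 + 1 / a) * \<phi> x powr (- \<beta>) * \<bar>h x\<bar>"
        by (rule mult_right_mono) simp
      then show ?thesis using True by (simp add: abs_mult mult_ac)
    qed simp
  qed
qed measurable

text \<open>The exponents \<open>\<beta> + e m\<close> satisfy the strict inequality. The moments
  converge, while for the energies a one-sided comparison suffices: at \<open>\<beta> + e m\<close>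
  the energy is at most \<open>a powr (- e m)\<close> times the one at \<beta>, and this factor
  tends to 1.\<close>

lemma variance_le:
  assumes \<beta>: "real CARD('n) + 1 \<le> \<beta>"
    and g[measurable]: "g \<in> borel_measurable borel" and fg: "AE x in lborel. GDERIV f x :> g x"
  shows "ennreal (weighted \<beta> (\<lambda>x. 1) * weighted \<beta> (\<lambda>x. (f x)\<^sup>2) - (weighted \<beta> f)\<^sup>2)
    \<le> ennreal (weighted \<beta> (\<lambda>x. 1) / (\<beta> - 1))
      * (energy_integral U \<phi> \<beta> H\<phi> g)"
proof -
  let ?q = "\<lambda>x. ennreal (indicator U x * ((matrix_inv (H\<phi> x) *v g x) \<bullet> g x))"
  define R where "R \<beta> = (\<integral>\<^sup>+x. ennreal (indicator U x * \<phi> x powr (1 - \<beta>)) * ?q x \<partial>lborel)" for \<beta>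
  note borel_measurable_energy[OF g, measurable]
  obtain F where F: "0 < F" "\<And>x. x \<in> U \<Longrightarrow> \<bar>f x\<bar> \<le> F" using f_bounded by blast
  have "0 < real CARD('n)" by simp
  then have \<beta>1: "0 < \<beta> - 1" using \<beta> by linarith
  have z0: "0 \<le> weighted \<beta> (\<lambda>x. 1)" for \<beta> by (intro integral_nonneg_AE AE_I2) simp
  consider "weighted \<beta> (\<lambda>x. 1) = 0" | "0 < weighted \<beta> (\<lambda>x. 1)" "R \<beta> = \<infinity>"
    | r where "0 < weighted \<beta> (\<lambda>x. 1)" "0 \<le> r" "R \<beta> = ennreal r"
    using z0[of \<beta>] by (cases "R \<beta>") (auto simp: order_less_le)
  then show ?thesis
  proof cases
    case 1
    then show ?thesis using weighted_eq_0[OF 1] by simp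
  next
    case 2
    then have "ennreal (weighted \<beta> (\<lambda>x. 1) / (\<beta> - 1)) * R \<beta> = \<infinity>" using \<beta>1 by (simp add: ennreal_mult_top)
    then show ?thesis unfolding R_def by simp
  next
    case (3 r)
    define e where "e m = 1 / real (Suc m)" for m
    have e: "0 < e m" for m by (simp add: e_def)
    have e0: "e \<longlonglongrightarrow> 0" unfolding e_def using LIMSEQ_inverse_real_of_nat by (simp add: inverse_eq_divide)
    let ?z = "\<lambda>m. weighted (\<beta> + e m) (\<lambda>x. 1)" and ?m1 = "\<lambda>m. weighted (\<beta> + e m) f"
      and ?m2 = "\<lambda>m. weighted (\<beta> + e m) (\<lambda>x. (f x)\<^sup>2)"
    have lim: "?z \<longlonglongrightarrow> weighted \<beta> (\<lambda>x. 1)" "?m1 \<longlonglongrightarrow> weighted \<beta> f" "?m2 \<longlonglongrightarrow> weighted \<beta> (\<lambda>x. (f x)\<^sup>2)"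
    proof -
      show "?z \<longlonglongrightarrow> weighted \<beta> (\<lambda>x. 1)" unfolding e_def by (rule weighted_tendsto[where B=1]) auto
      show "?m1 \<longlonglongrightarrow> weighted \<beta> f" unfolding e_def by (rule weighted_tendsto[where B=F]) (use F in auto)
      show "?m2 \<longlonglongrightarrow> weighted \<beta> (\<lambda>x. (f x)\<^sup>2)" unfolding e_def
      proof (rule weighted_tendsto[where B="F\<^sup>2"])
        show "\<bar>(f x)\<^sup>2\<bar> \<le> F\<^sup>2" if "x \<in> U" for x
          using power_mono[OF F(2)[OF that], of 2] by simp
      qed measurable
    qed
    have "?z m * ?m2 m - (?m1 m)\<^sup>2 \<le> ?z m / (\<beta> + e m - 1) * (a powr (- e m) * r)" for m
    proof -
      have "R (\<beta> + e m) \<le> (\<integral>\<^sup>+x. ennreal (a powr (- e m)) * (ennreal (indicator U x * \<phi> x powr (1 - \<beta>)) * ?q x) \<partial>lborel)"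
        unfolding R_def
      proof (rule nn_integral_mono)
        fix x
        have "ennreal (indicator U x * \<phi> x powr (1 - (\<beta> + e m))) \<le> ennreal (a powr (- e m)) * ennreal (indicator U x * \<phi> x powr (1 - \<beta>))"
          using powr_shift_le[of x "e m" "1 - \<beta>"] e[of m]
          by (cases "x \<in> U") (auto simp: ennreal_mult[symmetric] diff_diff_eq intro: ennreal_leI)
        then show "ennreal (indicator U x * \<phi> x powr (1 - (\<beta> + e m))) * ?q x
          \<le> ennreal (a powr (- e m)) * (ennreal (indicator U x * \<phi> x powr (1 - \<beta>)) * ?q x)"
          unfolding mult.assoc[symmetric] by (rule mult_right_mono) simp
      qed
      also have "\<dots> = ennreal (a powr (- e m)) * R \<beta>"
        unfolding R_def by (rule nn_integral_cmult) measurable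
      also have "\<dots> = ennreal (a powr (- e m) * r)" using 3 by (simp add: ennreal_mult)
      finally have Rm: "R (\<beta> + e m) \<le> ennreal (a powr (- e m) * r)" .
      have "ennreal (?z m * ?m2 m - (?m1 m)\<^sup>2) \<le> ennreal (?z m / (\<beta> + e m - 1)) * R (\<beta> + e m)"
        unfolding R_def by (rule variance_le_of_gt[where \<alpha>="\<beta> + e m - real CARD('n) - 1"]) (use \<beta> e[of m] g fg in auto)
      also have "\<dots> \<le> ennreal (?z m / (\<beta> + e m - 1)) * ennreal (a powr (- e m) * r)"
        by (intro mult_left_mono Rm) simp
      also have "\<dots> = ennreal (?z m / (\<beta> + e m - 1) * (a powr (- e m) * r))"
        using 3 \<beta>1 e[of m] z0 by (intro ennreal_mult[symmetric]) (auto intro!: divide_nonneg_nonneg)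
      finally show ?thesis
        using 3 \<beta>1 e[of m] z0 by (subst (asm) ennreal_le_iff) (auto intro!: mult_nonneg_nonneg divide_nonneg_nonneg)
    qed
    moreover have "(\<lambda>m. ?z m * ?m2 m - (?m1 m)\<^sup>2) \<longlonglongrightarrow> weighted \<beta> (\<lambda>x. 1) * weighted \<beta> (\<lambda>x. (f x)\<^sup>2) - (weighted \<beta> f)\<^sup>2"
      by (intro tendsto_intros lim)
    moreover have "(\<lambda>m. ?z m / (\<beta> + e m - 1) * (a powr (- e m) * r)) \<longlonglongrightarrow> weighted \<beta> (\<lambda>x. 1) / (\<beta> + 0 - 1) * (a powr (- 0) * r)"
      using \<beta>1 a by (intro tendsto_intros lim e0) auto
    ultimately have "weighted \<beta> (\<lambda>x. 1) * weighted \<beta> (\<lambda>x. (f x)\<^sup>2) - (weighted \<beta> f)\<^sup>2 \<le> weighted \<beta> (\<lambda>x. 1) / (\<beta> + 0 - 1) * (a powr (- 0) * r)"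
      by (intro LIMSEQ_le) auto
    then have "weighted \<beta> (\<lambda>x. 1) * weighted \<beta> (\<lambda>x. (f x)\<^sup>2) - (weighted \<beta> f)\<^sup>2 \<le> weighted \<beta> (\<lambda>x. 1) / (\<beta> - 1) * r"
      using a by simp
    then have "ennreal (weighted \<beta> (\<lambda>x. 1) * weighted \<beta> (\<lambda>x. (f x)\<^sup>2) - (weighted \<beta> f)\<^sup>2) \<le> ennreal (weighted \<beta> (\<lambda>x. 1) / (\<beta> - 1) * r)"
      by (rule ennreal_leI)
    also have "\<dots> = ennreal (weighted \<beta> (\<lambda>x. 1) / (\<beta> - 1)) * R \<beta>"
      unfolding 3(3) using 3 \<beta>1 by (intro ennreal_mult divide_nonneg_nonneg) auto
    finally show ?thesis unfolding R_def .
  qed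
qed

end

subsection \<open>Exhaustion\<close>

text \<open>McShane's formula: the infimum over \<open>K\<close> of the functions
  \<open>f y + L * dist x y\<close> is finite because f is Lipschitz on \<open>K\<close>, and the
  triangle inequality makes it Lipschitz with the same constant.\<close>

lemma lipschitz_on_extension:
  fixes f :: "'a::metric_space \<Rightarrow> real"
  assumes lip: "L-lipschitz_on K f"
  obtains h where "L-lipschitz_on UNIV h" "\<And>x. x \<in> K \<Longrightarrow> h x = f x"
proof (cases "K = {}")
  case True
  have "L-lipschitz_on UNIV (\<lambda>x::'a. 0::real)"
    using lipschitz_on_nonneg[OF lip] by (intro lipschitz_onI) auto
  then show ?thesis using that True by blast
next
  case False
  have L: "0 \<le> L" using lip by (rule lipschitz_on_nonneg)
  define h where "h x = (INF y\<in>K. f y + L * dist x y)" for x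
  have fL: "f y0 \<le> f y + L * dist y0 y" if "y0 \<in> K" "y \<in> K" for y0 y
    using lipschitz_onD[OF lip that] by (simp add: dist_real_def abs_le_iff)
  have bdd: "bdd_below ((\<lambda>y. f y + L * dist x y) ` K)" for x
  proof -
    obtain y0 where y0: "y0 \<in> K" using False by auto
    show ?thesis
    proof (rule bdd_belowI2)
      fix y assume y: "y \<in> K"
      have "L * dist y0 y \<le> L * (dist x y0 + dist x y)" by (intro mult_left_mono dist_triangle3 L)
      then show "f y0 - L * dist x y0 \<le> f y + L * dist x y" using fL[OF y0 y] by (simp add: distrib_left)
    qed
  qed
  have le: "h x \<le> h x' + L * dist x x'" for x x'
  proof -
    have "h x - L * dist x x' \<le> h x'"
      unfolding h_def[of x']
    proof (rule cINF_greatest[OF False])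
      fix y assume y: "y \<in> K"
      have "h x \<le> f y + L * dist x y" unfolding h_def by (rule cINF_lower[OF bdd y])
      also have "L * dist x y \<le> L * (dist x x' + dist x' y)" by (intro mult_left_mono dist_triangle L)
      finally show "h x - L * dist x x' \<le> f y + L * dist x' y" by (simp add: distrib_left)
    qed
    then show ?thesis by simp
  qed
  show ?thesis
  proof
    show "L-lipschitz_on UNIV h"
    proof (rule lipschitz_onI[OF _ L])
      fix x y
      show "dist (h x) (h y) \<le> L * dist x y"
        using le[of x y] le[of y x] unfolding dist_real_def dist_commute[of y x] by linarith
    qed
    fix x assume x: "x \<in> K"
    show "h x = f x"
    proof (rule antisym)
      show "h x \<le> f x" unfolding h_def using cINF_lower[OF bdd x, of x] by simp
      show "f x \<le> h x" unfolding h_def by (rule cINF_greatest[OF False]) (rule fL[OF x])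
    qed
  qed
qed

text \<open>The singleton \<open>{0}\<close> is a dummy time: \<open>local_lipschitz\<close>
  concerns families of functions, and its compactness result is used for the family with the single
  member f.\<close>

lemma locally_lipschitz_on_compact:
  assumes f: "locally_lipschitz_on \<Omega> f" and K: "compact K" "K \<subseteq> \<Omega>"
  obtains L where "L-lipschitz_on K f"
proof -
  have ll: "local_lipschitz {0::real} K (\<lambda>_. f)"
  proof (rule local_lipschitzI)
    fix t :: real and x assume "x \<in> K"
    then obtain e L where e: "e > 0" "L-lipschitz_on (ball x e \<inter> \<Omega>) f"
      using f K(2) unfolding locally_lipschitz_on_def by blast
    have "L-lipschitz_on (cball x (e / 2) \<inter> K) f"
      by (rule lipschitz_on_subset[OF e(2)]) (use e K(2) in auto)
    then show "\<exists>u>0. \<exists>L. \<forall>t\<in>cball t u \<inter> {0}. L-lipschitz_on (cball x u \<inter> K) f"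
      using e(1) by (intro exI[of _ "e / 2"]) auto
  qed
  obtain L where "\<And>t. t \<in> {0::real} \<Longrightarrow> L-lipschitz_on K f"
    using local_lipschitz_compact_implies_lipschitz[OF ll K(1) compact_sing] by auto
  then show ?thesis using that by blast
qed

lemma GDERIV_unique:
  assumes "GDERIV f x :> D" "GDERIV f x :> D'"
  shows "D = D'"
proof -
  have "(\<lambda>h. h \<bullet> D) = (\<lambda>h. h \<bullet> D')"
    using assms unfolding gderiv_def by (rule has_derivative_unique)
  then have "(D - D') \<bullet> D = (D - D') \<bullet> D'" by meson
  then have "(D - D') \<bullet> (D - D') = 0" by (simp add: inner_diff_right)
  then show ?thesis by simp
qed

lemma grad_eq: "GDERIV f x :> D \<Longrightarrow> grad f x = D"
  unfolding grad_def by (rule some_equality) (auto intro: GDERIV_unique)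

text \<open>The quadratic form attains a positive minimum on the compact product of \<open>K\<close>
  and the unit sphere; homogeneity extends the bound to all vectors.\<close>

lemma Hessian_coercive_on_compact:
  fixes H :: "real^'n \<Rightarrow> real^'n^'n"
  assumes K: "compact K" and cont: "continuous_on K H"
    and pos: "\<And>x v. x \<in> K \<Longrightarrow> v \<noteq> 0 \<Longrightarrow> v \<bullet> (H x *v v) > 0"
  obtains c where "0 < c" "\<And>x v. x \<in> K \<Longrightarrow> c * (norm v)\<^sup>2 \<le> v \<bullet> (H x *v v)"
proof (cases "K = {}")
  case False
  let ?S = "K \<times> sphere (0 :: real^'n) 1"
  have "\<exists>v :: real^'n. norm v = 1" using vector_choose_size[of 1] by (metis zero_le_one)
  then have ne: "?S \<noteq> {}" using False by auto
  have H: "continuous_on ?S (\<lambda>z. H (fst z))"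
    by (rule continuous_on_compose2[OF cont]) (auto intro: continuous_intros)
  have "continuous_on ?S (\<lambda>z. snd z \<bullet> (H (fst z) *v snd z))"
    unfolding matrix_vector_mult_def
    by (intro continuous_intros continuous_on_vec_lambda H)
  moreover have "compact ?S" by (intro compact_Times K compact_sphere)
  ultimately obtain z where z: "z \<in> ?S" "\<And>w. w \<in> ?S \<Longrightarrow> snd z \<bullet> (H (fst z) *v snd z) \<le> snd w \<bullet> (H (fst w) *v snd w)"
    using continuous_attains_inf[OF _ ne] by blast
  let ?c = "snd z \<bullet> (H (fst z) *v snd z)"
  show ?thesis
  proof (rule that[of ?c])
    have "fst z \<in> K" "norm (snd z) = 1" using z(1) by auto
    then show "0 < ?c" by (intro pos) (auto simp del: norm_eq_zero)
    fix x v assume x: "x \<in> K"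
    show "?c * (norm v)\<^sup>2 \<le> v \<bullet> (H x *v v)"
    proof (cases "v = 0")
      case False
      have "?c \<le> (v /\<^sub>R norm v) \<bullet> (H x *v (v /\<^sub>R norm v))"
        using z(2)[of "(x, v /\<^sub>R norm v)"] x False by simp
      also have "\<dots> = (v \<bullet> (H x *v v)) / (norm v)\<^sup>2"
        by (simp add: matrix_vector_mult_scaleR power2_eq_square divide_inverse)
      finally show ?thesis using False by (simp add: pos_le_divide_eq)
    qed simp
  qed
qed (rule that[of 1], auto)


section \<open>Compact convex pieces of \<Omega>\<close>

text \<open>Outside \<open>K\<close> the function f may fail to be Lipschitz, so it is replaced by
  an extension h of its restriction, to which Rademacher's theorem applies globally. On the open
  interior f and h agree, hence so do their gradients. Measurability is stated for the energy of g,
  because \<open>grad f\<close> is an arbitrary choice where f is not differentiable.\<close>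

lemma variance_le_on_compact:
  fixes \<Omega> :: "(real^'n) set" and \<phi> :: "real^'n \<Rightarrow> real"
    and D\<phi> :: "real^'n \<Rightarrow> real^'n" and H\<phi> :: "real^'n \<Rightarrow> real^'n^'n"
  assumes K: "compact K" "convex K" "K \<subseteq> \<Omega>"
    and pos: "\<And>x. x \<in> \<Omega> \<Longrightarrow> \<phi> x > 0"
    and grad_phi: "\<And>x. x \<in> \<Omega> \<Longrightarrow> GDERIV \<phi> x :> D\<phi> x"
    and hess_phi: "\<And>x. x \<in> \<Omega> \<Longrightarrow> (D\<phi> has_derivative (\<lambda>h. H\<phi> x *v h)) (at x)"
    and contH: "continuous_on \<Omega> H\<phi>"
    and posdef: "\<And>x v. x \<in> \<Omega> \<Longrightarrow> v \<noteq> 0 \<Longrightarrow> v \<bullet> (H\<phi> x *v v) > 0"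
    and \<beta>: "real CARD('n) + 1 \<le> \<beta>"
    and f: "locally_lipschitz_on \<Omega> f"
  obtains g where "AE x in lborel. x \<in> interior K \<longrightarrow> GDERIV f x :> g x"
    "(\<lambda>x. ennreal (indicator (interior K) x * ((matrix_inv (H\<phi> x) *v g x) \<bullet> g x))) \<in> borel_measurable borel"
    "ennreal ((weighted_integral (interior K) \<phi> \<beta> (\<lambda>x. 1)) * (weighted_integral (interior K) \<phi> \<beta> (\<lambda>x. (f x)\<^sup>2))
        - (weighted_integral (interior K) \<phi> \<beta> f)\<^sup>2)
      \<le> ennreal ((weighted_integral (interior K) \<phi> \<beta> (\<lambda>x. 1)) / (\<beta> - 1))
        * (energy_integral (interior K) \<phi> \<beta> H\<phi> g)"
proof -
  define U where "U = interior K"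
  have UK: "U \<subseteq> K" unfolding U_def by (rule interior_subset)
  have cont\<phi>: "continuous_on K \<phi>"
  using K(3) by (intro continuous_at_imp_continuous_on ballI GDERIV_imp_isCont[OF grad_phi]) auto
  have "\<exists>a>0. \<forall>x\<in>K. a \<le> \<phi> x"
  proof (cases "K = {}")
    case False
    obtain x where x: "x \<in> K" "\<And>y. y \<in> K \<Longrightarrow> \<phi> x \<le> \<phi> y"
      using continuous_attains_inf[OF K(1) False cont\<phi>] by blast
    then show ?thesis using pos[of x] K(3) by (intro exI[of _ "\<phi> x"]) auto
  qed (auto intro: exI[of _ 1])
  then obtain a where a: "0 < a" "\<And>x. x \<in> K \<Longrightarrow> a \<le> \<phi> x" by blast
  have "bounded (\<phi> ` K)" by (intro compact_imp_bounded compact_continuous_image cont\<phi> K(1))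
  then obtain b where b: "\<And>x. x \<in> K \<Longrightarrow> \<bar>\<phi> x\<bar> \<le> b" by (auto simp: bounded_iff)
  obtain c where c: "0 < c" "\<And>x v. x \<in> K \<Longrightarrow> c * (norm v)\<^sup>2 \<le> v \<bullet> (H\<phi> x *v v)"
    using Hessian_coercive_on_compact[OF K(1) continuous_on_subset[OF contH K(3)] posdef] K(3) by blast
  obtain L where L: "L-lipschitz_on K f" using locally_lipschitz_on_compact[OF f K(1,3)] by blast
  obtain h where h: "L-lipschitz_on UNIV h" "\<And>x. x \<in> K \<Longrightarrow> h x = f x"
    using lipschitz_on_extension[OF L] by blast
  obtain g where g: "g \<in> borel_measurable borel" "AE x in lborel. GDERIV h x :> g x"
    using Rademacher[OF h(1)] by blast
  interpret bounded_convex_weight U \<phi> D\<phi> H\<phi> c a b h L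
  proof
    show "open U" "convex U" unfolding U_def by (simp_all add: K(2) convex_interior)
    show "bounded U" using compact_imp_bounded[OF K(1)] UK bounded_subset by blast
    show "\<phi> x \<le> b" if "x \<in> U" for x using b[of x] UK that by auto
    show "continuous_on U H\<phi>" using contH UK K(3) by (auto intro: continuous_on_subset)
  qed (use a c h UK K(3) grad_phi hess_phi in auto)
  have hf: "indicator U x * \<phi> x powr (- \<beta>) * h x = indicator U x * \<phi> x powr (- \<beta>) * f x"
    "indicator U x * \<phi> x powr (- \<beta>) * (h x)\<^sup>2 = indicator U x * \<phi> x powr (- \<beta>) * (f x)\<^sup>2" for x
    using h(2)[of x] UK by (auto simp: indicator_def)
  have "AE x in lborel. x \<in> U \<longrightarrow> GDERIV f x :> g x"
    using g(2)
  proof eventually_elim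
    case (elim x)
    show ?case
    proof
      assume x: "x \<in> U"
      have "((\<lambda>y. f y) has_derivative (\<lambda>k. k \<bullet> g x)) (at x)"
        by (rule has_derivative_transform_within_open[OF elim[unfolded gderiv_def] openU x]) (use h(2) UK in auto)
      then show "GDERIV f x :> g x" by (simp add: gderiv_def)
    qed
  qed
  then show ?thesis
    unfolding U_def
    by (rule that[OF _ borel_measurable_energy[OF g(1), unfolded U_def] variance_le[OF \<beta> g, unfolded hf, unfolded U_def]])
qed

text \<open>The convex hulls of an ordinary compact exhaustion remain in \<Omega> by convexity and
  remain compact in finite dimension; a small ball around each point of \<Omega> eventually lies
  inside.\<close>

lemma open_convex_exhaustion:
  fixes \<Omega> :: "'a::euclidean_space set"
  assumes "open \<Omega>" "convex \<Omega>"
  obtains K where "\<And>n::nat. compact (K n)" "\<And>n. convex (K n)" "\<And>n. K n \<subseteq> \<Omega>"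
    "\<And>x. x \<in> \<Omega> \<Longrightarrow> \<forall>\<^sub>F n in sequentially. x \<in> interior (K n)"
proof -
  obtain C where C: "\<And>n. compact (C n)" "\<And>n. C n \<subseteq> \<Omega>" "\<And>n. C n \<subseteq> interior (C (Suc n))" "\<Union>(range C) = \<Omega>"
    "\<And>K. \<lbrakk>compact K; K \<subseteq> \<Omega>\<rbrakk> \<Longrightarrow> \<exists>N. \<forall>n\<ge>N. K \<subseteq> (C n)"
    by (rule open_Union_compact_subsets[OF assms(1)]) (rule that)
  show ?thesis
  proof (rule that[of "\<lambda>n. convex hull (C n)"])
    show "compact (convex hull (C n))" for n by (intro compact_convex_hull C)
    show "convex (convex hull (C n))" for n by (rule convex_convex_hull)
    show "convex hull (C n) \<subseteq> \<Omega>" for n using C(2) assms(2) by (rule hull_minimal)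
    fix x assume "x \<in> \<Omega>"
    then obtain e where e: "0 < e" "cball x e \<subseteq> \<Omega>" using assms(1) open_contains_cball by blast
    obtain N where N: "\<forall>n\<ge>N. cball x e \<subseteq> C n" using C(5)[OF compact_cball e(2)] by blast
    show "\<forall>\<^sub>F n in sequentially. x \<in> interior (convex hull (C n))"
      unfolding eventually_sequentially
    proof (intro exI[of _ N] allI impI)
      fix n assume "N \<le> n"
      then have "ball x e \<subseteq> convex hull (C n)"
        using N hull_subset[of "C n" convex] ball_subset_cball[of x e] by blast
      then show "x \<in> interior (convex hull (C n))"
        using e(1) by (meson mem_interior)
    qed
  qed
qed

theorem theorem8:
  fixes \<Omega> :: "(real^'n) set" and \<phi> :: "real^'n \<Rightarrow> real"
    and D\<phi> :: "real^'n \<Rightarrow> real^'n" and H\<phi> :: "real^'n \<Rightarrow> real^'n^'n"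
    and \<beta> :: real and f :: "real^'n \<Rightarrow> real"
  assumes "open \<Omega>" and "convex \<Omega>"
    and pos: "\<And>x. x \<in> \<Omega> \<Longrightarrow> \<phi> x > 0"
    and grad_phi: "\<And>x. x \<in> \<Omega> \<Longrightarrow> GDERIV \<phi> x :> D\<phi> x"
    and hess_phi: "\<And>x. x \<in> \<Omega> \<Longrightarrow> (D\<phi> has_derivative (\<lambda>h. H\<phi> x *v h)) (at x)"
    and "continuous_on \<Omega> H\<phi>"
    and "convex_on \<Omega> \<phi>"
    and posdef: "\<And>x v. x \<in> \<Omega> \<Longrightarrow> v \<noteq> 0 \<Longrightarrow> v \<bullet> (H\<phi> x *v v) > 0"
    and "\<beta> \<ge> real CARD('n) + 1"
    and "set_integrable lebesgue \<Omega> (\<lambda>x. \<phi> x powr (-\<beta>))"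
    and "locally_lipschitz_on \<Omega> f"
    and "f \<in> borel_measurable (mu_beta \<Omega> \<phi> \<beta>)"
    and "integrable (mu_beta \<Omega> \<phi> \<beta>) (\<lambda>x. (f x)\<^sup>2)"
  shows "ennreal ((\<integral>x. (f x)\<^sup>2 \<partial>mu_beta \<Omega> \<phi> \<beta>) - (\<integral>x. f x \<partial>mu_beta \<Omega> \<phi> \<beta>)\<^sup>2)
      \<le> ennreal (1 / (\<beta> - 1)) *
        (\<integral>\<^sup>+x. ennreal (((matrix_inv (H\<phi> x) *v grad f x) \<bullet> grad f x) * \<phi> x) \<partial>mu_beta \<Omega> \<phi> \<beta>)"
proof -
  define w where "w x = indicator \<Omega> x * \<phi> x powr (- \<beta>)" for x
  define Z where "Z = (\<integral>x. w x \<partial>lborel)"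
  have "0 < real CARD('n)" by simp
  then have \<beta>1: "0 < \<beta> - 1" using assms(9) by linarith
  have w0: "0 \<le> w x" for x by (simp add: w_def)
  have \<Omega>[measurable]: "\<Omega> \<in> sets borel" using assms(1) by simp
  have "continuous_on \<Omega> \<phi>"
  by (intro continuous_at_imp_continuous_on ballI GDERIV_imp_isCont[OF grad_phi])
  then have \<phi>m[measurable]: "(\<lambda>x. indicator \<Omega> x * \<phi> x) \<in> borel_measurable borel"
    using borel_measurable_continuous_on_indicator[OF \<Omega>, of \<phi>] by simp
  \<comment> \<open>The second indicator changes nothing where w is nonzero and presents w through a
    Borel function, as \<phi> is controlled only on \<Omega>.\<close>
  have "w = (\<lambda>x. indicator \<Omega> x * (indicator \<Omega> x * \<phi> x) powr (- \<beta>))"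
    by (auto simp: w_def indicator_def)
  then have wm[measurable]: "w \<in> borel_measurable borel" by simp
  have "continuous_on \<Omega> f"
  proof (intro continuous_at_imp_continuous_on ballI)
    fix x assume x: "x \<in> \<Omega>"
    then obtain e L where e: "e > 0" "L-lipschitz_on (ball x e \<inter> \<Omega>) f"
      using assms(11) unfolding locally_lipschitz_on_def by blast
    have "continuous_on (ball x e \<inter> \<Omega>) f" using e(2) by (rule lipschitz_on_continuous_on)
    moreover have "open (ball x e \<inter> \<Omega>)" "x \<in> ball x e \<inter> \<Omega>" using assms(1) e(1) x by auto
    ultimately show "isCont f x" by (simp add: continuous_on_eq_continuous_at)
  qed
  then have fm[measurable]: "(\<lambda>x. indicator \<Omega> x * f x) \<in> borel_measurable borel"
    using borel_measurable_continuous_on_indicator[OF \<Omega>, of f] by simp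
  have wfm[measurable]: "(\<lambda>x. w x * f x) \<in> borel_measurable borel" "(\<lambda>x. w x * (f x)\<^sup>2) \<in> borel_measurable borel"
  proof -
    have "(\<lambda>x. w x * f x) = (\<lambda>x. w x * (indicator \<Omega> x * f x))" "(\<lambda>x. w x * (f x)\<^sup>2) = (\<lambda>x. w x * (indicator \<Omega> x * f x)\<^sup>2)"
      by (auto simp: w_def indicator_def)
    then show "(\<lambda>x. w x * f x) \<in> borel_measurable borel" "(\<lambda>x. w x * (f x)\<^sup>2) \<in> borel_measurable borel" by simp_all
  qed
  \<comment> \<open>The measure in the statement is a density with respect to the completed measure,
    whereas the estimates are for \<open>lborel\<close>; for Borel integrands the integrals
    coincide.\<close>
  have Z_eq: "(\<integral>y\<in>\<Omega>. \<phi> y powr (-\<beta>) \<partial>lebesgue) = Z"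
    unfolding Z_def set_lebesgue_integral_def real_scaleR_def w_def[symmetric] by (rule integral_completion) simp
  have w_int: "integrable lborel w"
    using assms(10) unfolding set_integrable_def real_scaleR_def w_def[symmetric] by (subst (asm) integrable_completion) auto
  have Z0: "0 \<le> Z" unfolding Z_def by (intro integral_nonneg_AE AE_I2 w0)
  have mu: "mu_beta \<Omega> \<phi> \<beta> = density lebesgue (\<lambda>x. ennreal (w x / Z))"
    unfolding mu_beta_def Z_eq w_def ..
  have fleb[measurable]: "f \<in> borel_measurable lebesgue"
    using assms(12) unfolding mu by simp
  have wleb[measurable]: "(\<lambda>x. w x / Z) \<in> borel_measurable lebesgue"
    by (rule measurable_completion) simp
  have I2: "(\<integral>x. (f x)\<^sup>2 \<partial>mu_beta \<Omega> \<phi> \<beta>) = (\<integral>x. w x * (f x)\<^sup>2 \<partial>lborel) / Z"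
  proof -
    have "(\<integral>x. (f x)\<^sup>2 \<partial>mu_beta \<Omega> \<phi> \<beta>) = (\<integral>x. (w x / Z) *\<^sub>R (f x)\<^sup>2 \<partial>lebesgue)"
      unfolding mu by (rule integral_density) (use w0 Z0 in auto)
    also have "\<dots> = (\<integral>x. w x * (f x)\<^sup>2 / Z \<partial>lebesgue)" by simp
    also have "\<dots> = (\<integral>x. w x * (f x)\<^sup>2 / Z \<partial>lborel)" by (rule integral_completion) simp
    finally show ?thesis by simp
  qed
  have I1: "(\<integral>x. f x \<partial>mu_beta \<Omega> \<phi> \<beta>) = (\<integral>x. w x * f x \<partial>lborel) / Z"
  proof -
    have "(\<integral>x. f x \<partial>mu_beta \<Omega> \<phi> \<beta>) = (\<integral>x. (w x / Z) *\<^sub>R f x \<partial>lebesgue)"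
      unfolding mu by (rule integral_density) (use w0 Z0 in auto)
    also have "\<dots> = (\<integral>x. w x * f x / Z \<partial>lebesgue)" by simp
    also have "\<dots> = (\<integral>x. w x * f x / Z \<partial>lborel)" by (rule integral_completion) simp
    finally show ?thesis by simp
  qed
  show ?thesis
  proof (cases "Z = 0")
    \<comment> \<open>Division by 0 yields 0, so both moments vanish and the left side is 0.\<close>
    case True
    then show ?thesis unfolding I1 I2 by simp
  next
    case False
    then have Z: "0 < Z" using Z0 by simp
    have w2_int: "integrable lborel (\<lambda>x. w x * (f x)\<^sup>2)"
    proof -
      have "integrable lebesgue (\<lambda>x. (w x / Z) *\<^sub>R (f x)\<^sup>2)"
        using assms(13) unfolding mu by (subst (asm) integrable_density) (use w0 Z0 in auto)
      then have "integrable lebesgue (\<lambda>x. Z * ((w x / Z) *\<^sub>R (f x)\<^sup>2))" by (rule integrable_mult_right)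
      then have "integrable lebesgue (\<lambda>x. w x * (f x)\<^sup>2)" using Z by simp
      then show ?thesis by (subst (asm) integrable_completion) auto
    qed
    have w1_int: "integrable lborel (\<lambda>x. w x * f x)"
    proof (rule Bochner_Integration.integrable_bound[of _ "\<lambda>x. w x + w x * (f x)\<^sup>2"])
      show "integrable lborel (\<lambda>x. w x + w x * (f x)\<^sup>2)" by (intro Bochner_Integration.integrable_add w_int w2_int)
      show "AE x in lborel. norm (w x * f x) \<le> norm (w x + w x * (f x)\<^sup>2)"
      proof (intro AE_I2)
        fix x
        have "\<bar>f x\<bar> \<le> 1 + (f x)\<^sup>2"
        proof -
          have "0 \<le> (\<bar>f x\<bar> - 1)\<^sup>2" "0 \<le> \<bar>f x\<bar>" by auto
          then show ?thesis by (simp add: power2_diff)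
        qed
        then have "w x * \<bar>f x\<bar> \<le> w x * (1 + (f x)\<^sup>2)" using w0 by (intro mult_left_mono) auto
        then show "norm (w x * f x) \<le> norm (w x + w x * (f x)\<^sup>2)" using w0[of x] by (simp add: abs_mult distrib_left)
      qed
    qed simp
    obtain K where K: "\<And>n::nat. compact (K n)" "\<And>n. convex (K n)" "\<And>n. K n \<subseteq> \<Omega>"
      "\<And>x. x \<in> \<Omega> \<Longrightarrow> \<forall>\<^sub>F n in sequentially. x \<in> interior (K n)"
      using open_convex_exhaustion[OF assms(1,2)] by blast
    define U where "U n = interior (K n)" for n
    have U\<Omega>: "U n \<subseteq> \<Omega>" for n using interior_subset K(3) unfolding U_def by blast
    have [measurable]: "U n \<in> sets borel" for n by (simp add: U_def)
    let ?P = "\<lambda>n g. (AE x in lborel. x \<in> U n \<longrightarrow> GDERIV f x :> g x)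
      \<and> (\<lambda>x. ennreal (indicator (U n) x * ((matrix_inv (H\<phi> x) *v g x) \<bullet> g x))) \<in> borel_measurable borel
      \<and> ennreal ((weighted_integral (U n) \<phi> \<beta> (\<lambda>x. 1)) * (weighted_integral (U n) \<phi> \<beta> (\<lambda>x. (f x)\<^sup>2))
          - (weighted_integral (U n) \<phi> \<beta> f)\<^sup>2)
        \<le> ennreal ((weighted_integral (U n) \<phi> \<beta> (\<lambda>x. 1)) / (\<beta> - 1))
          * (energy_integral (U n) \<phi> \<beta> H\<phi> g)"
    have "\<exists>g. ?P n g" for n
      unfolding U_def
      by (rule variance_le_on_compact[OF K(1-3)[of n] pos grad_phi hess_phi assms(6) posdef assms(9) assms(11)])
        (assumption | rule exI conjI)+
    then have "\<forall>n. \<exists>g. ?P n g" by (rule allI)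
    from choice[OF this] obtain g where gP: "\<forall>n. ?P n (g n)" by (rule exE)
    have g: "AE x in lborel. x \<in> U n \<longrightarrow> GDERIV f x :> g n x"
      and qm: "(\<lambda>x. ennreal (indicator (U n) x * ((matrix_inv (H\<phi> x) *v g n x) \<bullet> g n x))) \<in> borel_measurable borel"
      and ineq: "ennreal ((weighted_integral (U n) \<phi> \<beta> (\<lambda>x. 1)) * (weighted_integral (U n) \<phi> \<beta> (\<lambda>x. (f x)\<^sup>2))
          - (weighted_integral (U n) \<phi> \<beta> f)\<^sup>2)
        \<le> ennreal ((weighted_integral (U n) \<phi> \<beta> (\<lambda>x. 1)) / (\<beta> - 1))
          * (energy_integral (U n) \<phi> \<beta> H\<phi> (g n))" for n
      using gP[THEN spec, of n] by - (elim conjE, assumption)+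
    note qm[measurable]
    define e where "e x = ennreal (((matrix_inv (H\<phi> x) *v grad f x) \<bullet> grad f x) * \<phi> x)" for x
    \<comment> \<open>A Borel version of \<open>e\<close> on \<Omega>. Almost everywhere on
      \<open>U n\<close> the field \<open>g n\<close> is the gradient of f, so each summand is the
      energy or 0, and the supremum glues the pieces together.\<close>
    define e' where "e' x = (SUP n. ennreal (indicator (U n) x * ((matrix_inv (H\<phi> x) *v g n x) \<bullet> g n x)) * ennreal (indicator \<Omega> x * \<phi> x))" for x
    have e'm[measurable]: "e' \<in> borel_measurable borel" unfolding e'_def[abs_def] by measurable
    have grad_g: "AE x in lborel. \<forall>n. x \<in> U n \<longrightarrow> grad f x = g n x"
      unfolding AE_all_countable
    proof
      fix n
      show "AE x in lborel. x \<in> U n \<longrightarrow> grad f x = g n x"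
        using g[of n] by eventually_elim (auto intro: grad_eq)
    qed
    have q\<phi>: "ennreal q * ennreal (\<phi> x) = ennreal (q * \<phi> x)" if "x \<in> \<Omega>" for q x
      using pos[OF that] by (intro ennreal_mult''[symmetric]) auto
    have ee': "AE x in lborel. x \<in> \<Omega> \<longrightarrow> e x = e' x"
      using grad_g
    proof eventually_elim
      case (elim x)
      show ?case
      proof
        assume x: "x \<in> \<Omega>"
        have summand: "ennreal (indicator (U n) x * ((matrix_inv (H\<phi> x) *v g n x) \<bullet> g n x)) * ennreal (indicator \<Omega> x * \<phi> x)
          = (if x \<in> U n then e x else 0)" for n
          using elim[rule_format, of n] x q\<phi>[OF x] by (simp add: e_def)
        obtain n where "x \<in> U n" using eventually_happens[OF K(4)[OF x]] by (auto simp: U_def)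
        then show "e x = e' x"
          unfolding e'_def summand by (intro antisym SUP_upper2[of n] SUP_least) auto
      qed
    qed
    define R where "R = (\<integral>\<^sup>+x. ennreal (w x) * e x \<partial>lborel)"
    have R_eq: "(\<integral>\<^sup>+x. e x \<partial>mu_beta \<Omega> \<phi> \<beta>) = ennreal (1 / Z) * R"
    proof -
      have "(\<integral>\<^sup>+x. e x \<partial>mu_beta \<Omega> \<phi> \<beta>) = (\<integral>\<^sup>+x. e' x \<partial>mu_beta \<Omega> \<phi> \<beta>)"
      proof (rule nn_integral_cong_AE)
        have "AE x in lebesgue. x \<in> \<Omega> \<longrightarrow> e x = e' x" using ee' by (rule AE_completion)
        then have "AE x in lebesgue. 0 < ennreal (w x / Z) \<longrightarrow> e x = e' x"
          by eventually_elim (auto simp: w_def indicator_def split: if_splits)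
        then show "AE x in mu_beta \<Omega> \<phi> \<beta>. e x = e' x"
          unfolding mu by (subst AE_density) auto
      qed
      also have "\<dots> = (\<integral>\<^sup>+x. ennreal (w x / Z) * e' x \<partial>lebesgue)"
        unfolding mu by (rule nn_integral_density) (auto intro: measurable_completion)
      also have "\<dots> = (\<integral>\<^sup>+x. ennreal (w x / Z) * e' x \<partial>lborel)" by (rule nn_integral_completion)
      also have "\<dots> = (\<integral>\<^sup>+x. ennreal (1 / Z) * (ennreal (w x) * e' x) \<partial>lborel)"
        using Z w0 by (intro nn_integral_cong) (simp add: mult.assoc[symmetric] ennreal_mult'[symmetric])
      also have "\<dots> = ennreal (1 / Z) * (\<integral>\<^sup>+x. ennreal (w x) * e' x \<partial>lborel)"
        by (rule nn_integral_cmult) measurable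
      also have "(\<integral>\<^sup>+x. ennreal (w x) * e' x \<partial>lborel) = R"
        unfolding R_def
        by (rule nn_integral_cong_AE, use ee' in eventually_elim) (auto simp: w_def)
      finally show ?thesis .
    qed
    \<comment> \<open>Enlarging the domain only increases the energy, so \<open>R\<close> is a
      common bound for all pieces and the limit is needed only for the moments.\<close>
    have energy_le: "(energy_integral (U n) \<phi> \<beta> H\<phi> (g n)) \<le> R" for n
      unfolding R_def
    proof (rule nn_integral_mono_AE, use grad_g in eventually_elim)
      case (elim x)
      show ?case
      proof (cases "x \<in> U n")
        case True
        then have x: "x \<in> \<Omega>" using U\<Omega> by auto
        have "\<phi> x powr (1 - \<beta>) = \<phi> x powr (- \<beta>) * \<phi> x"
          using pos[OF x] powr_add[of "\<phi> x" "- \<beta>" 1] by simp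
        then have "ennreal (\<phi> x powr (1 - \<beta>)) = ennreal (\<phi> x powr (- \<beta>)) * ennreal (\<phi> x)"
          using pos[OF x] by (simp add: ennreal_mult)
        then have "ennreal (\<phi> x powr (1 - \<beta>)) * ennreal ((matrix_inv (H\<phi> x) *v g n x) \<bullet> g n x)
          = ennreal (\<phi> x powr (- \<beta>)) * (ennreal ((matrix_inv (H\<phi> x) *v g n x) \<bullet> g n x) * ennreal (\<phi> x))"
          by (simp only: mult_ac)
        also have "\<dots> = ennreal (w x) * e x"
          using True x elim[rule_format, of n] by (simp add: w_def e_def q\<phi>[OF x])
        finally show ?thesis using True by simp
      qed simp
    qed
    have conv: "(\<lambda>n. weighted_integral (U n) \<phi> \<beta> h) \<longlonglongrightarrow> (\<integral>x. w x * h x \<partial>lborel)"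
      if int: "integrable lborel (\<lambda>x. w x * h x)" for h
    proof -
      have eq: "indicator (U n) x * \<phi> x powr (- \<beta>) * h x = indicator (U n) x * (w x * h x)" for n x
        using U\<Omega>[of n] by (auto simp: w_def indicator_def)
      have [measurable]: "(\<lambda>x. w x * h x) \<in> borel_measurable borel" using borel_measurable_integrable[OF int] by simp
      show ?thesis
        unfolding eq
      proof (rule integral_dominated_convergence[where w="\<lambda>x. norm (w x * h x)"])
        show "integrable lborel (\<lambda>x. norm (w x * h x))" using int by (rule integrable_norm)
        show "AE x in lborel. (\<lambda>n. indicator (U n) x * (w x * h x)) \<longlonglongrightarrow> w x * h x"
        proof (intro AE_I2)
          fix x
          show "(\<lambda>n. indicator (U n) x * (w x * h x)) \<longlonglongrightarrow> w x * h x"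
          proof (cases "x \<in> \<Omega>")
            case True
            show ?thesis
              by (rule tendsto_eventually, use K(4)[OF True] in eventually_elim) (simp add: U_def)
          qed (simp add: w_def)
        qed
      qed (auto simp: indicator_def)
    qed
    let ?z = "\<lambda>n. weighted_integral (U n) \<phi> \<beta> (\<lambda>x. 1)"
      and ?m1 = "\<lambda>n. weighted_integral (U n) \<phi> \<beta> f"
      and ?m2 = "\<lambda>n. weighted_integral (U n) \<phi> \<beta> (\<lambda>x. (f x)\<^sup>2)"
    define M1 where "M1 = (\<integral>x. w x * f x \<partial>lborel)"
    define M2 where "M2 = (\<integral>x. w x * (f x)\<^sup>2 \<partial>lborel)"
    have lim: "?z \<longlonglongrightarrow> Z" "?m1 \<longlonglongrightarrow> M1" "?m2 \<longlonglongrightarrow> M2"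
      using conv[of "\<lambda>x. 1"] conv[OF w1_int] conv[OF w2_int] w_int by (simp_all add: Z_def M1_def M2_def)
    have "ennreal (M2 / Z - (M1 / Z)\<^sup>2) \<le> ennreal (1 / (\<beta> - 1)) * (ennreal (1 / Z) * R)"
    proof (cases R)
      case top
      then show ?thesis using Z \<beta>1 by (simp add: ennreal_mult_top)
    next
      case (real r)
      have "?z n * ?m2 n - (?m1 n)\<^sup>2 \<le> ?z n / (\<beta> - 1) * r" for n
      proof -
        have z0: "0 \<le> ?z n" by (intro integral_nonneg_AE AE_I2) simp
        have "ennreal (?z n * ?m2 n - (?m1 n)\<^sup>2) \<le> ennreal (?z n / (\<beta> - 1)) * R"
          by (rule order_trans[OF ineq mult_left_mono[OF energy_le]]) simp
        also have "\<dots> = ennreal (?z n / (\<beta> - 1) * r)"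
          unfolding real(2) using z0 \<beta>1 real(1) by (intro ennreal_mult[symmetric] divide_nonneg_nonneg) auto
        finally show ?thesis
          using z0 \<beta>1 real(1) by (subst (asm) ennreal_le_iff) (auto intro!: mult_nonneg_nonneg divide_nonneg_nonneg)
      qed
      moreover have "(\<lambda>n. ?z n * ?m2 n - (?m1 n)\<^sup>2) \<longlonglongrightarrow> Z * M2 - M1\<^sup>2"
        by (intro tendsto_intros lim)
      moreover have "(\<lambda>n. ?z n / (\<beta> - 1) * r) \<longlonglongrightarrow> Z / (\<beta> - 1) * r"
        using \<beta>1 by (intro tendsto_intros lim) auto
      ultimately have "Z * M2 - M1\<^sup>2 \<le> Z / (\<beta> - 1) * r"
        by (intro LIMSEQ_le) auto
      \<comment> \<open>Division by \<open>Z\<^sup>2\<close> passes from the unnormalised moments to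
        those of the probability measure.\<close>
      then have "(Z * M2 - M1\<^sup>2) / Z\<^sup>2 \<le> (Z / (\<beta> - 1) * r) / Z\<^sup>2" by (rule divide_right_mono) simp
      moreover have "(Z * M2 - M1\<^sup>2) / Z\<^sup>2 = M2 / Z - (M1 / Z)\<^sup>2"
        using Z by (simp add: diff_divide_distrib power2_eq_square)
      moreover have "(Z / (\<beta> - 1) * r) / Z\<^sup>2 = 1 / (\<beta> - 1) * (1 / Z * r)"
        using Z by (simp add: power2_eq_square)
      ultimately have "ennreal (M2 / Z - (M1 / Z)\<^sup>2) \<le> ennreal (1 / (\<beta> - 1) * (1 / Z * r))" by (simp add: ennreal_leI)
      also have "\<dots> = ennreal (1 / (\<beta> - 1)) * (ennreal (1 / Z) * R)"
        unfolding real(2) using Z \<beta>1 real(1) by (subst ennreal_mult, simp, simp, subst ennreal_mult) auto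
      finally show ?thesis .
    qed
    then show ?thesis
      using R_eq unfolding I1 I2 M1_def M2_def e_def by simp
  qed
qed

end
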